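(* Let $\mathscr{C}$ be a finite-dimensional, semi-simple complex algebra. Then there exists an almost disjoint family $\mathcal{A}\subseteq[\mathbb{N}]^{\omega}$ such that the quotient algebra $\mathscr{B}(C_0(K_{\mathcal{A}}))/\mathscr{X}(C_0(K_{\mathcal{A}}))$ is isomorphic to $\mathscr{C}$.
   Context: Here the scalar field is $\mathbb{C}$. $\mathscr{B}(X)$ is the algebra of bounded operators on a Banach space $X$, and $\mathscr{X}(X)$ is the closed ideal of operators with separable range. $[\mathbb{N}]^{\omega}$ is the set of infinite subsets of $\mathbb{N}$; $\mathcal{A}\subseteq[\mathbb{N}]^{\omega}$ is almost disjoint if distinct members have finite intersection. $K_{\mathcal{A}}$ is the locally compact Hausdorff space of distinct points $\{x_n:n\in\mathbb{N}\}\cup\{y_A:A\in\mathcal{A}\}$, where each $x_n$ is isolated and the sets $\{x_n:n\in A\setminus F\}\cup\{y_A\}$, $F\subseteq\mathbb{N}$ finite, form a neighbourhood basis at $y_A$. $C_0(K)$ is the Banach space of continuous scalar-valued functions on $K$ vanishing at infinity, with the sup norm. *)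

theory Defs
  imports "HOL-Analysis.Analysis" "HOL-Algebra.Module" "HOL-Algebra.QuotRing"
begin

section \<open>Complex algebras\<close>

text \<open>
  Algebras are associative and not assumed to be unital (the class \<open>ring\<close> has no unit),
  and the zero algebra is allowed. Left ideals are therefore required to be subspaces, and the
  Jacobson radical is the intersection of the maximal modular left ideals. For a unital algebra
  every left ideal is modular, so this is the usual intersection of all maximal left ideals.
  If there are no maximal modular left ideals the radical is the whole algebra.
\<close>

locale complex_algebra = vector_space scale
  for scale :: "complex \<Rightarrow> 'a::ring \<Rightarrow> 'a" +
  assumes mult_scale_left: "scale c x * y = scale c (x * y)"
    and mult_scale_right: "x * scale c y = scale c (x * y)"
begin

definition finite_dimensional :: bool where
  "finite_dimensional \<longleftrightarrow> (\<exists>B. finite B \<and> span B = UNIV)"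

definition left_ideal :: "'a set \<Rightarrow> bool" where
  "left_ideal L \<longleftrightarrow> subspace L \<and> (\<forall>a. \<forall>x\<in>L. a * x \<in> L)"

definition modular_left_ideal :: "'a set \<Rightarrow> bool" where
  "modular_left_ideal L \<longleftrightarrow> left_ideal L \<and> (\<exists>e. \<forall>a. a - a * e \<in> L)"

definition maximal_modular_left_ideal :: "'a set \<Rightarrow> bool" where
  "maximal_modular_left_ideal L \<longleftrightarrow> modular_left_ideal L \<and> L \<noteq> UNIV \<and>
     (\<forall>M. left_ideal M \<longrightarrow> L \<subseteq> M \<longrightarrow> M = L \<or> M = UNIV)"

definition jacobson_radical :: "'a set" where
  "jacobson_radical = \<Inter> {L. maximal_modular_left_ideal L}"

definition semisimple :: bool where
  "semisimple \<longleftrightarrow> jacobson_radical = {0}"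

end


section \<open>The space \<open>K\<^sub>\<A>\<close> of an almost disjoint family\<close>

definition almost_disjoint_family :: "nat set set \<Rightarrow> bool" where
  "almost_disjoint_family \<A> \<longleftrightarrow>
     (\<forall>A\<in>\<A>. infinite A) \<and> (\<forall>A\<in>\<A>. \<forall>B\<in>\<A>. A \<noteq> B \<longrightarrow> finite (A \<inter> B))"

text \<open>The point \<open>x\<^sub>n\<close> is \<open>Inl n\<close>, and \<open>y\<^sub>A\<close> is \<open>Inr A\<close>.\<close>

definition K_points :: "nat set set \<Rightarrow> (nat + nat set) set" where
  "K_points \<A> = range Inl \<union> Inr ` \<A>"

definition K_space :: "nat set set \<Rightarrow> (nat + nat set) topology" where
  "K_space \<A> = topology (\<lambda>U. U \<subseteq> K_points \<A> \<and>
     (\<forall>A\<in>\<A>. Inr A \<in> U \<longrightarrow> (\<exists>F. finite F \<and> insert (Inr A) (Inl ` (A - F)) \<subseteq> U)))"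

lemma openin_K_space:
  "openin (K_space \<A>) U \<longleftrightarrow> U \<subseteq> K_points \<A> \<and>
     (\<forall>A\<in>\<A>. Inr A \<in> U \<longrightarrow> (\<exists>F. finite F \<and> insert (Inr A) (Inl ` (A - F)) \<subseteq> U))"
proof -
  let ?P = "\<lambda>U. U \<subseteq> K_points \<A> \<and>
     (\<forall>A\<in>\<A>. Inr A \<in> U \<longrightarrow> (\<exists>F. finite F \<and> insert (Inr A) (Inl ` (A - F)) \<subseteq> U))"
  have Int: "?P (S \<inter> T)" if S: "?P S" and T: "?P T" for S T
  proof (intro conjI ballI impI)
    show "S \<inter> T \<subseteq> K_points \<A>" using S by blast
    fix A assume A: "A \<in> \<A>" "Inr A \<in> S \<inter> T"
    obtain F where "finite F" "insert (Inr A) (Inl ` (A - F)) \<subseteq> S" using S A by blast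
    moreover obtain G where "finite G" "insert (Inr A) (Inl ` (A - G)) \<subseteq> T" using T A by blast
    ultimately show "\<exists>F. finite F \<and> insert (Inr A) (Inl ` (A - F)) \<subseteq> S \<inter> T"
      by (intro exI[of _ "F \<union> G"]) auto
  qed
  have Un: "?P (\<Union>\<K>)" if "\<forall>S\<in>\<K>. ?P S" for \<K>
  proof (intro conjI ballI impI)
    show "\<Union>\<K> \<subseteq> K_points \<A>" using that by blast
    fix A assume "A \<in> \<A>" "Inr A \<in> \<Union>\<K>"
    then obtain S where S: "S \<in> \<K>" "Inr A \<in> S" by blast
    with \<open>A \<in> \<A>\<close> that obtain F where "finite F" "insert (Inr A) (Inl ` (A - F)) \<subseteq> S"
      by meson
    with S(1) show "\<exists>F. finite F \<and> insert (Inr A) (Inl ` (A - F)) \<subseteq> \<Union>\<K>"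
      by (meson Union_upper subset_trans)
  qed
  have "istopology ?P"
    unfolding istopology_def
    by (rule conjI; intro allI impI) (erule (1) Int, erule Un)
  then show ?thesis by (simp add: K_space_def topology_inverse')
qed

lemma topspace_K_space: "topspace (K_space \<A>) = K_points \<A>"
proof -
  have "openin (K_space \<A>) (K_points \<A>)"
    by (auto simp: openin_K_space K_points_def intro!: exI[of _ "{}"])
  moreover have "topspace (K_space \<A>) \<subseteq> K_points \<A>"
    using openin_topspace[of "K_space \<A>"] unfolding openin_K_space by (rule conjunct1)
  ultimately show ?thesis by (intro subset_antisym openin_subset)
qed


section \<open>The Banach space \<open>C\<^sub>0(K)\<close>\<close>

text \<open>
  A function on the space \<open>X\<close> is represented by its extension by zero to the whole type, so that
  the elements of \<open>C0 X\<close> are determined by their values on \<open>topspace X\<close> and the supremum over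
  the type is the supremum over the space. The value \<open>0\<close> of \<open>sup_norm\<close> at unbounded functions
  is irrelevant; it makes \<open>sup_dist\<close> fit the locale \<open>Metric_space\<close>.
\<close>

definition C0 :: "'p topology \<Rightarrow> ('p \<Rightarrow> complex) set" where
  "C0 X = {f. continuous_map X euclidean f \<and>
              (\<forall>\<epsilon>>0. compactin X {x \<in> topspace X. \<epsilon> \<le> cmod (f x)}) \<and>
              (\<forall>x. x \<notin> topspace X \<longrightarrow> f x = 0)}"

definition sup_norm :: "('p \<Rightarrow> complex) \<Rightarrow> real" where
  "sup_norm f = (if bounded (range f) then (SUP x. cmod (f x)) else 0)"

definition sup_dist :: "('p \<Rightarrow> complex) \<Rightarrow> ('p \<Rightarrow> complex) \<Rightarrow> real" where
  "sup_dist f g = sup_norm (\<lambda>x. f x - g x)"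

lemma cmod_le_sup_norm: "bounded (range f) \<Longrightarrow> cmod (f x) \<le> sup_norm f"
  unfolding sup_norm_def
  by (auto intro!: cSUP_upper simp: bounded_iff bdd_above_def)

lemma sup_norm_least: "(\<And>x. cmod (f x) \<le> c) \<Longrightarrow> sup_norm f \<le> c"
  using order_trans[OF norm_ge_zero] by (auto simp: sup_norm_def intro!: cSUP_least)

lemma bounded_C0:
  assumes "f \<in> C0 X"
  shows "bounded (range f)"
proof -
  let ?S = "{x \<in> topspace X. 1 \<le> cmod (f x)}"
  have "compactin euclidean (f ` ?S)"
    using assms by (intro image_compactin) (auto simp: C0_def)
  then have "bounded (f ` ?S)" by (simp add: compact_imp_bounded)
  then obtain b where b: "\<And>x. x \<in> ?S \<Longrightarrow> cmod (f x) \<le> b"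
    by (auto simp: bounded_iff)
  have "cmod (f x) \<le> max 1 b" for x
  proof (cases "x \<in> ?S")
    case True
    then show ?thesis using b[of x] by simp
  next
    case False
    then have "cmod (f x) \<le> 1"
      using assms by (cases "x \<in> topspace X") (auto simp: C0_def)
    then show ?thesis by simp
  qed
  then show ?thesis by (auto simp: bounded_iff)
qed

lemma Metric_space_C0: "Metric_space (C0 X) sup_dist"
proof
  fix f g :: "'a \<Rightarrow> complex"
  show "0 \<le> sup_dist f g"
  proof (cases "bounded (range (\<lambda>x. f x - g x))")
    case True
    then show ?thesis
      unfolding sup_dist_def
      by (rule order_trans[OF norm_ge_zero cmod_le_sup_norm[of _ undefined]])
  qed (simp add: sup_dist_def sup_norm_def)
  have "bounded (range (\<lambda>x. g x - f x)) = bounded (range (\<lambda>x. f x - g x))"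
    by (simp add: bounded_iff norm_minus_commute)
  then show "sup_dist f g = sup_dist g f"
    by (simp add: sup_dist_def sup_norm_def norm_minus_commute)
next
  fix f g assume "f \<in> C0 X" "g \<in> C0 X"
  then have "bounded (range (\<lambda>x. f x - g x))"
    by (intro bounded_minus_comp bounded_C0)
  then have "cmod (f x - g x) \<le> sup_dist f g" for x
    unfolding sup_dist_def using cmod_le_sup_norm[of "\<lambda>x. f x - g x"] by simp
  then show "(sup_dist f g = 0) = (f = g)"
    by (auto simp: sup_dist_def sup_norm_def fun_eq_iff)
next
  fix f g h assume *: "f \<in> C0 X" "g \<in> C0 X" "h \<in> C0 X"
  have "bounded (range (\<lambda>x. f x - g x))" "bounded (range (\<lambda>x. g x - h x))"
    using * bounded_C0 by (blast intro: bounded_minus_comp)+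
  then have "cmod (f x - h x) \<le> sup_dist f g + sup_dist g h" for x
    unfolding sup_dist_def
    using cmod_le_sup_norm[of "\<lambda>x. f x - g x" x] cmod_le_sup_norm[of "\<lambda>x. g x - h x" x]
      norm_triangle_ineq[of "f x - g x" "g x - h x"] by simp
  then show "sup_dist f h \<le> sup_dist f g + sup_dist g h"
    unfolding sup_dist_def[of f h] by (rule sup_norm_least)
qed


section \<open>Operators on \<open>C\<^sub>0(K)\<close>\<close>

text \<open>
  An operator on \<open>C0 X\<close> is extended by zero to all functions, so that operators are determined
  by their values on \<open>C0 X\<close> and composition of operators is \<open>(\<circ>)\<close>.
\<close>

definition bounded_operators ::
    "'p topology \<Rightarrow> (('p \<Rightarrow> complex) \<Rightarrow> ('p \<Rightarrow> complex)) set" where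
  "bounded_operators X = {T.
     (\<forall>f\<in>C0 X. T f \<in> C0 X) \<and>
     (\<forall>f\<in>C0 X. \<forall>g\<in>C0 X. T (\<lambda>x. f x + g x) = (\<lambda>x. T f x + T g x)) \<and>
     (\<forall>c. \<forall>f\<in>C0 X. T (\<lambda>x. c * f x) = (\<lambda>x. c * T f x)) \<and>
     (\<exists>b. \<forall>f\<in>C0 X. sup_norm (T f) \<le> b * sup_norm f) \<and>
     (\<forall>f. f \<notin> C0 X \<longrightarrow> T f = (\<lambda>x. 0))}"

definition operator_algebra ::
    "'p topology \<Rightarrow> (complex, ('p \<Rightarrow> complex) \<Rightarrow> ('p \<Rightarrow> complex)) module" where
  "operator_algebra X =
     \<lparr>carrier = bounded_operators X,
      mult = (\<circ>),
      one = (\<lambda>f. if f \<in> C0 X then f else (\<lambda>x. 0)),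
      zero = (\<lambda>f x. 0),
      add = (\<lambda>S T f x. S f x + T f x),
      smult = (\<lambda>c T f x. c * T f x)\<rparr>"

definition separable_range_operators ::
    "'p topology \<Rightarrow> (('p \<Rightarrow> complex) \<Rightarrow> ('p \<Rightarrow> complex)) set" where
  "separable_range_operators X = {T \<in> bounded_operators X.
     separable_space (subtopology (Metric_space.mtopology (C0 X) sup_dist) (T ` C0 X))}"


section \<open>Quotient algebras and isomorphism\<close>

text \<open>
  The quotient ring of the library, with the induced scalar multiplication; as for
  \<open>rcoset_mult\<close>, the union is over cosets which all coincide.
\<close>

definition quotient_algebra :: "('k, 'b) module \<Rightarrow> 'b set \<Rightarrow> ('k, 'b set) module" where
  "quotient_algebra R I =
     ring.extend (R Quot I)
       (module.fields (\<lambda>c U. \<Union>a\<in>U. I +>\<^bsub>R\<^esub> (c \<odot>\<^bsub>R\<^esub> a)))"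

definition (in complex_algebra) algebra_isomorphism :: 
    "(complex, 'b) module \<Rightarrow> ('b \<Rightarrow> 'a) \<Rightarrow> bool" where
  "algebra_isomorphism R \<phi> \<longleftrightarrow>
     bij_betw \<phi> (carrier R) UNIV \<and>
     (\<forall>u\<in>carrier R. \<forall>v\<in>carrier R. \<phi> (u \<oplus>\<^bsub>R\<^esub> v) = \<phi> u + \<phi> v) \<and>
     (\<forall>u\<in>carrier R. \<forall>v\<in>carrier R. \<phi> (u \<otimes>\<^bsub>R\<^esub> v) = \<phi> u * \<phi> v) \<and>
     (\<forall>c. \<forall>u\<in>carrier R. \<phi> (c \<odot>\<^bsub>R\<^esub> u) = scale c (\<phi> u))"

end

theory Submission
  imports Defs "HOL-Computational_Algebra.Fundamental_Theorem_Algebra"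
begin

text \<open>
  Identify \<open>C\<^sub>0(K\<^sub>\<A>)\<close> with the closed linear span of \<open>c\<^sub>0\<close> and the indicator functions \<open>1\<^sub>A\<close>, \<open>A \<in> \<A>\<close>,
  in \<open>\<ell>\<^sub>\<infinity>\<close>. An operator agrees with the matrix of its restriction to \<open>c\<^sub>0\<close> at all but countably many
  \<open>1\<^sub>A\<close>, since a functional vanishing on \<open>c\<^sub>0\<close> is absolutely summable over the \<open>1\<^sub>A\<close>; and up to an
  operator with separable range the columns of the matrix tend to zero. There are only continuum many
  such matrices \<open>M\<close>, so they can be ruined one by one in a transfinite recursion. The sets in \<open>\<A>\<close> are
  unions of two branches of a fixed almost disjoint family of size continuum, and at each stage unused
  branches are chosen such that, if possible, \<open>M 1\<^sub>A\<close> is not in the space for some new set \<open>A\<close>. If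
  this is impossible, then comparing the limits of \<open>M 1\<^sub>A\<close> along the available branches shows that \<open>M\<close>
  acts on branches as a scalar modulo \<open>c\<^sub>0\<close>, outside a countable union of \<open>G\<^sub>\<delta>\<close> sets of cardinality
  less than the continuum, which is countable by the perfect set theorem.

  Running the recursion for countably many families \<open>P i\<close> at once, with no operators of non-separable
  range between different ones, and placing several copies of each \<open>P i\<close> on disjoint copies of \<open>\<nat>\<close>
  turns the quotient algebra into a direct sum of full matrix algebras with prescribed sizes. By the
  Wedderburn--Artin theorem every semisimple algebra of finite dimension has this form.
\<close>

section \<open>Sets of reals of cardinality less than the continuum\<close>

unbundle cardinal_syntax

text \<open>Unions of two branches are what forces scalars. With single branches, multiplication by
  \<psi>(j / n) at the code of (n, j), for bounded continuous \<psi>, would converge to \<psi>(x)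
  along \<open>branch x\<close> and act on the space with a non-constant multiplier.

  Countability is the threshold that the quotient can see: a range is separable exactly when the
  limits of its functions at the points y_A are carried by countably many A. The recursion alone
  controls exceptions only up to fewer than continuum many, because at a given stage each of the
  earlier branches may account for countably many of them. Without the continuum hypothesis this is
  weaker, and the detour through G_delta sets closes the gap. It is also why branches are indexed by
  reals: a row sum has to be a continuous function of the index.\<close>

definition small :: "'a set \<Rightarrow> bool" where
  "small S \<longleftrightarrow> |S| <o |UNIV :: real set|"

lemma small_subset: "small T \<Longrightarrow> S \<subseteq> T \<Longrightarrow> small S"
  unfolding small_def by (meson card_of_mono1 ordLeq_ordLess_trans)

lemma countable_small:
  assumes "countable S" shows "small S"
proof -
  have "\<not> |UNIV :: real set| \<le>o |S|"
  proof
    assume "|UNIV :: real set| \<le>o |S|"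
    then obtain f :: "real \<Rightarrow> 'a" where "inj f" "range f \<subseteq> S"
      using card_of_ordLeq[of "UNIV :: real set" S] by auto
    then have "countable (UNIV :: real set)"
      using countable_image_inj_on[of f UNIV] countable_subset[OF _ assms] by auto
    then show False using uncountable_UNIV_real by blast
  qed
  then show ?thesis unfolding small_def using not_ordLeq_iff_ordLess[OF card_of_Well_order card_of_Well_order] by auto
qed

text \<open>Countable pieces do not raise the cardinality of an infinite index set, so the argument
  works whatever the cofinality of the continuum.\<close>

lemma small_UN_countable:
  assumes "small I" and "\<And>i. i \<in> I \<Longrightarrow> countable (F i)"
  shows "small (\<Union>i\<in>I. F i)"
proof (cases "countable I")
  case True
  then show ?thesis using assms by (intro countable_small) auto
next
  case False
  then have inf: "infinite I" using countable_finite by blast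
  have "|F i| \<le>o |I|" if i: "i \<in> I" for i
  proof -
    have "|F i| \<le>o |UNIV :: nat set|"
    proof -
      obtain f :: "'b \<Rightarrow> nat" where "inj_on f (F i)"
        using assms(2)[OF i] countable_def by blast
      then show ?thesis using card_of_ordLeq[of "F i" UNIV] by blast
    qed
    also have "|UNIV :: nat set| \<le>o |I|"
      using inf infinite_iff_card_of_nat[of I] by simp
    finally show ?thesis .
  qed
  then have "|\<Union>i\<in>I. F i| \<le>o |I|"
    using inf card_of_UNION_ordLeq_infinite[OF inf ordLeq_refl[OF card_of_Card_order]] by auto
  then show ?thesis using assms(1) unfolding small_def by (meson ordLeq_ordLess_trans)
qed

lemma small_Un:
  assumes "small S" "small T" shows "small (S \<union> T)"
proof -
  have inf: "infinite (UNIV :: real set)" by (simp add: infinite_UNIV_char_0)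
  show ?thesis
    using card_of_Un_ordLess_infinite[OF inf, of S T] assms unfolding small_def by simp
qed

lemma small_obtain:
  assumes "small (S :: real set)" "\<not> small T"
  obtains x where "x \<in> T" "x \<notin> S"
proof -
  have "\<not> T \<subseteq> S" using small_subset[OF assms(1)] assms(2) by auto
  then show thesis using that by auto
qed

lemma lepoll_not_small:
  assumes "(UNIV :: real set) \<lesssim> S" shows "\<not> small S"
proof -
  have "|UNIV :: real set| \<le>o |S|"
    using assms unfolding lepoll_def card_of_ordLeq[symmetric] by simp
  then show ?thesis unfolding small_def using not_ordLess_ordLeq[of "|S|"] by auto
qed

lemma not_small_UNIV: "\<not> small (UNIV :: real set)"
  by (rule lepoll_not_small) (rule lepoll_refl)

text \<open>Cantor-Bendixson: a G_delta set is completely metrizable, and after discarding its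
  countable basic open pieces it is perfect; a nonempty perfect set there has at least continuum
  many points.\<close>

lemma uncountable_gdelta_not_small:
  fixes G :: "real set"
  assumes "gdelta_in euclidean G" and "uncountable G"
  shows "\<not> small G"
proof -
  let ?X = "subtopology euclidean G"
  have cm: "completely_metrizable_space ?X"
    by (rule completely_metrizable_space_gdelta_in[OF completely_metrizable_space_euclidean assms(1)])
  obtain \<B> :: "real set set" where cB: "countable \<B>" and tB: "topological_basis \<B>"
    using ex_countable_basis by blast
  have \<B>: "\<And>B. B \<in> \<B> \<Longrightarrow> open B" "\<And>U x. open U \<Longrightarrow> x \<in> U \<Longrightarrow> \<exists>B\<in>\<B>. x \<in> B \<and> B \<subseteq> U"
    subgoal using topological_basis_open[OF tB] by simp
    subgoal premises prems for U x
      by (rule topological_basisE[OF tB prems]) auto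
    done
  \<comment> \<open>A countable basis makes the discarded part countable; \<open>P\<close> consists
    of the condensation points of \<open>G\<close>.\<close>
  define N where "N = (\<Union>B\<in>{B \<in> \<B>. countable (B \<inter> G)}. B \<inter> G)"
  define P where "P = G - N"
  have cN: "countable N"
    unfolding N_def using cB by (intro countable_UN) auto
  have big: "uncountable (U \<inter> G)" if U: "open U" "x \<in> U" and xP: "x \<in> P" for U x
  proof
    assume c: "countable (U \<inter> G)"
    obtain B where B: "B \<in> \<B>" "x \<in> B" "B \<subseteq> U" using \<B>(2)[OF U] by auto
    then have "countable (B \<inter> G)" by (intro countable_subset[OF _ c]) auto
    with B show False using xP unfolding P_def N_def by auto
  qed
  have "?X derived_set_of P = P"
  proof (intro equalityI subsetI)
    fix x assume x: "x \<in> ?X derived_set_of P"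
    then have xG: "x \<in> G" by (simp add: in_derived_set_of)
    have "x \<notin> N"
    proof
      assume "x \<in> N"
      then obtain B where B: "B \<in> \<B>" "countable (B \<inter> G)" "x \<in> B" unfolding N_def by auto
      have "openin ?X (B \<inter> G)" using \<B>(1)[OF B(1)] by (auto simp: openin_subtopology)
      then obtain y where "y \<in> P" "y \<in> B \<inter> G" using x B xG unfolding in_derived_set_of by auto
      then show False using B unfolding P_def N_def by auto
    qed
    then show "x \<in> P" using xG unfolding P_def by blast
  next
    fix x assume x: "x \<in> P"
    show "x \<in> ?X derived_set_of P"
      unfolding in_derived_set_of
    proof (intro conjI allI impI)
      show "x \<in> topspace ?X" using x unfolding P_def by auto
      fix T assume T: "x \<in> T \<and> openin ?X T"
      then obtain U where U: "open U" "T = U \<inter> G" unfolding openin_subtopology by auto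
      then have "uncountable T"
        using big[OF U(1) _ x] T by simp
      then have "uncountable (T - (N \<union> {x}))"
        using cN by (intro uncountable_minus_countable) auto
      then have "T - (N \<union> {x}) \<noteq> {}" by (metis countable_empty)
      then obtain y where "y \<in> T - (N \<union> {x})" by blast
      then show "\<exists>y. y \<noteq> x \<and> y \<in> P \<and> y \<in> T" unfolding P_def using U by blast
    qed
  qed
  moreover have "P \<noteq> {}"
    using uncountable_minus_countable[OF assms(2) cN] unfolding P_def by (metis countable_empty)
  ultimately have "(UNIV :: real set) \<lesssim> P"
    using lepoll_perfect_set[OF disjI1[OF cm]] by simp
  then have "\<not> small P" by (rule lepoll_not_small)
  then show ?thesis using small_subset[of G P] unfolding P_def by auto
qed

text \<open>Convergence along this filter is continuity at the point y_A, and
  \<open>eventually_along\<close> turns it into finiteness of an exceptional set.\<close>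

abbreviation along :: "nat set \<Rightarrow> nat filter" where
  "along A \<equiv> inf sequentially (principal A)"

lemma eventually_along:
  "eventually P (along A) \<longleftrightarrow> finite {n \<in> A. \<not> P n}"
proof -
  have "eventually P (along A) \<longleftrightarrow> eventually (\<lambda>n. n \<in> A \<longrightarrow> P n) sequentially"
    by (simp add: eventually_inf_principal)
  also have "\<dots> \<longleftrightarrow> finite {n. \<not> (n \<in> A \<longrightarrow> P n)}"
    by (simp add: eventually_cofinite flip: cofinite_eq_sequentially)
  finally show ?thesis by (simp add: Collect_conj_eq)
qed

lemma eventually_sequentially_finite:
  "eventually P sequentially \<longleftrightarrow> finite {n :: nat. \<not> P n}"
  by (simp add: eventually_cofinite flip: cofinite_eq_sequentially)

lemma along_nontrivial: "infinite A \<Longrightarrow> along A \<noteq> bot"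
  using eventually_along[of "\<lambda>_. False" A] by (auto simp: eventually_False)

lemma along_mono: "A \<subseteq> B \<Longrightarrow> along A \<le> along B"
  by (intro inf_mono) auto

section \<open>Branches and row sums\<close>

text \<open>The graph of the map taking n to the integer part of n x. Distinct reals separate once n
  exceeds 1 / |x - y|, which gives almost disjointness, and membership of a fixed code is locally
  constant at irrational x.\<close>

definition branch :: "real \<Rightarrow> nat set" where
  "branch x = range (\<lambda>n. prod_encode (n, int_encode \<lfloor>real n * x\<rfloor>))"

lemma mem_branch:
  "k \<in> branch x \<longleftrightarrow> \<lfloor>real (fst (prod_decode k)) * x\<rfloor> = int_decode (snd (prod_decode k))"
proof
  assume "k \<in> branch x"
  then show "\<lfloor>real (fst (prod_decode k)) * x\<rfloor> = int_decode (snd (prod_decode k))"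
    unfolding branch_def by auto
next
  assume "\<lfloor>real (fst (prod_decode k)) * x\<rfloor> = int_decode (snd (prod_decode k))"
  then have "k = prod_encode (fst (prod_decode k), int_encode \<lfloor>real (fst (prod_decode k)) * x\<rfloor>)"
    by simp
  then show "k \<in> branch x" unfolding branch_def by blast
qed

lemma infinite_branch: "infinite (branch x)"
  unfolding branch_def
  by (intro range_inj_infinite injI) simp

lemma finite_branch_Int:
  assumes "x \<noteq> y" shows "finite (branch x \<inter> branch y)"
proof (rule finite_subset)
  let ?f = "\<lambda>n. prod_encode (n, int_encode \<lfloor>real n * x\<rfloor>)"
  show "branch x \<inter> branch y \<subseteq> ?f ` {n. n \<le> nat \<lceil>1 / \<bar>x - y\<bar>\<rceil>}"
  proof
    fix k assume k: "k \<in> branch x \<inter> branch y"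
    then obtain n where n: "k = ?f n" unfolding branch_def by blast
    have "\<lfloor>real n * x\<rfloor> = \<lfloor>real n * y\<rfloor>" using k n unfolding Int_iff mem_branch by simp
    then have "\<bar>real n * x - real n * y\<bar> < 1" by linarith
    then have "real n * \<bar>x - y\<bar> < 1" by (simp add: abs_mult flip: right_diff_distrib)
    then have "real n < 1 / \<bar>x - y\<bar>" using assms by (simp add: field_simps)
    then have "n \<le> nat \<lceil>1 / \<bar>x - y\<bar>\<rceil>" by linarith
    then show "k \<in> ?f ` {n. n \<le> nat \<lceil>1 / \<bar>x - y\<bar>\<rceil>}" using n by blast
  qed
qed auto

text \<open>The integer part of n x jumps only where n x is an integer, hence at rational x, except
  for n = 0, where it is constant.\<close>

lemma continuous_on_branch:
  "continuous_on (- \<rat>) (\<lambda>x. of_bool (k \<in> branch x) :: complex)"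
  unfolding continuous_on_def
proof
  fix x :: real assume x: "x \<in> - \<rat>"
  let ?n = "fst (prod_decode k)"
  have "\<forall>\<^sub>F z in at x within - \<rat>. \<lfloor>real ?n * z\<rfloor> = \<lfloor>real ?n * x\<rfloor>"
  proof (cases "?n = 0")
    case False
    have "real ?n * x \<notin> \<int>"
    proof
      assume "real ?n * x \<in> \<int>"
      then have "(real ?n * x) / real ?n \<in> \<rat>" using Ints_subset_Rats by (intro Rats_divide) auto
      then show False using x False by simp
    qed
    moreover have "((\<lambda>z. real ?n * z) \<longlongrightarrow> real ?n * x) (at x within - \<rat>)"
      by (intro tendsto_intros)
    ultimately show ?thesis by (intro eventually_floor_eq)
  qed simp
  then have "\<forall>\<^sub>F z in at x within - \<rat>. (of_bool (k \<in> branch z) :: complex) = of_bool (k \<in> branch x)"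
    by eventually_elim (simp add: mem_branch)
  then show "((\<lambda>x. of_bool (k \<in> branch x) :: complex) \<longlongrightarrow> of_bool (k \<in> branch x)) (at x within - \<rat>)"
    by (rule tendsto_eventually)
qed

text \<open>This is the sequence M 1_A, the matrix applied to the indicator function of
  \<open>A\<close>.\<close>

definition row_sum :: "(nat \<Rightarrow> nat \<Rightarrow> complex) \<Rightarrow> nat set \<Rightarrow> nat \<Rightarrow> complex" where
  "row_sum M A n = (\<Sum>\<^sub>\<infinity>k\<in>A. M n k)"

abbreviation acts_as_scalar :: "(nat \<Rightarrow> nat \<Rightarrow> complex) \<Rightarrow> complex \<Rightarrow> nat set \<Rightarrow> bool" where
  "acts_as_scalar M l A \<equiv> (\<lambda>n. row_sum M A n - l * of_bool (n \<in> A)) \<longlonglongrightarrow> 0"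

locale row_bounded =
  fixes M :: "nat \<Rightarrow> nat \<Rightarrow> complex" and b :: real
  assumes rows: "finite F \<Longrightarrow> (\<Sum>k\<in>F. cmod (M n k)) \<le> b"
begin

lemma abs_summable: "(\<lambda>k. cmod (M n k)) summable_on A"
  by (rule nonneg_bdd_above_summable_on) (auto intro!: bdd_aboveI2[of _ _ b] rows)

lemma summable: "M n summable_on A"
  using abs_summable abs_summable_summable by blast

lemma norm_row_sum_le: "cmod (row_sum M A n) \<le> (\<Sum>\<^sub>\<infinity>k\<in>A. cmod (M n k))"
  unfolding row_sum_def by (rule norm_infsum_bound) (rule abs_summable)

lemma abs_row_sum_le: "(\<Sum>\<^sub>\<infinity>k\<in>A. cmod (M n k)) \<le> b"
  by (rule infsum_le_finite_sums) (use abs_summable rows in auto)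

lemma row_sum_Un_disjoint: "A \<inter> B = {} \<Longrightarrow> row_sum M (A \<union> B) n = row_sum M A n + row_sum M B n"
  unfolding row_sum_def by (intro infsum_Un_disjoint summable)

lemma row_sum_finite: "finite A \<Longrightarrow> row_sum M A n = (\<Sum>k\<in>A. M n k)"
  unfolding row_sum_def by simp

lemma row_sum_split:
  assumes "finite O'"
  shows "row_sum M A n = row_sum M (A - O') n + (\<Sum>k\<in>A \<inter> O'. M n k)"
proof -
  have "row_sum M ((A - O') \<union> (A \<inter> O')) n = row_sum M (A - O') n + row_sum M (A \<inter> O') n"
    by (rule row_sum_Un_disjoint) auto
  moreover have "(A - O') \<union> (A \<inter> O') = A" by auto
  ultimately show ?thesis using assms by (simp add: row_sum_finite)
qed

text \<open>Disjoint sets of columns share the absolute mass of one row, which is at most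
  \<open>b\<close>. The l1 bounds on limits further on come from here.\<close>

lemma sum_disjoint_row_sums_le:
  assumes "finite I" "disjoint_family_on A I"
  shows "(\<Sum>i\<in>I. cmod (row_sum M (A i) n)) \<le> b"
proof -
  have "(\<Sum>i\<in>I. cmod (row_sum M (A i) n)) \<le> (\<Sum>i\<in>I. \<Sum>\<^sub>\<infinity>k\<in>A i. cmod (M n k))"
    by (rule sum_mono) (rule norm_row_sum_le)
  also have "\<dots> = (\<Sum>\<^sub>\<infinity>k\<in>(\<Union>i\<in>I. A i). cmod (M n k))"
    using assms
  proof (induction I rule: finite_induct)
    case (insert i I)
    then have d: "A i \<inter> (\<Union>j\<in>I. A j) = {}" "disjoint_family_on A I"
      by (force simp: disjoint_family_on_def, simp add: disjoint_family_on_def)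
    have "(\<Sum>\<^sub>\<infinity>k\<in>A i \<union> (\<Union>j\<in>I. A j). cmod (M n k))
        = (\<Sum>\<^sub>\<infinity>k\<in>A i. cmod (M n k)) + (\<Sum>\<^sub>\<infinity>k\<in>(\<Union>j\<in>I. A j). cmod (M n k))"
      by (intro infsum_Un_disjoint abs_summable d)
    then show ?case using insert.hyps insert.IH[OF d(2)] by simp
  qed simp
  also have "\<dots> \<le> b" by (rule abs_row_sum_le)
  finally show ?thesis .
qed

text \<open>The row is absolutely summable, so by the M-test its finite partial sums converge
  uniformly in \<open>x\<close>.\<close>

lemma continuous_on_row_sum: "continuous_on (- \<rat>) (\<lambda>x. row_sum M (branch x) n)"
proof -
  have "uniform_limit (- \<rat>) (\<lambda>F x. \<Sum>k\<in>F. M n k * of_bool (k \<in> branch x))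
      (\<lambda>x. \<Sum>\<^sub>\<infinity>k. M n k * of_bool (k \<in> branch x)) (finite_subsets_at_top UNIV)"
    by (rule Weierstrass_m_test_general[where M = "\<lambda>k. cmod (M n k)"]) (use abs_summable in \<open>auto simp: norm_mult\<close>)
  then have "continuous_on (- \<rat>) (\<lambda>x. \<Sum>\<^sub>\<infinity>k. M n k * of_bool (k \<in> branch x))"
    by (rule uniform_limit_theorem[rotated])
      (auto intro!: always_eventually continuous_intros continuous_on_branch)
  moreover have "row_sum M (branch x) n = (\<Sum>\<^sub>\<infinity>k. M n k * of_bool (k \<in> branch x))" for x
    unfolding row_sum_def by (rule infsum_cong_neutral) auto
  ultimately show ?thesis by simp
qed

end

text \<open>Reduces almost disjoint sets to disjoint ones: for a matrix with null columns, deleting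
  the finite set \<open>O'\<close> alters row sums only by null sequences.\<close>

lemma finite_pairwise_overlap:
  assumes "finite I" "\<And>i j. i \<in> I \<Longrightarrow> j \<in> I \<Longrightarrow> i \<noteq> j \<Longrightarrow> finite (A i \<inter> A j)"
  obtains O' where "finite O'" "disjoint_family_on (\<lambda>i. A i - O') I"
proof
  let ?O = "\<Union>i\<in>I. \<Union>j\<in>I - {i}. A i \<inter> A j"
  show "finite ?O" by (intro finite_UN_I finite_Diff assms) auto
  show "disjoint_family_on (\<lambda>i. A i - ?O) I" unfolding disjoint_family_on_def by auto
qed

lemma countable_nonzero_of_sum_le:
  fixes d :: "'a \<Rightarrow> complex"
  assumes "\<And>X. finite X \<Longrightarrow> X \<subseteq> S \<Longrightarrow> (\<Sum>x\<in>X. cmod (d x)) \<le> c"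
  shows "countable {x \<in> S. d x \<noteq> 0}"
proof -
  have "(\<lambda>x. cmod (d x)) summable_on S"
    by (rule nonneg_bdd_above_summable_on) (auto intro!: bdd_aboveI2[of _ _ c] assms)
  then show ?thesis by (rule abs_summable_countable)
qed

text \<open>These are the matrices of the bounded operators on c_0.\<close>

locale c0_matrix = row_bounded +
  assumes cols: "(\<lambda>n. M n k) \<longlonglongrightarrow> 0"

context c0_matrix
begin

lemma row_sum_minus_finite:
  assumes "finite O'"
  shows "(\<lambda>n. row_sum M A n - row_sum M (A - O') n) \<longlonglongrightarrow> 0"
proof -
  have "(\<lambda>n. \<Sum>k\<in>A \<inter> O'. M n k) \<longlonglongrightarrow> (\<Sum>k\<in>A \<inter> O'. 0)"
    by (intro tendsto_sum cols)
  then show ?thesis using row_sum_split[OF assms, of A] by simp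
qed

lemma row_sum_Un_almost_disjoint:
  assumes "finite (A \<inter> B)"
  shows "(\<lambda>n. row_sum M (A \<union> B) n - (row_sum M A n + row_sum M B n)) \<longlonglongrightarrow> 0"
proof -
  have "row_sum M (A \<union> B) n = row_sum M A n + row_sum M (B - A \<inter> B) n" for n
    using row_sum_Un_disjoint[of A "B - A \<inter> B" n] by (simp add: Un_Diff_Int Diff_Int)
  then show ?thesis
    using tendsto_minus[OF row_sum_minus_finite[OF assms, of B]] by (simp add: algebra_simps)
qed

text \<open>The bound for disjoint sets, with the null sequences caused by the finite overlaps
  absorbed in the extra 1.\<close>

lemma eventually_sum_row_sums_le:
  assumes "finite I" "\<And>i j. i \<in> I \<Longrightarrow> j \<in> I \<Longrightarrow> i \<noteq> j \<Longrightarrow> finite (A i \<inter> A j)"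
  shows "\<forall>\<^sub>F n in sequentially. (\<Sum>i\<in>I. cmod (row_sum M (A i) n)) \<le> b + 1"
proof -
  obtain O' where O: "finite O'" "disjoint_family_on (\<lambda>i. A i - O') I"
    using finite_pairwise_overlap[OF assms(1), of A] assms(2) by auto
  have "(\<lambda>n. \<Sum>i\<in>I. cmod (row_sum M (A i) n - row_sum M (A i - O') n)) \<longlonglongrightarrow> (\<Sum>i\<in>I. 0)"
    by (intro tendsto_sum tendsto_norm_zero row_sum_minus_finite O)
  then have "\<forall>\<^sub>F n in sequentially. (\<Sum>i\<in>I. cmod (row_sum M (A i) n - row_sum M (A i - O') n)) < 1"
    by (simp add: order_tendsto_iff)
  then show ?thesis
  proof eventually_elim
    case (elim n)
    have "(\<Sum>i\<in>I. cmod (row_sum M (A i) n))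
        \<le> (\<Sum>i\<in>I. cmod (row_sum M (A i - O') n) + cmod (row_sum M (A i) n - row_sum M (A i - O') n))"
      by (intro sum_mono) (metis norm_triangle_sub)
    also have "\<dots> \<le> b + 1"
      using elim sum_disjoint_row_sums_le[OF assms(1) O(2), of n] by (simp add: sum.distrib)
    finally show ?case .
  qed
qed

text \<open>All images are observed along the same \<open>B\<close>, so the row bound survives the
  passage to the limit. As it does not depend on \<open>I\<close>, only countably many limits at one
  point can be nonzero.\<close>

lemma sum_limits_le:
  assumes "finite I" "\<And>i j. i \<in> I \<Longrightarrow> j \<in> I \<Longrightarrow> i \<noteq> j \<Longrightarrow> finite (A i \<inter> A j)"
    and "infinite B" "\<And>i. i \<in> I \<Longrightarrow> (row_sum M (A i) \<longlongrightarrow> d i) (along B)"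
  shows "(\<Sum>i\<in>I. cmod (d i)) \<le> b + 1"
proof (rule tendsto_upperbound)
  show "((\<lambda>n. \<Sum>i\<in>I. cmod (row_sum M (A i) n)) \<longlongrightarrow> (\<Sum>i\<in>I. cmod (d i))) (along B)"
    by (intro tendsto_sum tendsto_norm assms)
  show "\<forall>\<^sub>F n in along B. (\<Sum>i\<in>I. cmod (row_sum M (A i) n)) \<le> b + 1"
    using eventually_sum_row_sums_le[OF assms(1,2)] by (rule filter_leD[rotated]) auto
  show "along B \<noteq> bot" by (rule along_nontrivial) fact
qed

lemma countable_nonzero_limits:
  assumes "\<And>i j. i \<in> I \<Longrightarrow> j \<in> I \<Longrightarrow> i \<noteq> j \<Longrightarrow> finite (A i \<inter> A j)"
    and "infinite B" "\<And>i. i \<in> I \<Longrightarrow> (row_sum M (A i) \<longlongrightarrow> d i) (along B)"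
  shows "countable {i \<in> I. d i \<noteq> 0}"
proof (rule countable_nonzero_of_sum_le)
  fix X assume "finite X" "X \<subseteq> I"
  then show "(\<Sum>i\<in>X. cmod (d i)) \<le> b + 1"
    using assms by (intro sum_limits_le[of X A B d]) (auto simp: subset_iff)
qed

text \<open>
  The set of exceptional branches is a countable union of \<open>G\<^sub>\<delta>\<close> sets, because the row sums depend
  continuously on the branch.
\<close>

lemma small_or_countable:
  fixes l :: complex
  defines "D \<equiv> {x \<in> - \<rat>. \<not> acts_as_scalar M l (branch x)}"
  assumes "small D"
  shows "countable D"
proof -
  define h where "h x n = row_sum M (branch x) n - l * of_bool (n \<in> branch x)" for x n
  have D: "D = {x \<in> - \<rat>. \<not> h x \<longlonglongrightarrow> 0}"
    unfolding D_def h_def ..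
  \<comment> \<open>An upper limit bounded away from zero is an infinitely-often condition on sets
    that are open in the irrationals.\<close>
  define G where "G m = {x \<in> - \<rat>. \<forall>N. \<exists>n\<ge>N. inverse (real (Suc m)) < cmod (h x n)}" for m
  have gd: "gdelta_in euclidean (G m)" for m
  proof -
    define c where "c = inverse (real (Suc m))"
    have op: "\<exists>T. open T \<and> (\<forall>x\<in>- \<rat>. c < cmod (h x n) \<longleftrightarrow> x \<in> T)" for n
    proof -
      let ?V = "- \<rat> \<inter> (\<lambda>x. cmod (h x n)) -` {c<..}"
      have "continuous_on (- \<rat>) (\<lambda>x. cmod (h x n))"
        unfolding h_def by (intro continuous_intros continuous_on_row_sum continuous_on_branch)
      then have "openin (top_of_set (- \<rat>)) ?V"
        by (intro continuous_openin_preimage_gen) auto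
      then obtain T where T: "open T" "?V = - \<rat> \<inter> T"
        unfolding openin_open by auto
      have "c < cmod (h x n) \<longleftrightarrow> x \<in> T" if "x \<in> - \<rat>" for x
      proof -
        have "c < cmod (h x n) \<longleftrightarrow> x \<in> ?V" using that by simp
        also have "\<dots> \<longleftrightarrow> x \<in> T" unfolding T(2) using that by simp
        finally show ?thesis .
      qed
      then show ?thesis using T(1) by auto
    qed
    obtain T where T: "\<And>n. open (T n)" "\<And>n x. x \<notin> \<rat> \<Longrightarrow> c < cmod (h x n) \<longleftrightarrow> x \<in> T n"
      using op by (metis ComplI)
    \<comment> \<open>The irrationals are a countable intersection of open sets, which turns the
      relative condition into a G_delta set of the line.\<close>
    have "G m = (\<Inter>N. \<Union>n\<in>{N..}. T n) \<inter> (\<Inter>q\<in>\<rat>. - {q})" (is "_ = ?R")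
    proof (intro Set.set_eqI)
      fix x
      show "x \<in> G m \<longleftrightarrow> x \<in> ?R"
      proof (cases "x \<in> \<rat>")
        case True
        then show ?thesis unfolding G_def by simp
      next
        case False
        then have "x \<in> G m \<longleftrightarrow> (\<forall>N. \<exists>n\<ge>N. x \<in> T n)" unfolding G_def c_def[symmetric] by (simp add: T(2))
        also have "\<dots> \<longleftrightarrow> x \<in> ?R" using False by auto
        finally show ?thesis .
      qed
    qed
    moreover have "gdelta_in euclidean (\<Inter>N. \<Union>n\<in>{N..}. T n)"
      by (rule gdelta_in_Inter) (auto intro!: open_imp_gdelta_in open_UN T)
    moreover have "gdelta_in euclidean (\<Inter>q\<in>(\<rat>::real set). - {q})"
      by (rule gdelta_in_Inter) (auto intro!: open_imp_gdelta_in countable_image countable_rat)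
    ultimately show ?thesis by (metis gdelta_in_Int)
  qed
  have "D \<subseteq> (\<Union>m. G m)"
  proof
    fix x assume x: "x \<in> D"
    then obtain e where e: "e > 0" "\<forall>N. \<exists>n\<ge>N. e \<le> cmod (h x n)"
      unfolding D by (auto simp: LIMSEQ_iff not_less)
    obtain m where "inverse (real (Suc m)) < e" using e(1) reals_Archimedean by blast
    then have "x \<in> G m" using e(2) x unfolding G_def D by (fastforce intro: less_le_trans)
    then show "x \<in> (\<Union>m. G m)" by blast
  qed
  moreover have "G m \<subseteq> D" for m
  proof
    fix x assume x: "x \<in> G m"
    have "\<not> h x \<longlonglongrightarrow> 0"
    proof
      assume "h x \<longlonglongrightarrow> 0"
      then have "\<exists>N. \<forall>n\<ge>N. cmod (h x n - 0) < inverse (real (Suc m))"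
        by (rule LIMSEQ_D) simp
      then show False using x unfolding G_def by force
    qed
    then show "x \<in> D" using x unfolding D G_def by auto
  qed
  then have "countable (G m)" for m
    using uncountable_gdelta_not_small[OF gd, of m] small_subset[OF assms(2), of "G m"] by auto
  then have "countable (\<Union>m. G m)" by auto
  ultimately show ?thesis by (rule countable_subset)
qed

end

section \<open>Matrices that cannot be ruined\<close>

definition convergent_along :: "(nat \<Rightarrow> complex) \<Rightarrow> nat set \<Rightarrow> bool" where
  "convergent_along f A \<longleftrightarrow> (\<exists>l. (f \<longlongrightarrow> l) (along A))"

lemma convergent_along_subset:
  "convergent_along f B \<Longrightarrow> A \<subseteq> B \<Longrightarrow> convergent_along f A"
  unfolding convergent_along_def using along_mono tendsto_mono by metis

definition points :: "('a \<times> 'a) set \<Rightarrow> 'a set" where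
  "points U = fst ` U \<union> snd ` U"

text \<open>Stands for \<open>M\<close> applied to the indicator of \<open>pair_branch p\<close>.
  For distinct branches and null columns the two differ by a null sequence, and the sum can be taken
  apart into branches.\<close>

definition pair_sum :: "(nat \<Rightarrow> nat \<Rightarrow> complex) \<Rightarrow> real \<times> real \<Rightarrow> nat \<Rightarrow> complex" where
  "pair_sum M p n = row_sum M (branch (fst p)) n + row_sum M (branch (snd p)) n"

definition pair_branch :: "real \<times> real \<Rightarrow> nat set" where
  "pair_branch p = branch (fst p) \<union> branch (snd p)"

text \<open>
  Here \<open>p\<close> is meant to become a member of the domain family, and \<open>q\<close> a member of the target
  family, which already contains \<open>U\<close>; \<open>Fr\<close> consists of the branches still available, and \<open>diag\<close>
  says that the two families coincide. Either alternative prevents the image of \<open>p\<close> under \<open>M\<close>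
  from belonging to the space of the target family, however the construction continues.
\<close>

definition ruin :: "(nat \<Rightarrow> nat \<Rightarrow> complex) \<Rightarrow> bool \<Rightarrow> (real \<times> real) set \<Rightarrow> real set \<Rightarrow>
    real \<times> real \<Rightarrow> real \<times> real \<Rightarrow> bool" where
  "ruin M diag U Fr p q \<longleftrightarrow>
     (\<exists>r\<in>U \<union> {q} \<union> (if diag then {p} else {}). \<not> convergent_along (pair_sum M p) (pair_branch r)) \<or>
     (\<exists>\<epsilon>>0. \<exists>E. infinite E \<and> (\<forall>n\<in>E. \<epsilon> \<le> cmod (pair_sum M p n)) \<and>
        (\<forall>z\<in>points U \<union> (if diag then Fr else Fr - {fst p, snd p}). finite (E \<inter> branch z)))"

lemma not_small_irrationals: "\<not> small (- \<rat> :: real set)"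
proof
  assume "small (- \<rat> :: real set)"
  then have "small (- \<rat> \<union> \<rat> :: real set)"
    using countable_small[OF countable_rat] by (rule small_Un)
  moreover have "- \<rat> \<union> \<rat> = (UNIV :: real set)" by auto
  ultimately show False using not_small_UNIV by simp
qed

text \<open>The situation at a stage where no fresh choice ruins \<open>M\<close>. The branches in
  \<open>Fr\<close> outnumber everything used so far, so auxiliary branches can always be taken
  fresh.\<close>

locale no_ruin = c0_matrix +
  fixes diag :: bool and U :: "(real \<times> real) set" and Fr :: "real set"
  assumes Fr_irr: "Fr \<subseteq> - \<rat>" and small_compl: "small (- \<rat> - Fr)"
    and U_Fr: "points U \<inter> Fr = {}" and small_U: "small (points U)"
    and no_ruin: "\<lbrakk>distinct [x, x1, y, y1]; {x, x1, y, y1} \<subseteq> Fr\<rbrakk> \<Longrightarrow> \<not> ruin M diag U Fr (x, x1) (y, y1)"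
begin

abbreviation g :: "real \<Rightarrow> nat \<Rightarrow> complex" where
  "g x \<equiv> row_sum M (branch x)"

lemma fresh:
  assumes "small S" obtains x where "x \<in> Fr" "x \<notin> S"
proof -
  have "\<not> small Fr"
  proof
    assume "small Fr"
    then have "small ((- \<rat> - Fr) \<union> Fr)" using small_compl by (intro small_Un)
    moreover have "- \<rat> \<subseteq> (- \<rat> - Fr) \<union> Fr" by auto
    ultimately show False using not_small_irrationals small_subset by metis
  qed
  then show thesis using small_obtain[OF assms] that by metis
qed

lemma fresh_finite:
  assumes "finite S" obtains x where "x \<in> Fr" "x \<notin> S"
  using fresh[OF countable_small[OF countable_finite[OF assms]]] .

text \<open>A branch still available is tested by making it one half of the target pair; a branch
  already in the target is tested through the member of \<open>U\<close> that contains it.\<close>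

lemma pair_convergent:
  assumes "x \<in> Fr" "x1 \<in> Fr" "x \<noteq> x1" "z \<in> points U \<union> Fr" "z \<noteq> x" "z \<noteq> x1"
  shows "convergent_along (pair_sum M (x, x1)) (branch z)"
proof (cases "z \<in> Fr")
  case True
  obtain y1 where y1: "y1 \<in> Fr" "y1 \<notin> {x, x1, z}" using fresh_finite[of "{x, x1, z}"] by auto
  have "\<not> ruin M diag U Fr (x, x1) (z, y1)"
    by (rule no_ruin) (use assms True y1 in auto)
  then have "convergent_along (pair_sum M (x, x1)) (pair_branch (z, y1))"
    unfolding ruin_def by simp
  then show ?thesis by (rule convergent_along_subset) (simp add: pair_branch_def)
next
  case False
  then obtain r where r: "r \<in> U" "z = fst r \<or> z = snd r" using assms(4) unfolding points_def by auto
  obtain y where y: "y \<in> Fr" "y \<notin> {x, x1}" using fresh_finite[of "{x, x1}"] by auto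
  obtain y1 where y1: "y1 \<in> Fr" "y1 \<notin> {x, x1, y}" using fresh_finite[of "{x, x1, y}"] by auto
  have "\<not> ruin M diag U Fr (x, x1) (y, y1)"
    by (rule no_ruin) (use assms y y1 in auto)
  then have "convergent_along (pair_sum M (x, x1)) (pair_branch r)"
    using r(1) unfolding ruin_def by simp
  then show ?thesis by (rule convergent_along_subset) (use r in \<open>auto simp: pair_branch_def\<close>)
qed

definition d :: "real \<Rightarrow> real \<Rightarrow> complex" where
  "d x z = Lim (along (branch z)) (g x)"

lemma tendsto_dI:
  assumes "convergent_along (g x) (branch z)"
  shows "(g x \<longlongrightarrow> d x z) (along (branch z))"
proof -
  obtain l where l: "(g x \<longlongrightarrow> l) (along (branch z))" using assms unfolding convergent_along_def by blast
  then have "d x z = l" unfolding d_def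
    by (intro tendsto_Lim along_nontrivial infinite_branch)
  then show ?thesis using l by simp
qed

text \<open>Pairs determine single branches: \<open>g x\<close> is half of the sum for
  \<open>(x, x1)\<close> plus that for \<open>(x, x2)\<close> minus that for
  \<open>(x1, x2)\<close>.\<close>

lemma tendsto_d:
  assumes "x \<in> Fr" "z \<in> points U \<union> Fr" "z \<noteq> x"
  shows "(g x \<longlongrightarrow> d x z) (along (branch z))"
proof (rule tendsto_dI)
  obtain x1 where x1: "x1 \<in> Fr" "x1 \<notin> {x, z}" using fresh_finite[of "{x, z}"] by auto
  obtain x2 where x2: "x2 \<in> Fr" "x2 \<notin> {x, z, x1}" using fresh_finite[of "{x, z, x1}"] by auto
  obtain l1 where 1: "(pair_sum M (x, x1) \<longlongrightarrow> l1) (along (branch z))"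
    using pair_convergent[of x x1 z] assms x1 unfolding convergent_along_def by auto
  obtain l2 where 2: "(pair_sum M (x, x2) \<longlongrightarrow> l2) (along (branch z))"
    using pair_convergent[of x x2 z] assms x2 unfolding convergent_along_def by auto
  obtain l3 where 3: "(pair_sum M (x1, x2) \<longlongrightarrow> l3) (along (branch z))"
    using pair_convergent[of x1 x2 z] assms x1 x2 unfolding convergent_along_def by auto
  have "((\<lambda>n. (pair_sum M (x, x1) n + pair_sum M (x, x2) n - pair_sum M (x1, x2) n) / 2)
      \<longlongrightarrow> (l1 + l2 - l3) / 2) (along (branch z))"
    by (intro tendsto_intros 1 2 3) auto
  moreover have "(\<lambda>n. (pair_sum M (x, x1) n + pair_sum M (x, x2) n - pair_sum M (x1, x2) n) / 2) = g x"
    by (auto simp: pair_sum_def)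
  ultimately show "convergent_along (g x) (branch z)" unfolding convergent_along_def by auto
qed

lemma tendsto_pair_sum:
  assumes "(g x \<longlongrightarrow> a) F" "(g x1 \<longlongrightarrow> c) F"
  shows "(pair_sum M (x, x1) \<longlongrightarrow> a + c) F"
proof -
  have "pair_sum M (x, x1) = (\<lambda>n. g x n + g x1 n)" by (auto simp: pair_sum_def)
  then show ?thesis using tendsto_add[OF assms] by simp
qed

lemma limits_agree:
  assumes "convergent_along f (branch y \<union> branch y1)"
    and "(f \<longlongrightarrow> a) (along (branch y))" "(f \<longlongrightarrow> c) (along (branch y1))"
  shows "a = c"
proof -
  obtain l where l: "(f \<longlongrightarrow> l) (along (branch y \<union> branch y1))"
    using assms(1) unfolding convergent_along_def by blast
  have "(f \<longlongrightarrow> l) (along (branch y))" "(f \<longlongrightarrow> l) (along (branch y1))"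
    using tendsto_mono[OF along_mono l] by auto
  then have "a = l" "c = l"
    using assms(2,3) tendsto_unique along_nontrivial infinite_branch by metis+
  then show ?thesis by simp
qed

text \<open>Here the target member consists of two branches: the image of \<open>(x, x1)\<close>
  converges along their union, so its limits along the two halves coincide.\<close>

lemma d_sum:
  assumes "distinct [x, x1, y, y1]" "{x, x1, y, y1} \<subseteq> Fr"
  shows "d x y + d x1 y = d x y1 + d x1 y1"
proof (rule limits_agree)
  show "convergent_along (pair_sum M (x, x1)) (branch y \<union> branch y1)"
    using no_ruin[OF assms] unfolding ruin_def pair_branch_def by simp
  show "(pair_sum M (x, x1) \<longlongrightarrow> d x y + d x1 y) (along (branch y))"
    "(pair_sum M (x, x1) \<longlongrightarrow> d x y1 + d x1 y1) (along (branch y1))"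
    by (intro tendsto_pair_sum tendsto_d; use assms in auto)+
qed

text \<open>The cancellation with three pairs, now applied to limits, removes the partner
  branch.\<close>

lemma d_const:
  assumes "x \<in> Fr" "y \<in> Fr" "y1 \<in> Fr" "y \<noteq> x" "y1 \<noteq> x"
  shows "d x y = d x y1"
proof (cases "y = y1")
  case False
  obtain x1 where x1: "x1 \<in> Fr" "x1 \<notin> {x, y, y1}" using fresh_finite[of "{x, y, y1}"] by auto
  obtain x2 where x2: "x2 \<in> Fr" "x2 \<notin> {x, y, y1, x1}" using fresh_finite[of "{x, y, y1, x1}"] by auto
  have eqs: "d x y + d x1 y = d x y1 + d x1 y1" "d x y + d x2 y = d x y1 + d x2 y1"
    "d x1 y + d x2 y = d x1 y1 + d x2 y1"
    by (intro d_sum; use assms x1 x2 False in auto)+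
  have "2 * d x y = (d x y + d x1 y) + (d x y + d x2 y) - (d x1 y + d x2 y)" by simp
  also have "\<dots> = 2 * d x y1" unfolding eqs by simp
  finally show ?thesis by simp
qed simp

text \<open>By \<open>d_const\<close> the chosen \<open>y\<close> does not affect the value for
  \<open>x \<in> Fr\<close>: it is the background value that the image of \<open>branch x\<close>
  takes at every other free branch.\<close>

definition common_limit :: "real \<Rightarrow> complex" where
  "common_limit x = d x (SOME y. y \<in> Fr \<and> y \<noteq> x)"

lemma d_eq_common_limit: "x \<in> Fr \<Longrightarrow> y \<in> Fr \<Longrightarrow> y \<noteq> x \<Longrightarrow> d x y = common_limit x"
  unfolding common_limit_def by (rule someI2[where a = y]) (auto intro: d_const)

text \<open>Finitely many \<open>x\<close> can be compared at one further branch \<open>y\<close>,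
  where the l1 bound on limits applies.\<close>

lemma countable_common_limit: "countable {x \<in> Fr. common_limit x \<noteq> 0}"
proof (rule countable_nonzero_of_sum_le)
  fix X assume X: "finite X" "X \<subseteq> Fr"
  obtain y where y: "y \<in> Fr" "y \<notin> X" using fresh_finite[OF X(1)] by auto
  show "(\<Sum>x\<in>X. cmod (common_limit x)) \<le> b + 1"
  proof (rule sum_limits_le[where B = "branch y"])
    fix x assume "x \<in> X"
    then have x: "x \<in> Fr" "y \<noteq> x" using X y by auto
    then show "(g x \<longlongrightarrow> common_limit x) (along (branch y))"
      using tendsto_d[of x y] d_eq_common_limit[of x y] y by simp
  qed (auto intro: X finite_branch_Int simp: infinite_branch)
qed

text \<open>Each earlier branch \<open>z\<close> sees countably many \<open>x\<close>, but there may
  be uncountably many \<open>z\<close>. This is where less than continuum replaces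
  countable.\<close>

lemma small_linked: "small {x \<in> Fr. \<exists>z\<in>points U. d x z \<noteq> 0}"
proof -
  have "countable {x \<in> Fr. d x z \<noteq> 0}" if z: "z \<in> points U" for z
  proof (rule countable_nonzero_limits[where B = "branch z"])
    fix x assume x: "x \<in> Fr"
    then have "z \<noteq> x" using z U_Fr by auto
    then show "(g x \<longlongrightarrow> d x z) (along (branch z))" using x z by (intro tendsto_d) auto
  qed (auto intro: finite_branch_Int simp: infinite_branch)
  then have "small (\<Union>z\<in>points U. {x \<in> Fr. d x z \<noteq> 0})"
    by (rule small_UN_countable[OF small_U])
  then show ?thesis by (rule small_subset) auto
qed

lemma pair_convergent_diag:
  assumes diag "x \<in> Fr" "x1 \<in> Fr" "x \<noteq> x1"
  shows "convergent_along (pair_sum M (x, x1)) (branch x \<union> branch x1)"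
proof -
  obtain y where y: "y \<in> Fr" "y \<notin> {x, x1}" using fresh_finite[of "{x, x1}"] by auto
  obtain y1 where y1: "y1 \<in> Fr" "y1 \<notin> {x, x1, y}" using fresh_finite[of "{x, x1, y}"] by auto
  have "\<not> ruin M diag U Fr (x, x1) (y, y1)"
    by (rule no_ruin) (use assms y y1 in auto)
  then show ?thesis using assms(1) unfolding ruin_def pair_branch_def by simp
qed

lemma tendsto_d_diag:
  assumes diag "x \<in> Fr"
  shows "(g x \<longlongrightarrow> d x x) (along (branch x))"
proof (rule tendsto_dI)
  obtain x1 where x1: "x1 \<in> Fr" "x1 \<noteq> x" using fresh_finite[of "{x}"] by auto
  have "convergent_along (pair_sum M (x, x1)) (branch x)"
    using pair_convergent_diag[of x x1] assms x1 convergent_along_subset by blast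
  then obtain l where l: "(pair_sum M (x, x1) \<longlongrightarrow> l) (along (branch x))"
    unfolding convergent_along_def by blast
  have "(g x1 \<longlongrightarrow> d x1 x) (along (branch x))"
    by (rule tendsto_d) (use assms x1 in auto)
  from tendsto_diff[OF l this] have "(g x \<longlongrightarrow> l - d x1 x) (along (branch x))"
    by (simp add: pair_sum_def)
  then show "convergent_along (g x) (branch x)" unfolding convergent_along_def by blast
qed

text \<open>The image of the pair has the same limit along both of its own branches. In each limit
  the cross term is the background value of the partner; moving these terms across isolates the
  multiplier.\<close>

lemma diag_const:
  assumes diag "x \<in> Fr" "x1 \<in> Fr"
  shows "d x x - common_limit x = d x1 x1 - common_limit x1"
proof (cases "x = x1")
  case False
  have "d x x + d x1 x = d x x1 + d x1 x1"
  proof (rule limits_agree)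
    show "convergent_along (pair_sum M (x, x1)) (branch x \<union> branch x1)"
      using pair_convergent_diag assms False by auto
    show "(pair_sum M (x, x1) \<longlongrightarrow> d x x + d x1 x) (along (branch x))"
      by (intro tendsto_pair_sum tendsto_d tendsto_d_diag) (use assms False in auto)
    show "(pair_sum M (x, x1) \<longlongrightarrow> d x x1 + d x1 x1) (along (branch x1))"
      by (intro tendsto_pair_sum tendsto_d tendsto_d_diag) (use assms False in auto)
  qed
  then show ?thesis using d_eq_common_limit[of x x1] d_eq_common_limit[of x1 x] assms False
    by (simp add: algebra_simps)
qed simp

text \<open>An uncountable bad set is not \<open>small\<close>, so it contains some \<open>x\<close>
  with zero background value and zero limits at earlier branches. Its error is large infinitely
  often, yet null along every relevant branch, and with a suitable partner \<open>x1\<close> this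
  yields the second alternative of \<open>ruin\<close>.\<close>

lemma exists_scalar:
  "\<exists>l. (\<not> diag \<longrightarrow> l = 0) \<and>
     countable {x \<in> - \<rat>. \<not> acts_as_scalar M l (branch x)}"
proof -
  obtain l where l0: "\<not> diag \<Longrightarrow> l = 0" and l: "\<And>x. diag \<Longrightarrow> x \<in> Fr \<Longrightarrow> d x x - common_limit x = l"
  proof (cases diag)
    case True
    obtain x0 where "x0 \<in> Fr" by (rule fresh_finite[OF finite.emptyI])
    then show thesis
      using True by (intro that[of "d x0 x0 - common_limit x0"] diag_const) simp_all
  next
    case False
    then show thesis by (intro that[of 0]) simp_all
  qed
  define D where "D = {x \<in> - \<rat>. \<not> acts_as_scalar M l (branch x)}"
  have "countable D"
  proof (rule ccontr)
    assume "uncountable D"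
    then have D_big: "\<not> small D" using small_or_countable[of l] unfolding D_def by auto
    have "small ((- \<rat> - Fr) \<union> {x \<in> Fr. common_limit x \<noteq> 0} \<union> {x \<in> Fr. \<exists>z\<in>points U. d x z \<noteq> 0})"
      by (intro small_Un small_compl small_linked countable_small[OF countable_common_limit])
    then obtain x where "x \<in> D"
      and "x \<notin> (- \<rat> - Fr) \<union> {x \<in> Fr. common_limit x \<noteq> 0} \<union> {x \<in> Fr. \<exists>z\<in>points U. d x z \<noteq> 0}"
      using D_big by (rule small_obtain)
    then have xD: "x \<in> D" and x: "x \<in> Fr" "common_limit x = 0" "\<And>z. z \<in> points U \<Longrightarrow> d x z = 0"
      unfolding D_def by auto
    define h where "h n = g x n - l * of_bool (n \<in> branch x)" for n
    have "\<not> h \<longlonglongrightarrow> 0" using xD unfolding D_def h_def by auto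
    then obtain \<epsilon> where \<epsilon>: "\<epsilon> > 0" "\<not> (\<forall>\<^sub>F n in sequentially. cmod (h n) < \<epsilon>)"
      by (auto simp: tendsto_iff)
    define E where "E = {n. \<epsilon> \<le> cmod (h n)}"
    have E_inf: "infinite E" using \<epsilon>(2) unfolding E_def eventually_sequentially_finite by (simp add: not_less)
    have E_fin: "finite (E \<inter> branch z)" if "(h \<longlongrightarrow> 0) (along (branch z))" for z
    proof -
      have "\<forall>\<^sub>F n in along (branch z). cmod (h n) < \<epsilon>"
        using that \<epsilon>(1) by (auto simp: tendsto_iff)
      then have "finite {n \<in> branch z. \<not> cmod (h n) < \<epsilon>}" unfolding eventually_along .
      moreover have "E \<inter> branch z = {n \<in> branch z. \<not> cmod (h n) < \<epsilon>}" unfolding E_def by auto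
      ultimately show ?thesis by simp
    qed
    have fin1: "finite (E \<inter> branch z)" if z: "z \<in> points U \<union> Fr" "z \<noteq> x" for z
    proof (rule E_fin)
      have "d x z = 0" using x d_eq_common_limit[of x z] z by auto
      then have "(g x \<longlongrightarrow> 0) (along (branch z))" using tendsto_d[of x z] x z by simp
      moreover have "((\<lambda>n. l * of_bool (n \<in> branch x)) \<longlongrightarrow> 0) (along (branch z))"
      proof (rule tendsto_eventually)
        have "{n \<in> branch z. \<not> l * of_bool (n \<in> branch x) = 0} \<subseteq> branch z \<inter> branch x" by auto
        then show "\<forall>\<^sub>F n in along (branch z). l * of_bool (n \<in> branch x) = 0"
          unfolding eventually_along using finite_branch_Int[OF z(2)] finite_subset by metis
      qed
      ultimately have "((\<lambda>n. g x n - l * of_bool (n \<in> branch x)) \<longlongrightarrow> 0 - 0) (along (branch z))"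
        by (intro tendsto_diff)
      then show "(h \<longlongrightarrow> 0) (along (branch z))" unfolding h_def by simp
    qed
    have fin2: "finite (E \<inter> branch x)" if diag
    proof (rule E_fin)
      have "(g x \<longlongrightarrow> l) (along (branch x))" using tendsto_d_diag[of x] l[of x] x that by simp
      moreover have "((\<lambda>n. l * of_bool (n \<in> branch x)) \<longlongrightarrow> l) (along (branch x))"
        by (rule tendsto_eventually) (simp add: eventually_along)
      ultimately have "((\<lambda>n. g x n - l * of_bool (n \<in> branch x)) \<longlongrightarrow> l - l) (along (branch x))"
        by (intro tendsto_diff)
      then show "(h \<longlongrightarrow> 0) (along (branch x))" unfolding h_def by simp
    qed
    \<comment> \<open>If the moduli of \<open>m\<close> further images add up to at most
      \<open>b + 1\<close> at a point, one of them is below \<open>\<epsilon> / 2\<close> there. By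
      pigeonhole a single partner works at infinitely many points, and adding its image cannot
      cancel that of \<open>x\<close>.\<close>
    obtain m :: nat where m: "2 * (b + 1) / \<epsilon> < real m" using reals_Archimedean2 by blast
    have "infinite (Fr - {x})"
    proof
      assume "finite (Fr - {x})"
      then obtain y where "y \<in> Fr" "y \<notin> insert x (Fr - {x})"
        using fresh_finite[of "insert x (Fr - {x})"] by auto
      then show False by auto
    qed
    then obtain X where X: "X \<subseteq> Fr - {x}" "finite X" "card X = m"
      using infinite_arbitrarily_large by blast
    define E' where "E' = {n \<in> E. (\<Sum>y\<in>X. cmod (g y n)) \<le> b + 1}"
    have "\<forall>\<^sub>F n in sequentially. (\<Sum>y\<in>X. cmod (g y n)) \<le> b + 1"
      using X(2) by (rule eventually_sum_row_sums_le) (rule finite_branch_Int)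
    then have "finite {n. \<not> (\<Sum>y\<in>X. cmod (g y n)) \<le> b + 1}" unfolding eventually_sequentially_finite .
    moreover have "E \<subseteq> E' \<union> {n. \<not> (\<Sum>y\<in>X. cmod (g y n)) \<le> b + 1}" unfolding E'_def by auto
    ultimately have E'_inf: "infinite E'" using E_inf by (metis finite_Un finite_subset)
    have "E' \<subseteq> (\<Union>y\<in>X. {n \<in> E'. cmod (g y n) < \<epsilon> / 2})"
    proof
      fix n assume n: "n \<in> E'"
      have "\<exists>y\<in>X. cmod (g y n) < \<epsilon> / 2"
      proof (rule ccontr)
        assume "\<not> (\<exists>y\<in>X. cmod (g y n) < \<epsilon> / 2)"
        then have "(\<Sum>y\<in>X. \<epsilon> / 2) \<le> (\<Sum>y\<in>X. cmod (g y n))" by (intro sum_mono) (auto simp: not_less)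
        then have "real m * \<epsilon> / 2 \<le> b + 1" using n X(3) unfolding E'_def by simp
        then show False using m \<epsilon>(1) by (simp add: field_simps)
      qed
      then show "n \<in> (\<Union>y\<in>X. {n \<in> E'. cmod (g y n) < \<epsilon> / 2})" using n by auto
    qed
    then have "\<exists>y\<in>X. infinite {n \<in> E'. cmod (g y n) < \<epsilon> / 2}"
      using E'_inf X(2) by (meson finite_UN_I finite_subset)
    then obtain x1 where x1: "x1 \<in> X" "infinite {n \<in> E'. cmod (g x1 n) < \<epsilon> / 2}" by auto
    \<comment> \<open>Off \<open>branch x\<close> the error \<open>h\<close> is the image itself. In
      the case of two different families the scalar is 0, so \<open>h\<close> is the image
      everywhere.\<close>
    define E2 where "E2 = {n \<in> E'. cmod (g x1 n) < \<epsilon> / 2} - (if diag then E \<inter> branch x else {})"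
    have E2_inf: "infinite E2"
      unfolding E2_def using x1(2) fin2 by (simp add: Diff_infinite_finite)
    have E2_sub: "E2 \<subseteq> E" unfolding E2_def E'_def by auto
    have E2: "\<epsilon> / 2 \<le> cmod (pair_sum M (x, x1) n)" if n: "n \<in> E2" for n
    proof -
      have "h n = g x n" using n E2_sub l0 unfolding h_def E2_def by (cases diag) auto
      then have "\<epsilon> \<le> cmod (g x n)" using n E2_sub unfolding E_def by auto
      moreover have "cmod (g x1 n) < \<epsilon> / 2" using n unfolding E2_def by auto
      moreover have "cmod (g x n) - cmod (g x1 n) \<le> cmod (g x n + g x1 n)" by (rule norm_diff_ineq)
      ultimately show ?thesis unfolding pair_sum_def by simp
    qed
    have E2_fin: "finite (E2 \<inter> branch z)" if z: "z \<in> points U \<union> (if diag then Fr else Fr - {x, x1})" for z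
    proof -
      have "finite (E \<inter> branch z)" using z fin1[of z] fin2 U_Fr x(1) by (cases "z = x") (auto split: if_splits)
      then show ?thesis using E2_sub by (metis Int_mono finite_subset order_refl)
    qed
    obtain y where y: "y \<in> Fr" "y \<notin> {x, x1}" using fresh_finite[of "{x, x1}"] by auto
    obtain y1 where y1: "y1 \<in> Fr" "y1 \<notin> {x, x1, y}" using fresh_finite[of "{x, x1, y}"] by auto
    have "ruin M diag U Fr (x, x1) (y, y1)"
      unfolding ruin_def fst_conv snd_conv
      by (intro disjI2 exI[of _ "\<epsilon> / 2"] conjI exI[of _ E2] E2_inf ballI E2)
        (use \<epsilon>(1) E2_fin in auto)
    moreover have "\<not> ruin M diag U Fr (x, x1) (y, y1)"
      by (rule no_ruin) (use x x1 X y y1 in auto)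
    ultimately show False by simp
  qed
  then show ?thesis using l0 unfolding D_def by auto
qed

end

section \<open>Rigid families of unions of two branches\<close>

type_synonym task = "(nat \<Rightarrow> nat \<Rightarrow> complex) \<times> nat \<times> nat"

text \<open>A task and an additional real can be coded together by a set of quadruples of naturals,
  hence by one real; the additional real makes every fibre uncountable.\<close>

lemma task_enumeration: "\<exists>\<tau> :: real \<Rightarrow> task. \<forall>t. uncountable {s. \<tau> s = t}"
proof -
  obtain f :: "real \<Rightarrow> nat set" where f: "inj f"
    using nat_sets_eqpoll_reals eqpoll_sym unfolding eqpoll_def bij_betw_def by metis
  obtain f' :: "nat set \<Rightarrow> real" where f': "inj f'"
    using nat_sets_eqpoll_reals unfolding eqpoll_def bij_betw_def by metis
  \<comment> \<open>The first coordinate tags the layer: real parts, imaginary parts, the pair of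
    indices, and the additional real.\<close>
  define C :: "task \<times> real \<Rightarrow> (nat \<times> nat \<times> nat \<times> nat) set" where
    "C = (\<lambda>((M, i, j), s). {(t, a, c, k). t = 0 \<and> k \<in> f (Re (M a c)) \<or> t = 1 \<and> k \<in> f (Im (M a c))
        \<or> t = 2 \<and> a = i \<and> c = j \<and> k = 0 \<or> t = 3 \<and> k \<in> f s})"
  have "inj C"
  proof (rule injI)
    fix u v :: "task \<times> real"
    assume eq: "C u = C v"
    obtain M i j s where u: "u = ((M, i, j), s)" by (metis prod.exhaust)
    obtain N i' j' s' where v: "v = ((N, i', j'), s')" by (metis prod.exhaust)
    have eq': "(t, a, c, k) \<in> C ((M, i, j), s) \<longleftrightarrow> (t, a, c, k) \<in> C ((N, i', j'), s')" for t a c k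
      using eq unfolding u v by simp
    have "k \<in> f (Re (M a c)) \<longleftrightarrow> k \<in> f (Re (N a c))" for a c k
      using eq'[of 0 a c k] unfolding C_def by simp
    then have 1: "Re (M a c) = Re (N a c)" for a c
      using f by (intro injD[OF f] Set.set_eqI)
    have "k \<in> f (Im (M a c)) \<longleftrightarrow> k \<in> f (Im (N a c))" for a c k
      using eq'[of 1 a c k] unfolding C_def by simp
    then have 2: "Im (M a c) = Im (N a c)" for a c
      using f by (intro injD[OF f] Set.set_eqI)
    have "k \<in> f s \<longleftrightarrow> k \<in> f s'" for k
      using eq'[of 3 0 0 k] unfolding C_def by simp
    then have 3: "s = s'" by (intro injD[OF f] Set.set_eqI)
    have 4: "i = i'" "j = j'"
      using eq'[of 2 i j 0] unfolding C_def by simp_all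
    have "M = N" by (intro ext complex_eqI 1 2)
    then show "u = v" using 3 4 unfolding u v by simp
  qed
  define H where "H = (\<lambda>u. f' (to_nat ` C u))"
  have H: "inj H"
  proof (rule injI)
    fix u v assume "H u = H v"
    then have "to_nat ` C u = to_nat ` C v" unfolding H_def by (rule injD[OF f'])
    then have "C u = C v" by (simp add: inj_image_eq_iff)
    then show "u = v" by (rule injD[OF \<open>inj C\<close>])
  qed
  define \<tau> where "\<tau> s = fst (inv_into UNIV H s)" for s
  have "uncountable {s. \<tau> s = t}" for t
  proof
    assume "countable {s. \<tau> s = t}"
    moreover have "range (\<lambda>r. H (t, r)) \<subseteq> {s. \<tau> s = t}"
      unfolding \<tau>_def using H by auto
    ultimately have "countable (range (\<lambda>r. H (t, r)))" by (rule countable_subset[rotated])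
    moreover have "inj (\<lambda>r. H (t, r))" using H by (auto intro!: injI dest: injD)
    ultimately have "countable (UNIV :: real set)" by (rule countable_image_inj_on)
    then show False using uncountable_UNIV_real by simp
  qed
  then show ?thesis by blast
qed

text \<open>
  This says that \<open>f\<close> lies in the closed linear span of \<open>c\<^sub>0\<close> and the indicator functions of
  the members of \<open>\<W>\<close>.
\<close>

definition in_space :: "nat set set \<Rightarrow> (nat \<Rightarrow> complex) \<Rightarrow> bool" where
  "in_space \<W> f \<longleftrightarrow> (\<forall>w\<in>\<W>. convergent_along f w) \<and>
     (\<forall>\<epsilon>>0. \<exists>\<W>0\<subseteq>\<W>. finite \<W>0 \<and> finite ({n. \<epsilon> \<le> cmod (f n)} - \<Union>\<W>0))"

lemma tendsto_along_cong:
  fixes f f' :: "nat \<Rightarrow> complex"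
  assumes "(\<lambda>n. f n - f' n) \<longlonglongrightarrow> 0" "(f \<longlongrightarrow> l) (along A)"
  shows "(f' \<longlongrightarrow> l) (along A)"
proof -
  have "((\<lambda>n. f n - f' n) \<longlongrightarrow> 0) (along A)" using assms(1) by (rule tendsto_mono[rotated]) simp
  from tendsto_diff[OF assms(2) this] show ?thesis by simp
qed

lemma in_space_cong:
  assumes "(\<lambda>n. f n - f' n) \<longlonglongrightarrow> 0" "in_space \<W> f"
  shows "in_space \<W> f'"
  unfolding in_space_def
proof (intro conjI ballI allI impI)
  fix w assume "w \<in> \<W>"
  then show "convergent_along f' w"
    using assms(2) tendsto_along_cong[OF assms(1)] unfolding in_space_def convergent_along_def by metis
next
  fix \<epsilon> :: real assume \<epsilon>: "\<epsilon> > 0"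
  then obtain \<W>0 where W: "\<W>0 \<subseteq> \<W>" "finite \<W>0" "finite ({n. \<epsilon> / 2 \<le> cmod (f n)} - \<Union>\<W>0)"
    using assms(2) unfolding in_space_def by (meson half_gt_zero)
  have "\<forall>\<^sub>F n in sequentially. cmod (f n - f' n) < \<epsilon> / 2"
    using assms(1) \<epsilon> by (auto simp: tendsto_iff dest: spec[of _ "\<epsilon> / 2"])
  then have fin: "finite {n. \<not> cmod (f n - f' n) < \<epsilon> / 2}" unfolding eventually_sequentially_finite .
  have "{n. \<epsilon> \<le> cmod (f' n)} - \<Union>\<W>0 \<subseteq> ({n. \<epsilon> / 2 \<le> cmod (f n)} - \<Union>\<W>0) \<union> {n. \<not> cmod (f n - f' n) < \<epsilon> / 2}"
  proof
    fix n assume n: "n \<in> {n. \<epsilon> \<le> cmod (f' n)} - \<Union>\<W>0"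
    have "cmod (f' n) \<le> cmod (f n) + cmod (f n - f' n)"
      by (metis norm_minus_commute norm_triangle_sub)
    then show "n \<in> ({n. \<epsilon> / 2 \<le> cmod (f n)} - \<Union>\<W>0) \<union> {n. \<not> cmod (f n - f' n) < \<epsilon> / 2}"
      using n by auto
  qed
  then have "finite ({n. \<epsilon> \<le> cmod (f' n)} - \<Union>\<W>0)" using W(3) fin by (meson finite_UnI finite_subset)
  then show "\<exists>\<W>0\<subseteq>\<W>. finite \<W>0 \<and> finite ({n. \<epsilon> \<le> cmod (f' n)} - \<Union>\<W>0)" using W by auto
qed

definition pts :: "(real \<times> real) \<times> (real \<times> real) \<Rightarrow> real set" where
  "pts v = {fst (fst v), snd (fst v), fst (snd v), snd (snd v)}"

definition fresh_quadruple :: "real set \<Rightarrow> (real \<times> real) \<times> (real \<times> real) \<Rightarrow> bool" where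
  "fresh_quadruple Fr v \<longleftrightarrow> distinct [fst (fst v), snd (fst v), fst (snd v), snd (snd v)] \<and> pts v \<subseteq> Fr"

text \<open>
  A task \<open>(M, i, j)\<close> asks to ruin \<open>M\<close> as an operator from the space of the \<open>i\<close>-th family to
  that of the \<open>j\<close>-th. Every task is treated at uncountably many stages: an operator is only
  determined by its matrix off a countable set, so a single ruined pair would not suffice.
\<close>

definition stage_ruin :: "task \<Rightarrow> (nat \<Rightarrow> (real \<times> real) set) \<Rightarrow> real set \<Rightarrow> (real \<times> real) \<times> (real \<times> real) \<Rightarrow> bool" where
  "stage_ruin t U Fr v \<longleftrightarrow>
     ruin (fst t) (fst (snd t) = snd (snd t)) (U (snd (snd t))) Fr (fst v) (snd v)"

text \<open>\<open>card_of\<close> is a well-order of least possible type, so proper initial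
  segments have fewer than continuum many elements and no stage runs out of branches.\<close>

definition real_less :: "(real \<times> real) set" where
  "real_less = card_of UNIV - Id"

lemma wf_real_less: "wf real_less"
  using card_of_well_order_on[of "UNIV :: real set"] unfolding well_order_on_def real_less_def by blast

lemma real_less_total: "x \<noteq> y \<Longrightarrow> (x, y) \<in> real_less \<or> (y, x) \<in> real_less"
  using card_of_well_order_on[of "UNIV :: real set"]
  unfolding well_order_on_def linear_order_on_def total_on_def real_less_def by auto

lemma real_less_trans: "(x, y) \<in> real_less \<Longrightarrow> (y, z) \<in> real_less \<Longrightarrow> (x, z) \<in> real_less"
  using card_of_well_order_on[of "UNIV :: real set"]
  unfolding well_order_on_def linear_order_on_def partial_order_on_def preorder_on_def real_less_def
  by (auto dest: transD antisymD)

lemma small_below: "small {y. (y, x) \<in> real_less}"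
proof -
  have "(card_of (underS (card_of (UNIV :: real set)) x), card_of (UNIV :: real set)) \<in> ordLess"
    by (rule card_of_underS[OF card_of_Card_order]) (simp add: Field_card_of)
  moreover have "underS (card_of (UNIV :: real set)) x = {y. (y, x) \<in> real_less}"
    unfolding underS_def real_less_def by auto
  ultimately show ?thesis unfolding small_def by simp
qed

lemma obtain_fresh_quadruple:
  assumes "small (- \<rat> - Fr)"
  obtains v where "fresh_quadruple Fr v"
proof -
  have inf: "\<exists>x. x \<in> Fr \<and> x \<notin> S" if "finite S" for S
  proof (rule ccontr)
    assume "\<nexists>x. x \<in> Fr \<and> x \<notin> S"
    then have "- \<rat> \<subseteq> (- \<rat> - Fr) \<union> S" by auto
    moreover have "small ((- \<rat> - Fr) \<union> S)"
      by (rule small_Un[OF assms countable_small[OF countable_finite[OF that]]])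
    ultimately show False using small_subset not_small_irrationals by metis
  qed
  obtain x where x: "x \<in> Fr" using inf[of "{}"] by auto
  obtain x1 where x1: "x1 \<in> Fr" "x1 \<notin> {x}" using inf[of "{x}"] by auto
  obtain y where y: "y \<in> Fr" "y \<notin> {x, x1}" using inf[of "{x, x1}"] by auto
  obtain y1 where y1: "y1 \<in> Fr" "y1 \<notin> {x, x1, y}" using inf[of "{x, x1, y}"] by auto
  have "fresh_quadruple Fr ((x, x1), (y, y1))"
    unfolding fresh_quadruple_def pts_def using x x1 y y1 by auto
  then show thesis by (rule that)
qed

section \<open>The transfinite recursion\<close>

locale construction =
  fixes \<tau> :: "real \<Rightarrow> task" and f :: "real \<Rightarrow> (real \<times> real) \<times> (real \<times> real)"
begin

definition used :: "real \<Rightarrow> real set" where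
  "used \<sigma> = (\<Union>\<rho>\<in>{\<rho>. (\<rho>, \<sigma>) \<in> real_less}. pts (f \<rho>))"

definition free :: "real \<Rightarrow> real set" where
  "free \<sigma> = - \<rat> - used \<sigma>"

text \<open>The first pair of a quadruple is the domain element to be ruined; the second is a target
  member against which its image is tested.\<close>

definition stages :: "real set \<Rightarrow> nat \<Rightarrow> (real \<times> real) set" where
  "stages S k = {fst (f \<rho>) |\<rho>. \<rho> \<in> S \<and> fst (snd (\<tau> \<rho>)) = k} \<union> {snd (f \<rho>) |\<rho>. \<rho> \<in> S \<and> snd (snd (\<tau> \<rho>)) = k}"

definition below :: "real \<Rightarrow> nat \<Rightarrow> (real \<times> real) set" where
  "below \<sigma> = stages {\<rho>. (\<rho>, \<sigma>) \<in> real_less}"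

text \<open>A ruining quadruple is taken whenever there is one, so a stage that does not ruin its
  matrix certifies that no fresh quadruple could.\<close>

definition step :: "real \<Rightarrow> (real \<times> real) \<times> (real \<times> real) \<Rightarrow> bool" where
  "step \<sigma> v \<longleftrightarrow> fresh_quadruple (free \<sigma>) v \<and>
     ((\<exists>w. fresh_quadruple (free \<sigma>) w \<and> stage_ruin (\<tau> \<sigma>) (below \<sigma>) (free \<sigma>) w) \<longrightarrow>
        stage_ruin (\<tau> \<sigma>) (below \<sigma>) (free \<sigma>) v)"

lemma small_used: "small (used \<sigma>)"
  unfolding used_def by (intro small_UN_countable small_below) (simp add: pts_def)

lemma small_free: "small (- \<rat> - free \<sigma>)"
  by (rule small_subset[OF small_used[of \<sigma>]]) (auto simp: free_def)

lemma step_exists: "\<exists>v. step \<sigma> v"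
proof (cases "\<exists>w. fresh_quadruple (free \<sigma>) w \<and> stage_ruin (\<tau> \<sigma>) (below \<sigma>) (free \<sigma>) w")
  case True
  then show ?thesis unfolding step_def by auto
next
  case False
  obtain v where v: "fresh_quadruple (free \<sigma>) v" by (rule obtain_fresh_quadruple[OF small_free])
  show ?thesis unfolding step_def by (rule exI[of _ v]) (use v False in blast)
qed

end

text \<open>A stage consults earlier quadruples only, through \<open>used\<close>,
  \<open>free\<close> and \<open>below\<close>, as well-founded choice requires.\<close>

lemma construction_exists: "\<exists>f. \<forall>\<sigma>. construction.step \<tau> f \<sigma> (f \<sigma>)"
proof (rule dependent_wf_choice[OF wf_real_less])
  fix f g :: "real \<Rightarrow> (real \<times> real) \<times> (real \<times> real)" and \<sigma> v
  assume eq: "\<And>\<rho>. (\<rho>, \<sigma>) \<in> real_less \<Longrightarrow> f \<rho> = g \<rho>"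
  have 1: "construction.used f \<sigma> = construction.used g \<sigma>"
    unfolding construction.used_def using eq by auto
  then have 2: "construction.free f \<sigma> = construction.free g \<sigma>"
    unfolding construction.free_def by simp
  have 3: "construction.below \<tau> f \<sigma> = construction.below \<tau> g \<sigma>"
    unfolding construction.below_def construction.stages_def
    by (intro ext arg_cong2[where f = "(\<union>)"] Collect_cong ex_cong1) (auto simp: eq)
  show "construction.step \<tau> f \<sigma> v = construction.step \<tau> g \<sigma> v"
    unfolding construction.step_def 2 3 ..
qed (rule construction.step_exists)

locale constructed = construction +
  assumes step: "step \<sigma> (f \<sigma>)"
    and \<tau>: "uncountable {s. \<tau> s = t}"
begin

lemma fresh_quadruple_f: "fresh_quadruple (free \<sigma>) (f \<sigma>)"
  using step unfolding step_def by simp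

lemma pts_free: "pts (f \<sigma>) \<subseteq> free \<sigma>"
  using fresh_quadruple_f unfolding fresh_quadruple_def by simp

lemma pts_disjoint: "\<rho> \<noteq> \<sigma> \<Longrightarrow> pts (f \<rho>) \<inter> pts (f \<sigma>) = {}"
proof -
  have *: "pts (f \<rho>) \<inter> pts (f \<sigma>) = {}" if "(\<rho>, \<sigma>) \<in> real_less" for \<rho> \<sigma>
    using pts_free[of \<sigma>] that unfolding free_def used_def by auto
  assume "\<rho> \<noteq> \<sigma>"
  then show ?thesis using real_less_total *[of \<rho> \<sigma>] *[of \<sigma> \<rho>] by auto
qed

definition pairs :: "nat \<Rightarrow> (real \<times> real) set" where
  "pairs = stages UNIV"

lemma pairs_cases:
  assumes "r \<in> pairs k"
  obtains \<sigma> where "r = fst (f \<sigma>)" "fst (snd (\<tau> \<sigma>)) = k" | \<sigma> where "r = snd (f \<sigma>)" "snd (snd (\<tau> \<sigma>)) = k"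
  using assms unfolding pairs_def stages_def by auto

lemma pts_eq: "pts v = {fst (fst v), snd (fst v)} \<union> {fst (snd v), snd (snd v)}"
  unfolding pts_def by auto

lemma distinct_f: "distinct [fst (fst (f \<sigma>)), snd (fst (f \<sigma>)), fst (snd (f \<sigma>)), snd (snd (f \<sigma>))]"
  using fresh_quadruple_f[of \<sigma>] unfolding fresh_quadruple_def by blast

lemma pairs_distinct: "r \<in> pairs k \<Longrightarrow> fst r \<noteq> snd r"
  by (erule pairs_cases) (use distinct_f in auto)

lemma pairs_irrational: "r \<in> pairs k \<Longrightarrow> {fst r, snd r} \<subseteq> - \<rat>"
proof (erule pairs_cases)
  fix \<sigma> assume "r = fst (f \<sigma>)"
  then show ?thesis using pts_free[of \<sigma>] unfolding free_def pts_eq by auto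
next
  fix \<sigma> assume "r = snd (f \<sigma>)"
  then show ?thesis using pts_free[of \<sigma>] unfolding free_def pts_eq by auto
qed

lemma pairs_disjoint:
  assumes r: "r \<in> pairs k" and r': "r' \<in> pairs k'" and "(k, r) \<noteq> (k', r')"
  shows "{fst r, snd r} \<inter> {fst r', snd r'} = {}"
proof -
  obtain \<sigma> where \<sigma>: "r = fst (f \<sigma>) \<and> fst (snd (\<tau> \<sigma>)) = k \<or> r = snd (f \<sigma>) \<and> snd (snd (\<tau> \<sigma>)) = k"
    using r by (auto elim: pairs_cases)
  obtain \<rho> where \<rho>: "r' = fst (f \<rho>) \<and> fst (snd (\<tau> \<rho>)) = k' \<or> r' = snd (f \<rho>) \<and> snd (snd (\<tau> \<rho>)) = k'"
    using r' by (auto elim: pairs_cases)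
  show ?thesis
  proof (cases "\<rho> = \<sigma>")
    case True
    then show ?thesis using \<sigma> \<rho> assms(3) distinct_f[of \<sigma>] by auto
  next
    case False
    have "{fst r, snd r} \<subseteq> pts (f \<sigma>)" "{fst r', snd r'} \<subseteq> pts (f \<rho>)"
      using \<sigma> \<rho> unfolding pts_eq by auto
    then show ?thesis using pts_disjoint[OF False] by auto
  qed
qed

lemma inj_first: "inj (\<lambda>\<sigma>. fst (f \<sigma>))"
proof (rule injI, rule ccontr)
  fix \<sigma> \<rho> assume "fst (f \<sigma>) = fst (f \<rho>)" "\<sigma> \<noteq> \<rho>"
  then show False using pts_disjoint[of \<sigma> \<rho>] unfolding pts_def by auto
qed

text \<open>Different stages use disjoint sets of points, so the uncountably many stages of one task
  produce uncountably many first pairs.\<close>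

lemma uncountable_stage_obtain:
  assumes "countable S"
  obtains \<sigma> where "\<tau> \<sigma> = t" "fst (f \<sigma>) \<notin> S"
proof -
  have "\<not> (\<lambda>\<sigma>. fst (f \<sigma>)) ` {\<sigma>. \<tau> \<sigma> = t} \<subseteq> S"
  proof
    assume "(\<lambda>\<sigma>. fst (f \<sigma>)) ` {\<sigma>. \<tau> \<sigma> = t} \<subseteq> S"
    then have "countable ((\<lambda>\<sigma>. fst (f \<sigma>)) ` {\<sigma>. \<tau> \<sigma> = t})" using assms by (rule countable_subset)
    then have "countable {\<sigma>. \<tau> \<sigma> = t}"
      by (rule countable_image_inj_on) (use inj_first in \<open>auto intro: inj_on_subset\<close>)
    then show False using \<tau> by simp
  qed
  then obtain \<sigma> where "\<tau> \<sigma> = t" "fst (f \<sigma>) \<notin> S" by blast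
  then show thesis by (rule that)
qed

lemma uncountable_pairs: "uncountable (pairs k)"
proof
  assume "countable (pairs k)"
  \<comment> \<open>Any matrix will do: each stage with indices \<open>(k, k)\<close> puts its first
    pair into \<open>pairs k\<close>.\<close>
  then obtain \<sigma> where "\<tau> \<sigma> = (undefined, k, k)" "fst (f \<sigma>) \<notin> pairs k"
    by (rule uncountable_stage_obtain)
  then show False unfolding pairs_def stages_def by auto
qed

text \<open>A target member is chosen before, at or after stage \<open>\<sigma>\<close>. In the last
  case its branches were still free at \<open>\<sigma>\<close> and avoid the quadruple chosen there.
  So the branches mentioned in \<open>ruin\<close> cover the whole future of the
  construction.\<close>

lemma later_points:
  assumes r: "r \<in> pairs j" and z: "z \<in> {fst r, snd r}" and \<tau>: "snd (snd (\<tau> \<sigma>)) = j"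
  shows "z \<in> points (below \<sigma> j) \<union>
    (if fst (snd (\<tau> \<sigma>)) = j then free \<sigma> else free \<sigma> - {fst (fst (f \<sigma>)), snd (fst (f \<sigma>))})"
proof -
  obtain \<rho> where \<rho>: "r = fst (f \<rho>) \<and> fst (snd (\<tau> \<rho>)) = j \<or> r = snd (f \<rho>) \<and> snd (snd (\<tau> \<rho>)) = j"
    using r by (auto elim: pairs_cases)
  have zp: "z \<in> pts (f \<rho>)" using \<rho> z unfolding pts_eq by auto
  consider "(\<rho>, \<sigma>) \<in> real_less" | "\<rho> = \<sigma>" | "(\<sigma>, \<rho>) \<in> real_less" using real_less_total by blast
  then show ?thesis
  proof cases
    case 1
    then have "r \<in> below \<sigma> j" using \<rho> unfolding below_def stages_def by auto
    then show ?thesis using z unfolding points_def by auto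
  next
    case 2
    then have "z \<in> free \<sigma>" using zp pts_free by auto
    moreover have "fst (snd (\<tau> \<sigma>)) = j \<or> z \<notin> {fst (fst (f \<sigma>)), snd (fst (f \<sigma>))}"
      using \<rho> 2 z distinct_f[of \<sigma>] by auto
    ultimately show ?thesis by auto
  next
    case 3
    have zf: "z \<in> - \<rat> - used \<rho>" using zp pts_free[of \<rho>] unfolding free_def by auto
    have "used \<sigma> \<subseteq> used \<rho>" "pts (f \<sigma>) \<subseteq> used \<rho>"
      using 3 real_less_trans unfolding used_def by auto
    then have "z \<in> free \<sigma>" "z \<notin> pts (f \<sigma>)" using zf unfolding free_def by auto
    then show ?thesis unfolding pts_def by auto
  qed
qed

text \<open>The first alternative contradicts convergence along members. In the second,
  \<open>E\<close> meets every member in a finite set, so finitely many members cannot cover it up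
  to a finite set.\<close>

lemma ruin_not_in_space:
  assumes \<tau>: "\<tau> \<sigma> = (M, i, j)" and ruin: "stage_ruin (\<tau> \<sigma>) (below \<sigma>) (free \<sigma>) (f \<sigma>)"
  shows "\<not> in_space (pair_branch ` pairs j) (pair_sum M (fst (f \<sigma>)))"
proof
  assume isp: "in_space (pair_branch ` pairs j) (pair_sum M (fst (f \<sigma>)))"
  let ?h = "pair_sum M (fst (f \<sigma>))"
  have 1: "convergent_along ?h (pair_branch r)"
    if "r \<in> below \<sigma> j \<union> {snd (f \<sigma>)} \<union> (if i = j then {fst (f \<sigma>)} else {})" for r
  proof -
    have "r \<in> pairs j" using that \<tau> unfolding below_def pairs_def stages_def by (auto split: if_splits)
    then show ?thesis using isp unfolding in_space_def by auto
  qed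
  then obtain \<epsilon> E where \<epsilon>: "\<epsilon> > 0" and E: "infinite E" "\<And>n. n \<in> E \<Longrightarrow> \<epsilon> \<le> cmod (?h n)"
    and fin: "\<And>z. z \<in> points (below \<sigma> j) \<union> (if i = j then free \<sigma> else free \<sigma> - {fst (fst (f \<sigma>)), snd (fst (f \<sigma>))})
        \<Longrightarrow> finite (E \<inter> branch z)"
    using ruin unfolding stage_ruin_def ruin_def \<tau> fst_conv snd_conv by auto
  obtain \<W>0 where W: "\<W>0 \<subseteq> pair_branch ` pairs j" "finite \<W>0" "finite ({n. \<epsilon> \<le> cmod (?h n)} - \<Union>\<W>0)"
    using isp \<epsilon> unfolding in_space_def by auto
  have "finite (E \<inter> w)" if "w \<in> \<W>0" for w
  proof -
    obtain r where r: "r \<in> pairs j" "w = pair_branch r" using \<open>w \<in> \<W>0\<close> W(1) by blast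
    have "finite (E \<inter> branch z)" if "z \<in> {fst r, snd r}" for z
      using later_points[OF r(1) that, of \<sigma>] \<tau> by (intro fin) simp
    then show ?thesis unfolding r(2) pair_branch_def by (simp add: Int_Un_distrib)
  qed
  then have "finite (\<Union>w\<in>\<W>0. E \<inter> w)" using W(2) by (intro finite_UN_I)
  moreover have "E \<subseteq> (\<Union>w\<in>\<W>0. E \<inter> w) \<union> ({n. \<epsilon> \<le> cmod (?h n)} - \<Union>\<W>0)" using E(2) by auto
  ultimately show False using W(3) E(1) by (meson finite_UnI finite_subset)
qed

text \<open>Some stage treats \<open>(M, i, j)\<close> with a first pair outside the countable
  exceptional set. It did not ruin \<open>M\<close>, so nothing could, and \<open>no_ruin\<close>
  applies.\<close>

lemma pairs_scalar:
  assumes M: "c0_matrix M b"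
    and bad: "countable {r \<in> pairs i. \<not> in_space (pair_branch ` pairs j) (pair_sum M r)}"
  shows "\<exists>l. (i \<noteq> j \<longrightarrow> l = 0) \<and>
     countable {x \<in> - \<rat>. \<not> acts_as_scalar M l (branch x)}"
proof -
  obtain \<sigma> where \<sigma>: "\<tau> \<sigma> = (M, i, j)"
    "fst (f \<sigma>) \<notin> {r \<in> pairs i. \<not> in_space (pair_branch ` pairs j) (pair_sum M r)}"
    by (rule uncountable_stage_obtain[OF bad])
  have "fst (f \<sigma>) \<in> pairs i" using \<sigma>(1) unfolding pairs_def stages_def by auto
  then have "\<not> stage_ruin (\<tau> \<sigma>) (below \<sigma>) (free \<sigma>) (f \<sigma>)"
    using \<sigma> ruin_not_in_space by auto
  then have nr: "\<not> stage_ruin (\<tau> \<sigma>) (below \<sigma>) (free \<sigma>) w" if "fresh_quadruple (free \<sigma>) w" for w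
    using step[of \<sigma>] that unfolding step_def by blast
  have sub: "points (below \<sigma> j) \<subseteq> used \<sigma>"
    unfolding points_def below_def stages_def used_def pts_def by auto
  interpret c0_matrix M b by (rule M)
  interpret no_ruin M b "i = j" "below \<sigma> j" "free \<sigma>"
  proof
    show "free \<sigma> \<subseteq> - \<rat>" unfolding free_def by auto
    show "small (- \<rat> - free \<sigma>)" by (rule small_free)
    show "points (below \<sigma> j) \<inter> free \<sigma> = {}" using sub unfolding free_def by auto
    show "small (points (below \<sigma> j))" using small_used sub by (rule small_subset)
    fix x x1 y y1
    assume "distinct [x, x1, y, y1]" "{x, x1, y, y1} \<subseteq> free \<sigma>"
    then have "fresh_quadruple (free \<sigma>) ((x, x1), (y, y1))" unfolding fresh_quadruple_def pts_def by simp
    then show "\<not> ruin M (i = j) (below \<sigma> j) (free \<sigma>) (x, x1) (y, y1)"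
      using nr unfolding stage_ruin_def \<sigma>(1) by auto
  qed
  show ?thesis using exists_scalar by simp
qed

lemma pair_branch_Int:
  assumes "r \<in> pairs k" "r' \<in> pairs k'" "(k, r) \<noteq> (k', r')"
  shows "finite (pair_branch r \<inter> pair_branch r')"
proof -
  have "fst r \<noteq> fst r'" "fst r \<noteq> snd r'" "snd r \<noteq> fst r'" "snd r \<noteq> snd r'"
    using pairs_disjoint[OF assms] by auto
  then show ?thesis
    unfolding pair_branch_def by (simp add: finite_branch_Int Int_Un_distrib Int_Un_distrib2)
qed

lemma infinite_pair_branch: "infinite (pair_branch r)"
  unfolding pair_branch_def using infinite_branch by simp

lemma inj_on_pair_branch: "inj_on pair_branch (pairs k)"
proof (rule inj_onI, rule ccontr)
  fix r r' assume "r \<in> pairs k" "r' \<in> pairs k" "pair_branch r = pair_branch r'" "r \<noteq> r'"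
  then show False using pair_branch_Int[of r k r' k] infinite_pair_branch[of r'] by simp
qed

text \<open>An exceptional pair contains an exceptional branch, and a branch lies in at most one
  pair, so countability passes from branches to pairs.\<close>

lemma pair_branch_scalar:
  assumes M: "c0_matrix M b"
    and bad: "countable {p \<in> pair_branch ` pairs i. \<not> in_space (pair_branch ` pairs j) (row_sum M p)}"
  shows "\<exists>l. (i \<noteq> j \<longrightarrow> l = 0) \<and>
     countable {p \<in> pair_branch ` pairs i. \<not> acts_as_scalar M l p}"
proof -
  interpret c0_matrix M b by (rule M)
  have diff: "(\<lambda>n. row_sum M (pair_branch r) n - pair_sum M r n) \<longlonglongrightarrow> 0" if "r \<in> pairs k" for r k
    unfolding pair_branch_def pair_sum_def
    by (intro row_sum_Un_almost_disjoint finite_branch_Int) (rule pairs_distinct[OF that])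
  let ?bad = "{r \<in> pairs i. \<not> in_space (pair_branch ` pairs j) (pair_sum M r)}"
  have "countable (pair_branch ` ?bad)"
    by (rule countable_subset[OF _ bad]) (auto dest: in_space_cong[OF diff])
  then have "countable ?bad"
    by (rule countable_image_inj_on) (rule inj_on_subset[OF inj_on_pair_branch], auto)
  from pairs_scalar[OF M this] obtain l where l: "i \<noteq> j \<longrightarrow> l = 0"
    and l_small: "countable {x \<in> - \<rat>. \<not> acts_as_scalar M l (branch x)}"
    by auto
  define D where "D = {x \<in> - \<rat>. \<not> acts_as_scalar M l (branch x)}"
  have D: "countable D" using l_small unfolding D_def .
  have D_lim: "acts_as_scalar M l (branch x)" if "x \<in> - \<rat>" "x \<notin> D" for x
    using that unfolding D_def by simp
  let ?R = "{r \<in> pairs i. fst r \<in> D} \<union> {r \<in> pairs i. snd r \<in> D}"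
  have "inj_on fst (pairs i)" "inj_on snd (pairs i)"
  proof -
    have "r = r'" if "r \<in> pairs i" "r' \<in> pairs i" "fst r = fst r' \<or> snd r = snd r'" for r r'
    proof (rule ccontr)
      assume "r \<noteq> r'"
      then show False using pairs_disjoint[OF that(1,2)] that(3) by auto
    qed
    then show "inj_on fst (pairs i)" "inj_on snd (pairs i)" by (simp_all add: inj_on_def)
  qed
  then have inj: "inj_on fst {r \<in> pairs i. fst r \<in> D}" "inj_on snd {r \<in> pairs i. snd r \<in> D}"
    by (auto intro: inj_on_subset)
  have cnt: "countable (fst ` {r \<in> pairs i. fst r \<in> D})" "countable (snd ` {r \<in> pairs i. snd r \<in> D})"
    by (rule countable_subset[OF _ D]; blast)+
  have "countable ?R"
    by (rule countable_Un[OF countable_image_inj_on[OF cnt(1) inj(1)] countable_image_inj_on[OF cnt(2) inj(2)]])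
  moreover have "{p \<in> pair_branch ` pairs i. \<not> acts_as_scalar M l p} \<subseteq> pair_branch ` ?R"
  proof
    fix p assume p: "p \<in> {p \<in> pair_branch ` pairs i. \<not> acts_as_scalar M l p}"
    then obtain r where r: "r \<in> pairs i" "p = pair_branch r" by blast
    have "r \<in> ?R"
    proof (rule ccontr)
      assume "r \<notin> ?R"
      then have "acts_as_scalar M l (branch (fst r))"
        "acts_as_scalar M l (branch (snd r))"
        using r(1) pairs_irrational[OF r(1)] by (auto intro: D_lim)
      from tendsto_add[OF this]
      have 1: "(\<lambda>n. pair_sum M r n - l * (of_bool (n \<in> branch (fst r)) + of_bool (n \<in> branch (snd r)))) \<longlonglongrightarrow> 0"
        unfolding pair_sum_def by (simp add: algebra_simps)
      have 2: "(\<lambda>n. l * (of_bool (n \<in> branch (fst r)) + of_bool (n \<in> branch (snd r)) - of_bool (n \<in> p))) \<longlonglongrightarrow> 0"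
      proof (rule tendsto_eventually)
        have "finite (branch (fst r) \<inter> branch (snd r))"
          by (rule finite_branch_Int[OF pairs_distinct[OF r(1)]])
        then show "\<forall>\<^sub>F n in sequentially. l * (of_bool (n \<in> branch (fst r)) + of_bool (n \<in> branch (snd r)) - of_bool (n \<in> p)) = 0"
          unfolding eventually_sequentially_finite r(2) pair_branch_def
          by (rule rev_finite_subset) auto
      qed
      have "acts_as_scalar M l p"
        using tendsto_add[OF tendsto_add[OF diff[OF r(1)] 1] 2] unfolding r(2) by (simp add: algebra_simps)
      then show False using p by simp
    qed
    then show "p \<in> pair_branch ` ?R" using r by blast
  qed
  ultimately have "countable {p \<in> pair_branch ` pairs i. \<not> acts_as_scalar M l p}"
    by (intro countable_subset[OF _ countable_image[of ?R pair_branch]])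
  then show ?thesis using l by auto
qed

end

text \<open>All that the rest of the proof knows about the recursion. Almost disjointness across
  families makes the limit of 1_p vanish along the members of every other family.\<close>

locale rigid_family =
  fixes P :: "nat \<Rightarrow> nat set set"
  assumes P_unc: "uncountable (P i)"
    and P_inf: "p \<in> P i \<Longrightarrow> infinite p"
    and P_Int: "p \<in> P i \<Longrightarrow> q \<in> P j \<Longrightarrow> (i, p) \<noteq> (j, q) \<Longrightarrow> finite (p \<inter> q)"
    and P_rigid: "c0_matrix M b \<Longrightarrow> countable {p \<in> P i. \<not> in_space (P j) (row_sum M p)} \<Longrightarrow>
       \<exists>l. (i \<noteq> j \<longrightarrow> l = 0) \<and> countable {p \<in> P i. \<not> acts_as_scalar M l p}"

theorem rigid_family_exists: "\<exists>P. rigid_family P"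
proof -
  obtain \<tau> :: "real \<Rightarrow> task" where \<tau>: "\<forall>t. uncountable {s. \<tau> s = t}" using task_enumeration by auto
  obtain f where f: "\<forall>\<sigma>. construction.step \<tau> f \<sigma> (f \<sigma>)" using construction_exists by auto
  interpret constructed \<tau> f by unfold_locales (use f \<tau> in auto)
  have "rigid_family (\<lambda>i. pair_branch ` pairs i)"
  proof
    show "uncountable (pair_branch ` pairs i)" for i
      using uncountable_pairs inj_on_pair_branch countable_image_inj_on by metis
    show "infinite p" if "p \<in> pair_branch ` pairs i" for i p using that infinite_pair_branch by auto
    show "finite (p \<inter> q)"
      if pq: "p \<in> pair_branch ` pairs i" "q \<in> pair_branch ` pairs j" "(i, p) \<noteq> (j, q)" for i j p q
    proof -
      obtain r r' where r: "r \<in> pairs i" "p = pair_branch r" "r' \<in> pairs j" "q = pair_branch r'"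
        using pq by blast
      then have "(i, r) \<noteq> (j, r')" using pq(3) by auto
      then show ?thesis unfolding r(2,4) by (rule pair_branch_Int[OF r(1,3)])
    qed
  qed (rule pair_branch_scalar)
  then show ?thesis by blast
qed

section \<open>Matrix units in semisimple algebras\<close>

context complex_algebra
begin

lemma left_ideal_mult_right: "left_ideal L \<Longrightarrow> left_ideal ((\<lambda>x. x * a) ` L)"
  unfolding left_ideal_def subspace_def
  by (auto simp: image_iff simp flip: distrib_right mult_scale_left mult.assoc)
    (metis mult_zero_left)

lemma left_ideal_annihilator: "left_ideal L \<Longrightarrow> left_ideal {x \<in> L. x * a = 0}"
  unfolding left_ideal_def subspace_def
  by (auto simp: distrib_right mult_scale_left mult.assoc)

lemma left_ideal_UNIV: "left_ideal UNIV"
  unfolding left_ideal_def subspace_def by simp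

lemma left_ideal_range: "left_ideal (range (\<lambda>x. x * a))"
  by (rule left_ideal_mult_right[OF left_ideal_UNIV])

text \<open>If \<open>L\<close> is not inside a maximal modular \<open>P\<close>, then
  \<open>P + L\<close> is everything. Writing the modular unit as \<open>e = p + l\<close> gives
  \<open>x * e = x * p \<in> P\<close> for \<open>x \<in> L\<close>, and
  \<open>x - x * e \<in> P\<close> then puts \<open>x\<close> into \<open>P\<close>.\<close>

lemma square_zero_left_ideal:
  assumes semisimple and L: "left_ideal L" and sq: "\<And>x y. x \<in> L \<Longrightarrow> y \<in> L \<Longrightarrow> x * y = 0"
  shows "L = {0}"
proof -
  have "L \<subseteq> P" if P: "maximal_modular_left_ideal P" for P
  proof (rule ccontr)
    assume "\<not> L \<subseteq> P"
    have liP: "left_ideal P" and subP: "subspace P" and subL: "subspace L"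
      using P L unfolding maximal_modular_left_ideal_def modular_left_ideal_def left_ideal_def by auto
    let ?S = "{p + l |p l. p \<in> P \<and> l \<in> L}"
    have "left_ideal ?S"
      unfolding left_ideal_def
    proof
      show "subspace ?S" by (rule subspace_sums[OF subP subL])
      show "\<forall>a. \<forall>x\<in>?S. a * x \<in> ?S"
        using liP L unfolding left_ideal_def by (fastforce simp: distrib_left)
    qed
    moreover have "P \<subseteq> ?S" using subspace_0[OF subL] by force
    moreover have "?S \<noteq> P"
      using \<open>\<not> L \<subseteq> P\<close> subspace_0[OF subP] by force
    ultimately have "?S = UNIV"
      using P unfolding maximal_modular_left_ideal_def by blast
    obtain e where e: "\<And>a. a - a * e \<in> P"
      using P unfolding maximal_modular_left_ideal_def modular_left_ideal_def by blast
    have "e \<in> ?S" using \<open>?S = UNIV\<close> by simp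
    then obtain p l where pl: "e = p + l" "p \<in> P" "l \<in> L" by blast
    have "x \<in> P" if x: "x \<in> L" for x
    proof -
      have "x * e = x * p" using sq[OF x pl(3)] by (simp add: pl(1) distrib_left)
      then have "x * e \<in> P" using liP pl(2) unfolding left_ideal_def by simp
      from subspace_add[OF subP e[of x] this] show ?thesis by simp
    qed
    then show False using \<open>\<not> L \<subseteq> P\<close> by blast
  qed
  then have "L \<subseteq> jacobson_radical" unfolding jacobson_radical_def by blast
  then show ?thesis using assms(1) L subspace_0 unfolding semisimple_def left_ideal_def by auto
qed

definition minimal_left_ideal :: "'a set \<Rightarrow> bool" where
  "minimal_left_ideal N \<longleftrightarrow> left_ideal N \<and> N \<noteq> {0} \<and> (\<forall>L. left_ideal L \<longrightarrow> L \<subseteq> N \<longrightarrow> L = {0} \<or> L = N)"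

definition primitive :: "'a \<Rightarrow> bool" where
  "primitive e \<longleftrightarrow> e * e = e \<and> e \<noteq> 0 \<and> minimal_left_ideal (range (\<lambda>a. a * e))"

text \<open>Brauer's lemma: right multiplication by a suitable \<open>a\<close> maps
  \<open>N\<close> onto itself with zero kernel, so the element \<open>e\<close> of \<open>N\<close>
  with \<open>e * a = a\<close> is idempotent.\<close>

lemma minimal_left_ideal_idempotent:
  assumes semisimple and N: "minimal_left_ideal N"
  obtains e where "primitive e" "e \<in> N"
proof -
  have li: "left_ideal N" and min: "\<And>L. left_ideal L \<Longrightarrow> L \<subseteq> N \<Longrightarrow> L = {0} \<or> L = N"
    and sub: "subspace N" and mult: "\<And>a x. x \<in> N \<Longrightarrow> a * x \<in> N"
    using N unfolding minimal_left_ideal_def left_ideal_def by auto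
  have "\<not> (\<forall>x\<in>N. \<forall>y\<in>N. x * y = 0)"
    using square_zero_left_ideal[OF assms(1) li] N unfolding minimal_left_ideal_def by auto
  then obtain x a where xa: "x \<in> N" "a \<in> N" "x * a \<noteq> 0" by blast
  have "(\<lambda>x. x * a) ` N = {0} \<or> (\<lambda>x. x * a) ` N = N"
    by (rule min[OF left_ideal_mult_right[OF li]]) (use mult xa in auto)
  moreover have "(\<lambda>x. x * a) ` N \<noteq> {0}" using xa by auto
  ultimately have "a \<in> (\<lambda>x. x * a) ` N" using xa(2) by simp
  then obtain e where e: "e \<in> N" "e * a = a" by auto
  have "a \<noteq> 0" using xa(3) by auto
  have "{x \<in> N. x * a = 0} = {0} \<or> {x \<in> N. x * a = 0} = N"
    by (rule min[OF left_ideal_annihilator[OF li]]) auto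
  moreover have "e \<notin> {x \<in> N. x * a = 0}" using e \<open>a \<noteq> 0\<close> by simp
  ultimately have ann: "{x \<in> N. x * a = 0} = {0}" using e(1) by auto
  have "e * e - e \<in> {x \<in> N. x * a = 0}"
    using e mult subspace_diff[OF sub] by (simp add: left_diff_distrib mult.assoc)
  then have ee: "e * e = e" using ann by auto
  have e0: "e \<noteq> 0" using e(2) \<open>a \<noteq> 0\<close> by auto
  have "range (\<lambda>a. a * e) = {0} \<or> range (\<lambda>a. a * e) = N"
    by (rule min[OF left_ideal_range]) (use mult e in auto)
  moreover have "e \<in> range (\<lambda>a. a * e)" using ee by (metis rangeI)
  ultimately have "range (\<lambda>a. a * e) = N" using e0 by auto
  then have "primitive e" using ee e0 N unfolding primitive_def by simp
  then show thesis using that e(1) by blast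
qed

text \<open>The multiples of \<open>y\<close> form a left ideal inside the minimal one generated by
  \<open>e\<close>. Without a unit, \<open>e' * y = y\<close> is what ensures that \<open>y\<close>
  itself is among them.\<close>

lemma primitive_left_inverse:
  assumes e: "primitive e" and y: "y * e = y" "y \<noteq> 0" "e' * y = y"
  obtains a where "a * y = e"
proof -
  have min: "\<And>L. left_ideal L \<Longrightarrow> L \<subseteq> range (\<lambda>a. a * e) \<Longrightarrow> L = {0} \<or> L = range (\<lambda>a. a * e)"
    and ee: "e * e = e" using e unfolding primitive_def minimal_left_ideal_def by auto
  have "range (\<lambda>a. a * y) = {0} \<or> range (\<lambda>a. a * y) = range (\<lambda>a. a * e)"
  proof (rule min[OF left_ideal_range])
    show "range (\<lambda>a. a * y) \<subseteq> range (\<lambda>a. a * e)"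
    proof
      fix z assume "z \<in> range (\<lambda>a. a * y)"
      then obtain a where "z = a * y" by auto
      then have "z = (a * y) * e" using y(1) by (simp add: mult.assoc)
      then show "z \<in> range (\<lambda>a. a * e)" by auto
    qed
  qed
  moreover have "y \<in> range (\<lambda>a. a * y)" using y(3) by (metis rangeI)
  ultimately have "range (\<lambda>a. a * y) = range (\<lambda>a. a * e)" using y(2) by auto
  moreover have "e \<in> range (\<lambda>a. a * e)" using ee by (metis rangeI)
  ultimately have "e \<in> range (\<lambda>a. a * y)" by simp
  then obtain a where "e = a * y" by blast
  then show thesis by (intro that) simp
qed

lemma primitive_no_zero_divisors:
  assumes e: "primitive e" and y: "y * e = y" "e * y = y" and z: "e * z = z" and "y * z = 0"
  shows "y = 0 \<or> z = 0"
proof (cases "y = 0")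
  case False
  obtain a where "a * y = e" using primitive_left_inverse[OF e y(1) False y(2)] by auto
  then have "e * z = 0" using assms(5) by (metis mult.assoc mult_zero_right)
  then show ?thesis using z by simp
qed simp

section \<open>Polynomials evaluated in a corner, with the idempotent as unit\<close>

definition eval_poly :: "'a \<Rightarrow> 'a \<Rightarrow> complex poly \<Rightarrow> 'a" where
  "eval_poly e y p = fold_coeffs (\<lambda>a x. scale a e + y * x) p 0"

lemma eval_poly_pCons: "eval_poly e y (pCons a p) = scale a e + y * eval_poly e y p"
  unfolding eval_poly_def
  by (cases "p = 0"; cases "a = 0") (simp_all add: fold_coeffs_pCons_coeff_not_0_eq fold_coeffs_pCons_not_0_0_eq)

lemma eval_poly_0: "eval_poly e y 0 = 0"
  unfolding eval_poly_def by simp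

lemma eval_poly_add: "eval_poly e y (p + q) = eval_poly e y p + eval_poly e y q"
  by (induction p q rule: poly_induct2)
    (simp_all add: eval_poly_0 eval_poly_pCons scale_left_distrib distrib_left algebra_simps)

lemma eval_poly_smult: "eval_poly e y (Polynomial.smult c p) = scale c (eval_poly e y p)"
  by (induction p) (simp_all add: eval_poly_0 eval_poly_pCons scale_right_distrib mult_scale_right)

lemma eval_poly_sum: "eval_poly e y (sum p I) = (\<Sum>i\<in>I. eval_poly e y (p i))"
  by (induction I rule: infinite_finite_induct) (simp_all add: eval_poly_0 eval_poly_add)

lemma eval_poly_left_unit:
  assumes "e * e = e" "e * y = y"
  shows "e * eval_poly e y p = eval_poly e y p"
  by (cases p) (simp add: eval_poly_pCons distrib_left mult_scale_right assms flip: mult.assoc)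

lemma eval_poly_root:
  assumes "e * e = e" "e * y = y"
  shows "eval_poly e y ([:- a, 1:] * q) = (y - scale a e) * eval_poly e y q"
proof -
  have "[:- a, 1:] * q = Polynomial.smult (- a) q + pCons 0 q" by simp
  then have "eval_poly e y ([:- a, 1:] * q) = scale (- a) (eval_poly e y q) + y * eval_poly e y q"
    by (simp only: eval_poly_add eval_poly_smult eval_poly_pCons) simp
  also have "\<dots> = (y - scale a e) * eval_poly e y q"
    by (simp add: left_diff_distrib mult_scale_left eval_poly_left_unit[OF assms])
  finally show ?thesis .
qed

text \<open>The corner has no zero divisors, so splitting off a complex root \<open>a\<close> of
  \<open>p\<close> either gives \<open>y = scale a e\<close> or lowers the degree.\<close>

lemma scalar_of_annihilating_poly:
  assumes e: "primitive e" and y: "y * e = y" "e * y = y"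
    and "p \<noteq> 0" "eval_poly e y p = 0"
  shows "\<exists>c. y = scale c e"
  using assms(4,5)
proof (induction "degree p" arbitrary: p rule: less_induct)
  case less
  have ee: "e * e = e" "e \<noteq> 0" using e unfolding primitive_def by auto
  show ?case
  proof (cases "degree p = 0")
    case True
    then obtain c where c: "p = [:c:]" by (metis degree_eq_zeroE)
    then have "scale c e = 0" using less.prems by (simp add: eval_poly_pCons eval_poly_0)
    then show ?thesis using c less.prems(1) ee(2) by simp
  next
    case False
    then obtain a where "poly p a = 0"
      using fundamental_theorem_of_algebra[of p] constant_degree[of p] by auto
    then obtain q where q: "p = [:- a, 1:] * q" unfolding poly_eq_0_iff_dvd by (rule dvdE)
    have q0: "q \<noteq> 0" using q less.prems(1) by auto
    have deg: "degree q < degree p"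
      using q0 unfolding q by (subst degree_mult_eq) auto
    have "(y - scale a e) * eval_poly e y q = 0"
      using less.prems(2) unfolding q eval_poly_root[OF ee(1) y(2)] .
    then have "y - scale a e = 0 \<or> eval_poly e y q = 0"
      by (intro primitive_no_zero_divisors[OF e])
        (simp_all add: left_diff_distrib right_diff_distrib mult_scale_left mult_scale_right y ee
          eval_poly_left_unit)
    then show ?thesis using less.hyps[OF deg q0] by auto
  qed
qed

end

locale fd_complex_algebra = complex_algebra scale + finite_dimensional_vector_space scale Basis
  for scale :: "complex \<Rightarrow> 'a::ring \<Rightarrow> 'a" and Basis
begin

lemma dependent_if_large: "card Basis < card X \<Longrightarrow> dependent X"
  using independent_card_le_dim[of X UNIV] by auto

text \<open>There are more powers of \<open>y\<close> than the dimension. Dependence is a property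
  of sets, so two coinciding powers form a case of their own.\<close>

lemma annihilating_poly:
  obtains p where "p \<noteq> 0" "eval_poly e y p = 0"
proof -
  define pw where "pw i = eval_poly e y (monom 1 i)" for i
  have pw: "eval_poly e y (monom c i) = scale c (pw i)" for c i
    unfolding pw_def by (simp flip: eval_poly_smult add: Polynomial.smult_monom)
  define n where "n = Suc (card Basis)"
  show thesis
  proof (cases "inj_on pw {..<n}")
    case False
    then obtain i j where ij: "i \<noteq> j" "pw i = pw j" unfolding inj_on_def by auto
    let ?p = "monom 1 i + Polynomial.smult (- 1) (monom 1 j) :: complex poly"
    have "coeff ?p i = 1" using ij(1) by simp
    then have "?p \<noteq> 0" by (metis coeff_0 zero_neq_one)
    moreover have "eval_poly e y ?p = 0"
      unfolding eval_poly_add eval_poly_smult pw using ij(2) by simp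
    ultimately show thesis by (rule that)
  next
    case True
    have "dependent (pw ` {..<n})"
      by (rule dependent_if_large) (simp add: card_image[OF True], simp add: n_def)
    then obtain u v where u: "v \<in> pw ` {..<n}" "u v \<noteq> 0" "(\<Sum>v\<in>pw ` {..<n}. scale (u v) v) = 0"
      by (subst (asm) dependent_finite) auto
    let ?p = "\<Sum>i<n. monom (u (pw i)) i"
    obtain i where i: "i < n" "v = pw i" using u(1) by auto
    have "coeff ?p i = u (pw i)"
      using i(1) by (simp add: coeff_sum sum.delta)
    then have "?p \<noteq> 0" using u(2) i(2) by (metis coeff_0)
    moreover have "eval_poly e y ?p = 0"
      using u(3) by (simp add: eval_poly_sum pw sum.reindex[OF True])
    ultimately show thesis by (rule that)
  qed
qed

text \<open>Schur's lemma in the language of idempotents.\<close>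

lemma primitive_corner:
  assumes "primitive e"
  shows "\<exists>c. e * x * e = scale c e"
proof -
  have ee: "e * e = e" using assms unfolding primitive_def by auto
  obtain p where "p \<noteq> 0" "eval_poly e (e * x * e) p = 0" by (rule annihilating_poly)
  then show ?thesis
    by (intro scalar_of_annihilating_poly[OF assms]) (simp_all add: mult.assoc ee, simp add: ee flip: mult.assoc)
qed

lemma contains_minimal_left_ideal:
  assumes "left_ideal L" "L \<noteq> {0}"
  obtains N where "minimal_left_ideal N" "N \<subseteq> L"
proof -
  let ?Q = "\<lambda>N. left_ideal N \<and> N \<noteq> {0} \<and> N \<subseteq> L"
  obtain N where N: "?Q N" "\<And>N'. ?Q N' \<Longrightarrow> dim N \<le> dim N'"
    using ex_has_least_nat[of ?Q L dim] assms by auto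
  have "minimal_left_ideal N"
    unfolding minimal_left_ideal_def
  proof (intro conjI allI impI)
    fix L' assume L': "left_ideal L'" "L' \<subseteq> N"
    show "L' = {0} \<or> L' = N"
    proof (cases "L' = {0}")
      case False
      then have "dim N \<le> dim L'" using L' N by auto
      then have "L' = N"
        using L' N(1) unfolding left_ideal_def by (intro subspace_dim_equal) auto
      then show ?thesis ..
    qed simp
  qed (use N in auto)
  then show thesis using that N(1) by auto
qed

section \<open>Complete systems of orthogonal primitive idempotents\<close>

definition orthogonal :: "'a set \<Rightarrow> bool" where
  "orthogonal E \<longleftrightarrow> finite E \<and> (\<forall>e\<in>E. primitive e) \<and> (\<forall>e\<in>E. \<forall>f\<in>E. e \<noteq> f \<longrightarrow> e * f = 0)"

lemma orthogonal_mult_sum: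
  assumes "orthogonal E" "f \<in> E"
  shows "f * (\<Sum>e\<in>E. scale (u e) e) = scale (u f) f" "(\<Sum>e\<in>E. scale (u e) e) * f = scale (u f) f"
proof -
  have fin: "finite E" and ff: "f * f = f" using assms unfolding orthogonal_def primitive_def by auto
  have "f * (\<Sum>e\<in>E. scale (u e) e) = (\<Sum>e\<in>E. if e = f then scale (u f) f else 0)"
    unfolding sum_distrib_left mult_scale_right
    by (intro sum.cong) (use assms ff in \<open>auto simp: orthogonal_def\<close>)
  then show "f * (\<Sum>e\<in>E. scale (u e) e) = scale (u f) f" using fin assms(2) by simp
  have "(\<Sum>e\<in>E. scale (u e) e) * f = (\<Sum>e\<in>E. if e = f then scale (u f) f else 0)"
    unfolding sum_distrib_right mult_scale_left
    by (intro sum.cong) (use assms ff in \<open>auto simp: orthogonal_def\<close>)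
  then show "(\<Sum>e\<in>E. scale (u e) e) * f = scale (u f) f" using fin assms(2) by simp
qed

lemma orthogonal_card: "orthogonal E \<Longrightarrow> card E \<le> card Basis"
proof (rule ccontr)
  assume E: "orthogonal E" and "\<not> card E \<le> card Basis"
  then have "dependent E" by (intro dependent_if_large) simp
  moreover have "finite E" using E unfolding orthogonal_def by simp
  ultimately obtain u v where u: "v \<in> E" "u v \<noteq> 0" "(\<Sum>v\<in>E. scale (u v) v) = 0"
    by (subst (asm) dependent_finite) auto
  then have "scale (u v) v = 0" using orthogonal_mult_sum(1)[OF E u(1), of u] by simp
  then show False using u E unfolding orthogonal_def primitive_def by auto
qed

text \<open>Take an orthogonal set of largest size, which exists because such sets are independent.
  If some nonzero \<open>x\<close> had \<open>x * s = 0\<close> for its sum \<open>s\<close>, a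
  primitive idempotent among these \<open>x\<close> could be modified and added.\<close>

lemma complete_orthogonal:
  assumes semisimple
  obtains E where "orthogonal E" "\<And>x. x * \<Sum>E = x" "\<And>x. \<Sum>E * x = x"
proof -
  have "orthogonal {}" unfolding orthogonal_def by simp
  moreover have "\<forall>E. orthogonal E \<longrightarrow> card E < Suc (card Basis)"
    using orthogonal_card by (simp add: less_Suc_eq_le)
  ultimately have "\<exists>E. orthogonal E \<and> (\<forall>E'. orthogonal E' \<longrightarrow> card E' \<le> card E)"
    by (rule ex_has_greatest_nat)
  then obtain E where E: "orthogonal E" "\<And>E'. orthogonal E' \<Longrightarrow> card E' \<le> card E" by auto
  have fin: "finite E" using E(1) unfolding orthogonal_def by simp
  define s where "s = \<Sum>E"
  have es: "e * s = e" "s * e = e" if "e \<in> E" for e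
    using orthogonal_mult_sum[OF E(1) that, of "\<lambda>_. 1"] unfolding s_def by simp_all
  have ss: "s * s = s"
  proof -
    have "s * s = (\<Sum>e\<in>E. e * s)" unfolding s_def sum_distrib_right ..
    also have "\<dots> = s" using es(1) by (simp add: s_def)
    finally show ?thesis .
  qed
  let ?L = "{x \<in> UNIV. x * s = 0}"
  have li: "left_ideal ?L" by (rule left_ideal_annihilator[OF left_ideal_UNIV])
  have "?L = {0}"
  proof (rule ccontr)
    assume "?L \<noteq> {0}"
    then obtain N where N: "minimal_left_ideal N" "N \<subseteq> ?L"
      using contains_minimal_left_ideal[OF li] by metis
    obtain f where f: "primitive f" "f \<in> N" by (rule minimal_left_ideal_idempotent[OF assms N(1)])
    have fs: "f * s = 0" using f N by auto
    have ff: "f * f = f" "f \<noteq> 0" and fmin: "minimal_left_ideal (range (\<lambda>a. a * f))"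
      using f(1) unfolding primitive_def by auto
    \<comment> \<open>\<open>f\<close> is orthogonal to the sum on one side only; subtracting
      \<open>s * f\<close> repairs the other side and leaves the generated left ideal
      unchanged.\<close>
    define f' where "f' = f - s * f"
    have 1: "f * f' = f"
    proof -
      have "f * (s * f) = 0" using fs by (simp flip: mult.assoc)
      then show ?thesis unfolding f'_def by (simp add: right_diff_distrib ff)
    qed
    have 2: "f' * f = f'" unfolding f'_def by (simp add: left_diff_distrib mult.assoc ff)
    have 3: "f' * f' = f'" using 1 2 by (metis mult.assoc)
    have 4: "s * f' = 0" unfolding f'_def by (simp add: right_diff_distrib ss flip: mult.assoc)
    have 5: "f' * s = 0" unfolding f'_def by (simp add: left_diff_distrib mult.assoc fs)
    have "range (\<lambda>a. a * f') = range (\<lambda>a. a * f)"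
    proof (intro equalityI subsetI)
      fix z assume "z \<in> range (\<lambda>a. a * f')"
      then obtain a where "z = a * f'" by auto
      then have "z = (a * f') * f" using 2 by (simp add: mult.assoc)
      then show "z \<in> range (\<lambda>a. a * f)" by auto
    next
      fix z assume "z \<in> range (\<lambda>a. a * f)"
      then obtain a where "z = a * f" by auto
      then have "z = (a * f) * f'" using 1 by (simp add: mult.assoc)
      then show "z \<in> range (\<lambda>a. a * f')" by auto
    qed
    then have prim: "primitive f'" using 1 3 ff(2) fmin unfolding primitive_def by auto
    have ef: "e * f' = 0" "f' * e = 0" if "e \<in> E" for e
    proof -
      have "e * f' = e * (s * f')" using es[OF that] by (simp flip: mult.assoc)
      then show "e * f' = 0" using 4 by simp
      have "f' * e = (f' * s) * e" using es[OF that] by (simp add: mult.assoc)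
      then show "f' * e = 0" using 5 by simp
    qed
    have "f' \<notin> E"
    proof
      assume "f' \<in> E"
      then show False using ef(1)[of f'] 3 prim unfolding primitive_def by simp
    qed
    moreover have "orthogonal (insert f' E)"
      using E(1) prim ef unfolding orthogonal_def by auto
    ultimately show False using E(2)[of "insert f' E"] fin by simp
  qed
  then have right: "x * s = x" for x
  proof -
    have "(x - x * s) * s = 0" by (simp add: left_diff_distrib mult.assoc ss)
    then have "x - x * s \<in> ?L" by simp
    then have "x - x * s \<in> {0}" unfolding \<open>?L = {0}\<close> .
    then show ?thesis by simp
  qed
  \<comment> \<open>Elements killed by every left multiplication form an ideal of square zero, and
    \<open>x - s * x\<close> is one of them since \<open>a * s = a\<close>.\<close>
  let ?R = "{x :: 'a. \<forall>a. a * x = 0}"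
  have "?R = {0}"
  proof (rule square_zero_left_ideal[OF assms])
    show "left_ideal ?R" unfolding left_ideal_def subspace_def
      by (auto simp: distrib_left mult_scale_right simp flip: mult.assoc)
  qed auto
  have left: "s * x = x" for x
  proof -
    have "a * (x - s * x) = 0" for a
      by (simp add: right_diff_distrib right flip: mult.assoc)
    then have "x - s * x \<in> ?R" by simp
    then have "x - s * x \<in> {0}" unfolding \<open>?R = {0}\<close> .
    then show ?thesis by simp
  qed
  show thesis using that[OF E(1)] right left unfolding s_def by blast
qed

section \<open>Equivalence of idempotents and matrix units\<close>

definition linked :: "'a \<Rightarrow> 'a \<Rightarrow> 'a \<Rightarrow> 'a \<Rightarrow> bool" where
  "linked e f u v \<longleftrightarrow> e * u = u \<and> u * f = u \<and> f * v = v \<and> v * e = v \<and> u * v = e \<and> v * u = f"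

text \<open>A left inverse of \<open>u = e * x * f\<close>, cut down to the corner, gives
  \<open>v\<close> with \<open>v * u = f\<close>. Then \<open>u * v\<close> is a nonzero idempotent
  among the multiples of \<open>e\<close>, hence \<open>e\<close> itself.\<close>

lemma linkedI:
  assumes e: "primitive e" and f: "primitive f" and "e * x * f \<noteq> 0"
  shows "\<exists>u v. linked e f u v"
proof -
  have ee: "e * e = e" "e \<noteq> 0" and ff: "f * f = f" "f \<noteq> 0" using e f unfolding primitive_def by auto
  define u where "u = e * x * f"
  have eu: "e * u = u" unfolding u_def by (simp add: ee flip: mult.assoc)
  have uf: "u * f = u" unfolding u_def by (simp add: ff mult.assoc)
  have "u \<noteq> 0" using assms(3) unfolding u_def .
  obtain a where a: "a * u = f" by (rule primitive_left_inverse[OF f uf \<open>u \<noteq> 0\<close> eu])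
  define v where "v = f * a * e"
  have fv: "f * v = v" unfolding v_def by (simp add: ff flip: mult.assoc)
  have ve: "v * e = v" unfolding v_def by (simp add: ee mult.assoc)
  have vu: "v * u = f" unfolding v_def by (simp add: mult.assoc eu a ff)
  obtain c where c: "e * (u * v) * e = scale c e" using primitive_corner[OF e] by blast
  have "e * (u * v) * e = u * v" by (simp add: mult.assoc ve) (simp add: eu flip: mult.assoc)
  then have uv: "u * v = scale c e" using c by simp
  have "(u * v) * (u * v) = u * v"
  proof -
    have "(u * v) * (u * v) = u * (v * u) * v" by (simp add: mult.assoc)
    then show ?thesis unfolding vu uf .
  qed
  then have "scale (c * c) e = scale c e" unfolding uv by (simp add: mult_scale_left mult_scale_right ee)
  then have "c * c = c" using ee(2) by simp
  moreover have "c \<noteq> 0"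
  proof
    assume "c = 0"
    then have "u * v = 0" using uv by simp
    then have "(v * u) * (v * u) = 0" by (metis mult.assoc mult_zero_left mult_zero_right)
    then show False unfolding vu using ff by simp
  qed
  ultimately have "c = 1" by simp
  then have "linked e f u v" unfolding linked_def using eu uf fv ve vu uv by simp
  then show ?thesis by blast
qed

lemma linked_sym: "linked e f u v \<Longrightarrow> linked f e v u"
  unfolding linked_def by auto

lemma linked_trans:
  assumes "linked e f u v" "linked f g u' v'"
  shows "linked e g (u * u') (v' * v)"
proof -
  have "u * u' * (v' * v) = u * (u' * v') * v" "v' * v * (u * u') = v' * (v * u) * u'"
    by (simp_all add: mult.assoc)
  then show ?thesis using assms unfolding linked_def by (metis mult.assoc)
qed

text \<open>Wedderburn-Artin in coordinates. The blocks are recorded by the class function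
  \<open>cl\<close> on indices, which is the form in which they enter the choice of the almost
  disjoint family.\<close>

theorem matrix_units:
  assumes semisimple
  shows "\<exists>(m :: nat) (cl :: nat \<Rightarrow> nat) (U :: nat \<Rightarrow> nat \<Rightarrow> 'a).
    (\<forall>i<m. \<forall>j<m. \<forall>k<m. \<forall>l<m. cl i = cl j \<longrightarrow> cl k = cl l \<longrightarrow> U i j * U k l = (if j = k then U i l else 0)) \<and>
    (\<forall>x. \<exists>c. x = (\<Sum>i<m. \<Sum>j<m. if cl i = cl j then scale (c i j) (U i j) else 0)) \<and>
    (\<forall>i<m. \<forall>j<m. cl i = cl j \<longrightarrow> U i j \<noteq> 0)"
proof -
  obtain E where E: "orthogonal E" "\<And>x. x * \<Sum>E = x" "\<And>x. \<Sum>E * x = x"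
    using complete_orthogonal[OF assms] by metis
  have "finite E" using E(1) unfolding orthogonal_def by simp
  then obtain e where e: "bij_betw e {..<card E} E"
    using bij_betw_from_nat_into_finite by blast
  define m where "m = card E"
  have eE: "e i \<in> E" if "i < m" for i using e that unfolding m_def bij_betw_def by auto
  have prim: "primitive (e i)" if "i < m" for i using E(1) eE[OF that] unfolding orthogonal_def by simp
  have ee: "e i * e i = e i" "e i \<noteq> 0" if "i < m" for i using prim[OF that] unfolding primitive_def by auto
  have orth: "e i * e j = 0" if "i < m" "j < m" "i \<noteq> j" for i j
  proof -
    have "e i \<noteq> e j" using e that unfolding m_def bij_betw_def inj_on_def by auto
    then show ?thesis using E(1) eE that unfolding orthogonal_def by simp
  qed
  define lnk where "lnk i j \<longleftrightarrow> j < m \<and> (\<exists>u v. linked (e i) (e j) u v)" for i j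
  have lnk_refl: "lnk i i" if "i < m" for i
    unfolding lnk_def using that ee[OF that] by (auto simp: linked_def intro!: exI[of _ "e i"])
  define cl where "cl i = (LEAST j. lnk i j)" for i
  have cl: "lnk i (cl i)" if "i < m" for i
    unfolding cl_def by (rule LeastI) (rule lnk_refl[OF that])
  have cl_eq: "cl i = cl j" if "i < m" "lnk i j" for i j
  proof -
    have "lnk i k \<longleftrightarrow> lnk j k" for k
      using that(2) unfolding lnk_def by (meson linked_sym linked_trans)
    then show ?thesis unfolding cl_def by presburger
  qed
  obtain u v where uv: "\<And>i. i < m \<Longrightarrow> linked (e i) (e (cl i)) (u i) (v i)"
    using cl unfolding lnk_def by metis
  \<comment> \<open>Every unit passes through the representative of its class, so the inner factors
    \<open>v j * u j\<close> cancel in products.\<close>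
  define U where "U i j = u i * v j" for i j
  have UU: "U i j * U k l = (if j = k then U i l else 0)"
    if "i < m" "j < m" "k < m" "l < m" "cl i = cl j" "cl k = cl l" for i j k l
  proof (cases "j = k")
    case True
    have "U i j * U k l = u i * (v j * u k) * v l" unfolding U_def by (simp add: mult.assoc)
    also have "v j * u k = e (cl i)" using uv[OF that(2)] that(5) True unfolding linked_def by simp
    also have "u i * e (cl i) = u i" using uv[OF that(1)] unfolding linked_def by simp
    finally show ?thesis using True unfolding U_def by simp
  next
    case False
    have "v j = v j * e j" "u k = e k * u k" using uv that unfolding linked_def by auto
    then have "v j * u k = v j * (e j * e k) * u k" by (metis mult.assoc)
    then have "v j * u k = 0" using orth[OF that(2,3) False] by simp
    then have "U i j * U k l = 0" unfolding U_def by (metis mult.assoc mult_zero_left mult_zero_right)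
    then show ?thesis using False by simp
  qed
  have Uii: "U i i = e i" if "i < m" for i
    using uv[OF that] unfolding U_def linked_def by simp
  have U0: "U i j \<noteq> 0" if ij: "i < m" "j < m" "cl i = cl j" for i j
  proof
    assume "U i j = 0"
    moreover have "U i j * U j i = U i i"
      using UU[OF ij(1,2,2,1,3) ij(3)[symmetric]] by simp
    ultimately show False using Uii[OF ij(1)] ee(2)[OF ij(1)] by simp
  qed
  have s: "\<Sum>E = (\<Sum>i<m. e i)"
    using e unfolding m_def bij_betw_def by (metis sum.reindex_cong)
  \<comment> \<open>Between different classes the corner vanishes, as a nonzero element would link
    them. Within a class, multiplication by \<open>u j * v i\<close> carries it into the corner of
    \<open>e i\<close>, which consists of scalars.\<close>
  have corner: "\<exists>c. e i * x * e j = (if cl i = cl j then scale c (U i j) else 0)" if ij: "i < m" "j < m" for i j x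
  proof (cases "cl i = cl j")
    case True
    define w where "w = e i * x * e j"
    obtain c where c: "e i * (x * e j * u j * v i) * e i = scale c (e i)"
      using primitive_corner[OF prim[OF ij(1)]] by blast
    have "w * u j * v i = scale c (e i)"
      using c uv[OF ij(1)] unfolding w_def linked_def by (metis mult.assoc)
    have "w = w * e j" unfolding w_def by (simp add: mult.assoc ee ij)
    also have "\<dots> = w * u j * (e (cl i) * v j)"
      using uv[OF ij(2)] True unfolding linked_def by (simp add: mult.assoc)
    also have "\<dots> = w * u j * (v i * u i * v j)"
      using uv[OF ij(1)] unfolding linked_def by simp
    also have "\<dots> = w * u j * v i * (u i * v j)" by (simp add: mult.assoc)
    also have "\<dots> = scale c (e i * u i * v j)"
      unfolding \<open>w * u j * v i = scale c (e i)\<close> by (simp add: mult_scale_left mult.assoc)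
    also have "\<dots> = scale c (U i j)" using uv[OF ij(1)] unfolding linked_def U_def by simp
    finally show ?thesis using True unfolding w_def by auto
  next
    case False
    then have "\<not> lnk i j" using cl_eq ij by auto
    then have "e i * x * e j = 0" using linkedI[OF prim prim] ij unfolding lnk_def by blast
    then show ?thesis using False by auto
  qed
  have span: "\<exists>c. x = (\<Sum>i<m. \<Sum>j<m. if cl i = cl j then scale (c i j) (U i j) else 0)" for x
  proof -
    define c where "c i j = (SOME a. e i * x * e j = (if cl i = cl j then scale a (U i j) else 0))" for i j
    have c: "e i * x * e j = (if cl i = cl j then scale (c i j) (U i j) else 0)" if "i < m" "j < m" for i j
      unfolding c_def by (rule someI_ex[OF corner[OF that]])
    have "x = \<Sum>E * x * \<Sum>E" using E by simp
    also have "\<dots> = (\<Sum>i<m. \<Sum>j<m. e i * x * e j)"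
      unfolding s sum_distrib_right sum_distrib_left by (rule sum.swap)
    also have "\<dots> = (\<Sum>i<m. \<Sum>j<m. if cl i = cl j then scale (c i j) (U i j) else 0)"
      by (intro sum.cong refl c) auto
    finally show ?thesis by blast
  qed
  show ?thesis
    by (rule exI[of _ m], rule exI[of _ cl], rule exI[of _ U], intro conjI allI impI UU span U0)
qed

end

lemma (in complex_algebra) finite_dimensional_basis:
  assumes finite_dimensional
  obtains Basis where "fd_complex_algebra scale Basis"
proof -
  obtain B0 where B0: "finite B0" "span B0 = UNIV" using assms unfolding finite_dimensional_def by blast
  obtain B where B: "B \<subseteq> B0" "independent B" "B0 \<subseteq> span B" by (rule basis_exists[of B0]) auto
  have "span B0 \<subseteq> span B" using B(3) by (rule span_minimal) (rule subspace_span)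
  then have "span B = UNIV" using B0 by auto
  then have "fd_complex_algebra scale B"
    using B B0(1) by unfold_locales (auto intro: finite_subset)
  then show thesis by (rule that)
qed

section \<open>Functions on the space of an almost disjoint family\<close>

lemma eventually_along_in:
  "eventually P (along A) \<Longrightarrow> \<exists>F. finite F \<and> (\<forall>n\<in>A - F. P n)"
  unfolding eventually_along by (intro exI[of _ "{n \<in> A. \<not> P n}"]) auto

lemma finite_cover_finite_rest:
  assumes "\<And>x. x \<in> S \<Longrightarrow> \<exists>U\<in>\<U>. x \<in> U" "finite \<T>" "\<T> \<subseteq> \<U>" "finite (S - \<Union>\<T>)"
  shows "\<exists>\<F>. finite \<F> \<and> \<F> \<subseteq> \<U> \<and> S \<subseteq> \<Union>\<F>"
proof -
  obtain V where V: "\<And>x. x \<in> S \<Longrightarrow> V x \<in> \<U> \<and> x \<in> V x" using assms(1) by metis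
  show ?thesis
    by (rule exI[of _ "\<T> \<union> V ` (S - \<Union>\<T>)"]) (use assms V in auto)
qed

locale ad_family =
  fixes \<A> :: "nat set set"
  assumes ad: "almost_disjoint_family \<A>"
begin

abbreviation K :: "(nat + nat set) topology" where "K \<equiv> K_space \<A>"

lemma infinite_mem: "A \<in> \<A> \<Longrightarrow> infinite A"
  using ad unfolding almost_disjoint_family_def by blast

lemma finite_Int: "A \<in> \<A> \<Longrightarrow> B \<in> \<A> \<Longrightarrow> A \<noteq> B \<Longrightarrow> finite (A \<inter> B)"
  using ad unfolding almost_disjoint_family_def by blast

lemma mem_topspace: "Inl n \<in> topspace K" "Inr A \<in> topspace K \<longleftrightarrow> A \<in> \<A>"
  unfolding topspace_K_space K_points_def by auto

text \<open>The points x_n are isolated, so continuity is a condition at the points y_A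
  only.\<close>

lemma continuous_map_K_iff:
  "continuous_map K euclidean f \<longleftrightarrow> (\<forall>A\<in>\<A>. ((\<lambda>n. f (Inl n)) \<longlongrightarrow> f (Inr A)) (along A))"
proof
  assume f: "continuous_map K euclidean f"
  show "\<forall>A\<in>\<A>. ((\<lambda>n. f (Inl n)) \<longlongrightarrow> f (Inr A)) (along A)"
  proof (intro ballI topological_tendstoI)
    fix A S assume A: "A \<in> \<A>" and S: "open S" "f (Inr A) \<in> S"
    have "openin K {x \<in> topspace K. f x \<in> S}"
      by (rule openin_continuous_map_preimage[OF f]) (use S in auto)
    moreover have "Inr A \<in> {x \<in> topspace K. f x \<in> S}" using A S by (simp add: mem_topspace)
    ultimately obtain F where F: "finite F" "insert (Inr A) (Inl ` (A - F)) \<subseteq> {x \<in> topspace K. f x \<in> S}"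
      using A unfolding openin_K_space by meson
    then have "{n \<in> A. f (Inl n) \<notin> S} \<subseteq> F" by auto
    then show "\<forall>\<^sub>F n in along A. f (Inl n) \<in> S"
      unfolding eventually_along using F(1) finite_subset by auto
  qed
next
  assume f: "\<forall>A\<in>\<A>. ((\<lambda>n. f (Inl n)) \<longlongrightarrow> f (Inr A)) (along A)"
  show "continuous_map K euclidean f"
    unfolding continuous_map_def openin_K_space
  proof (intro conjI allI impI ballI)
    fix U A assume U: "openin euclidean U" and A: "A \<in> \<A>" "Inr A \<in> {x \<in> topspace K. f x \<in> U}"
    then have "\<forall>\<^sub>F n in along A. f (Inl n) \<in> U"
      using f by (intro topological_tendstoD[of _ "f (Inr A)"]) auto
    then obtain F where "finite F" "\<forall>n\<in>A - F. f (Inl n) \<in> U" using eventually_along_in by blast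
    then show "\<exists>F. finite F \<and> insert (Inr A) (Inl ` (A - F)) \<subseteq> {x \<in> topspace K. f x \<in> U}"
      using A by (intro exI[of _ F]) (auto simp: mem_topspace)
  qed (auto simp: topspace_K_space)
qed

text \<open>Vanishing at infinity as seen on the isolated points: a compact set is covered by
  finitely many points x_n and finitely many sets consisting of y_A and the x_n with n in A.\<close>

definition controlled :: "(nat \<Rightarrow> complex) \<Rightarrow> bool" where
  "controlled f \<longleftrightarrow> (\<forall>\<epsilon>>0. \<exists>\<W>\<subseteq>\<A>. finite \<W> \<and> finite ({n. \<epsilon> \<le> cmod (f n)} - \<Union>\<W>))"

lemma controlledE:
  assumes "controlled f" "\<epsilon> > 0"
  obtains \<W> where "\<W> \<subseteq> \<A>" "finite \<W>" "finite ({n. \<epsilon> \<le> cmod (f n)} - \<Union>\<W>)"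
  using assms unfolding controlled_def by auto

text \<open>Otherwise \<open>A\<close> would meet each member of \<open>\<W>\<close> finitely,
  although almost all of \<open>A\<close> lies where \<open>f\<close> is large.\<close>

lemma large_limit_mem:
  assumes "\<W> \<subseteq> \<A>" "finite \<W>" "finite ({n. \<epsilon> \<le> cmod (f n)} - \<Union>\<W>)"
    and "A \<in> \<A>" "(f \<longlongrightarrow> l) (along A)" "\<epsilon> < cmod l"
  shows "A \<in> \<W>"
proof (rule ccontr)
  assume "A \<notin> \<W>"
  have "\<forall>\<^sub>F n in along A. \<epsilon> < cmod (f n)"
    using order_tendstoD(1)[OF tendsto_norm[OF assms(5)] assms(6)] .
  then have "finite {n \<in> A. \<not> \<epsilon> < cmod (f n)}" unfolding eventually_along .
  moreover have "finite (\<Union>B\<in>\<W>. A \<inter> B)"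
    using assms \<open>A \<notin> \<W>\<close> by (intro finite_UN_I finite_Int) auto
  moreover have "A \<subseteq> {n \<in> A. \<not> \<epsilon> < cmod (f n)} \<union> (\<Union>B\<in>\<W>. A \<inter> B) \<union> ({n. \<epsilon> \<le> cmod (f n)} - \<Union>\<W>)"
    by auto
  ultimately have "finite A" using assms(3) by (meson finite_UnI finite_subset)
  then show False using infinite_mem[OF assms(4)] by simp
qed

text \<open>Translates the topology into conditions on sequences: an element of \<open>C0 K\<close>
  is from now on a sequence with limits along the members of \<open>\<A>\<close>.\<close>

lemma C0_iff:
  "f \<in> C0 K \<longleftrightarrow> (\<forall>A\<in>\<A>. ((\<lambda>n. f (Inl n)) \<longlongrightarrow> f (Inr A)) (along A)) \<and>
     controlled (\<lambda>n. f (Inl n)) \<and> (\<forall>A. A \<notin> \<A> \<longrightarrow> f (Inr A) = 0)"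
proof
  assume f: "f \<in> C0 K"
  have lim: "\<forall>A\<in>\<A>. ((\<lambda>n. f (Inl n)) \<longlongrightarrow> f (Inr A)) (along A)"
    using f unfolding C0_def continuous_map_K_iff by blast
  have zero: "\<forall>A. A \<notin> \<A> \<longrightarrow> f (Inr A) = 0" using f unfolding C0_def by (simp add: mem_topspace)
  have "controlled (\<lambda>n. f (Inl n))"
    unfolding controlled_def
  proof (intro allI impI)
    fix \<epsilon> :: real assume "\<epsilon> > 0"
    let ?S = "{x \<in> topspace K. \<epsilon> \<le> cmod (f x)}"
    \<comment> \<open>Singletons and the largest basic neighbourhoods cover \<open>K\<close>, and a
      finite subcover displays the wanted \<open>N\<close> and \<open>\<W>\<close>.\<close>
    let ?g = "\<lambda>n. {Inl n :: nat + nat set}" and ?h = "\<lambda>A. insert (Inr A) (Inl ` A) :: (nat + nat set) set"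
    have "compactin K ?S" using f \<open>\<epsilon> > 0\<close> unfolding C0_def by blast
    moreover have "\<forall>U\<in>range ?g \<union> ?h ` \<A>. openin K U"
    proof -
      have "openin K (?g n)" for n unfolding openin_K_space K_points_def by auto
      moreover have "openin K (?h A)" if "A \<in> \<A>" for A
        unfolding openin_K_space K_points_def using that by (auto intro!: exI[of _ "{}"])
      ultimately show ?thesis by blast
    qed
    moreover have "?S \<subseteq> \<Union>(range ?g \<union> ?h ` \<A>)"
    proof
      fix x assume "x \<in> ?S"
      then show "x \<in> \<Union>(range ?g \<union> ?h ` \<A>)" by (cases x) (auto simp: mem_topspace)
    qed
    ultimately obtain \<F> where F: "finite \<F>" "\<F> \<subseteq> range ?g \<union> ?h ` \<A>" "?S \<subseteq> \<Union>\<F>"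
      unfolding compactin_def by meson
    obtain N where N: "finite N" "\<F> \<inter> range ?g = ?g ` N"
      using finite_subset_image[of "\<F> \<inter> range ?g" ?g UNIV] F(1) by auto
    obtain \<W> where W: "\<W> \<subseteq> \<A>" "finite \<W>" "\<F> \<inter> ?h ` \<A> = ?h ` \<W>"
      using finite_subset_image[of "\<F> \<inter> ?h ` \<A>" ?h \<A>] F(1) by auto
    have "\<F> = (\<F> \<inter> range ?g) \<union> (\<F> \<inter> ?h ` \<A>)"
      using inf_absorb1[OF F(2)] unfolding Int_Un_distrib by (rule sym)
    then have "\<F> = ?g ` N \<union> ?h ` \<W>" unfolding N(2) W(3) .
    then have S: "?S \<subseteq> Inl ` N \<union> (\<Union>A\<in>\<W>. ?h A)" using F(3) by auto
    have "{n. \<epsilon> \<le> cmod (f (Inl n))} - \<Union>\<W> \<subseteq> N"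
    proof
      fix n assume n: "n \<in> {n. \<epsilon> \<le> cmod (f (Inl n))} - \<Union>\<W>"
      then have "Inl n \<in> ?S" by (simp add: mem_topspace)
      then show "n \<in> N" using S n by auto
    qed
    from finite_subset[OF this N(1)]
    show "\<exists>\<W>\<subseteq>\<A>. finite \<W> \<and> finite ({n. \<epsilon> \<le> cmod (f (Inl n))} - \<Union>\<W>)"
      using W(1,2) by (intro exI[of _ \<W>] conjI)
  qed
  then show "(\<forall>A\<in>\<A>. ((\<lambda>n. f (Inl n)) \<longlongrightarrow> f (Inr A)) (along A)) \<and>
     controlled (\<lambda>n. f (Inl n)) \<and> (\<forall>A. A \<notin> \<A> \<longrightarrow> f (Inr A) = 0)" using lim zero by blast
next
  assume f: "(\<forall>A\<in>\<A>. ((\<lambda>n. f (Inl n)) \<longlongrightarrow> f (Inr A)) (along A)) \<and>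
     controlled (\<lambda>n. f (Inl n)) \<and> (\<forall>A. A \<notin> \<A> \<longrightarrow> f (Inr A) = 0)"
  then have lim: "\<And>A. A \<in> \<A> \<Longrightarrow> ((\<lambda>n. f (Inl n)) \<longlongrightarrow> f (Inr A)) (along A)" by blast
  have "compactin K {x \<in> topspace K. \<epsilon> \<le> cmod (f x)}" if eps: "\<epsilon> > 0" for \<epsilon>
    unfolding compactin_def
  proof (intro conjI allI impI)
    fix \<U> assume U: "(\<forall>U\<in>\<U>. openin K U) \<and> {x \<in> topspace K. \<epsilon> \<le> cmod (f x)} \<subseteq> \<Union>\<U>"
    let ?S = "{x \<in> topspace K. \<epsilon> \<le> cmod (f x)}"
    \<comment> \<open>Halving \<open>\<epsilon>\<close> provides the strict inequality of
      \<open>large_limit_mem\<close> for limits of modulus exactly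
      \<open>\<epsilon>\<close>.\<close>
    obtain \<W> where W: "\<W> \<subseteq> \<A>" "finite \<W>" "finite ({n. \<epsilon> / 2 \<le> cmod (f (Inl n))} - \<Union>\<W>)"
      using f eps by (auto intro: controlledE[of "\<lambda>n. f (Inl n)" "\<epsilon> / 2"])
    \<comment> \<open>\<open>T\<close> is the cover element chosen for \<open>A\<close>. The empty
      set stands for none, when \<open>f\<close> is below \<open>\<epsilon>\<close> at y_A and hence
      large at only finitely many points of \<open>A\<close>.\<close>
    define P where "P A T \<longleftrightarrow> (T = {} \<or> T \<in> \<U>) \<and> finite {n \<in> A. \<epsilon> \<le> cmod (f (Inl n)) \<and> Inl n \<notin> T} \<and>
        (\<epsilon> \<le> cmod (f (Inr A)) \<longrightarrow> Inr A \<in> T)" for A T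
    have loc: "\<exists>T. P A T" if A: "A \<in> \<A>" for A
    proof (cases "\<epsilon> \<le> cmod (f (Inr A))")
      case True
      then have "Inr A \<in> ?S" using A by (simp add: mem_topspace)
      then obtain V where V: "V \<in> \<U>" "Inr A \<in> V" using U by auto
      then have "openin K V" using U by blast
      then obtain F where F: "finite F" "insert (Inr A) (Inl ` (A - F)) \<subseteq> V"
        using V(2) A unfolding openin_K_space by meson
      have "{n \<in> A. \<epsilon> \<le> cmod (f (Inl n)) \<and> Inl n \<notin> V} \<subseteq> F" using F(2) by auto
      from finite_subset[OF this F(1)] show ?thesis using V unfolding P_def by (intro exI[of _ V]) simp
    next
      case False
      have "\<forall>\<^sub>F n in along A. cmod (f (Inl n)) < \<epsilon>"
        using order_tendstoD(2)[OF tendsto_norm[OF lim[OF A]]] False by auto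
      then have "finite {n \<in> A. \<not> cmod (f (Inl n)) < \<epsilon>}" unfolding eventually_along .
      then have "finite {n \<in> A. \<epsilon> \<le> cmod (f (Inl n)) \<and> Inl n \<notin> {}}" by (simp add: not_less)
      then show ?thesis using False unfolding P_def by (intro exI[of _ "{}"]) simp
    qed
    define T where "T A = (SOME T. P A T)" for A
    have PT: "P A (T A)" if "A \<in> \<A>" for A
      unfolding T_def by (rule someI_ex[OF loc[OF that]])
    have T: "\<And>A. A \<in> \<A> \<Longrightarrow> T A = {} \<or> T A \<in> \<U>"
        "\<And>A. A \<in> \<A> \<Longrightarrow> finite ({n \<in> A. \<epsilon> \<le> cmod (f (Inl n)) \<and> Inl n \<notin> T A})"
        "\<And>A. A \<in> \<A> \<Longrightarrow> \<epsilon> \<le> cmod (f (Inr A)) \<Longrightarrow> Inr A \<in> T A"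
      using PT unfolding P_def by simp_all
    let ?R = "({n. \<epsilon> / 2 \<le> cmod (f (Inl n))} - \<Union>\<W>) \<union> (\<Union>A\<in>\<W>. {n \<in> A. \<epsilon> \<le> cmod (f (Inl n)) \<and> Inl n \<notin> T A})"
    have "finite (?S - \<Union>(T ` \<W> - {{}}))"
    proof (rule finite_subset)
      show "?S - \<Union>(T ` \<W> - {{}}) \<subseteq> Inl ` ?R"
      proof
        fix x assume x: "x \<in> ?S - \<Union>(T ` \<W> - {{}})"
        show "x \<in> Inl ` ?R"
        proof (cases x)
          case (Inl n)
          then have n: "\<epsilon> \<le> cmod (f (Inl n))" "\<And>A. A \<in> \<W> \<Longrightarrow> Inl n \<notin> T A" using x by auto
          then have "n \<in> ?R" using eps by auto
          then show ?thesis using Inl by blast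
        next
          case (Inr A)
          then have A: "A \<in> \<A>" "\<epsilon> \<le> cmod (f (Inr A))" using x by (auto simp: mem_topspace)
          then have "A \<in> \<W>"
            using large_limit_mem[OF W A(1) lim[OF A(1)]] A(2) eps by simp
          then have "x \<in> \<Union>(T ` \<W> - {{}})" using T(3)[OF A] Inr by auto
          then show ?thesis using x by simp
        qed
      qed
      show "finite (Inl ` ?R)" using W T(2) by (intro finite_imageI finite_UnI finite_UN_I) auto
    qed
    moreover have "T ` \<W> - {{}} \<subseteq> \<U>" using T(1) W(1) by auto
    ultimately show "\<exists>\<F>. finite \<F> \<and> \<F> \<subseteq> \<U> \<and> ?S \<subseteq> \<Union>\<F>"
      using U W(2) by (intro finite_cover_finite_rest[of _ _ "T ` \<W> - {{}}"]) auto
  qed auto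
  moreover have "f x = 0" if "x \<notin> topspace K" for x
    using that f by (cases x) (auto simp: mem_topspace)
  ultimately show "f \<in> C0 K" unfolding C0_def continuous_map_K_iff using lim by auto
qed

lemma controlled_add:
  assumes "controlled f" "controlled g" shows "controlled (\<lambda>n. f n + g n)"
  unfolding controlled_def
proof (intro allI impI)
  fix \<epsilon> :: real assume "\<epsilon> > 0"
  then have e: "\<epsilon> / 2 > 0" by simp
  obtain V where V: "V \<subseteq> \<A>" "finite V" "finite ({n. \<epsilon> / 2 \<le> cmod (f n)} - \<Union>V)"
    by (rule controlledE[OF assms(1) e])
  obtain W where W: "W \<subseteq> \<A>" "finite W" "finite ({n. \<epsilon> / 2 \<le> cmod (g n)} - \<Union>W)"
    by (rule controlledE[OF assms(2) e])
  have "{n. \<epsilon> \<le> cmod (f n + g n)} - \<Union>(V \<union> W) \<subseteq>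
      ({n. \<epsilon> / 2 \<le> cmod (f n)} - \<Union>V) \<union> ({n. \<epsilon> / 2 \<le> cmod (g n)} - \<Union>W)"
  proof
    fix n assume n: "n \<in> {n. \<epsilon> \<le> cmod (f n + g n)} - \<Union>(V \<union> W)"
    then have "\<epsilon> \<le> cmod (f n) + cmod (g n)" using norm_triangle_ineq[of "f n" "g n"] by simp
    then show "n \<in> ({n. \<epsilon> / 2 \<le> cmod (f n)} - \<Union>V) \<union> ({n. \<epsilon> / 2 \<le> cmod (g n)} - \<Union>W)"
      using n by auto
  qed
  then have "finite ({n. \<epsilon> \<le> cmod (f n + g n)} - \<Union>(V \<union> W))"
    by (rule finite_subset) (intro finite_UnI V W)
  then show "\<exists>\<W>\<subseteq>\<A>. finite \<W> \<and> finite ({n. \<epsilon> \<le> cmod (f n + g n)} - \<Union>\<W>)"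
    using V W by (intro exI[of _ "V \<union> W"]) simp
qed

lemma controlled_cmult:
  assumes "controlled f" shows "controlled (\<lambda>n. c * f n)"
proof (cases "c = 0")
  case True
  then show ?thesis unfolding controlled_def by (auto intro!: exI[of _ "{}"])
next
  case False
  show ?thesis unfolding controlled_def
  proof (intro allI impI)
    fix \<epsilon> :: real assume "\<epsilon> > 0"
    then have e: "\<epsilon> / cmod c > 0" using False by simp
    obtain V where V: "V \<subseteq> \<A>" "finite V" "finite ({n. \<epsilon> / cmod c \<le> cmod (f n)} - \<Union>V)"
      by (rule controlledE[OF assms e])
    moreover have "{n. \<epsilon> \<le> cmod (c * f n)} = {n. \<epsilon> / cmod c \<le> cmod (f n)}"
      using False by (simp add: norm_mult field_simps)
    ultimately show "\<exists>\<W>\<subseteq>\<A>. finite \<W> \<and> finite ({n. \<epsilon> \<le> cmod (c * f n)} - \<Union>\<W>)" by auto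
  qed
qed

lemma C0_add: "f \<in> C0 K \<Longrightarrow> g \<in> C0 K \<Longrightarrow> (\<lambda>x. f x + g x) \<in> C0 K"
  unfolding C0_iff by (auto intro!: tendsto_add controlled_add)

lemma C0_cmult: "f \<in> C0 K \<Longrightarrow> (\<lambda>x. c * f x) \<in> C0 K"
  unfolding C0_iff by (auto intro!: tendsto_mult_left controlled_cmult)

lemma C0_zero: "(\<lambda>x. 0) \<in> C0 K"
  unfolding C0_iff controlled_def by (auto intro!: exI[of _ "{}"])

lemma C0_diff: "f \<in> C0 K \<Longrightarrow> g \<in> C0 K \<Longrightarrow> (\<lambda>x. f x - g x) \<in> C0 K"
  using C0_add[of f "\<lambda>x. (-1) * g x"] C0_cmult[of g "-1"] by simp

lemma C0_sum: "(\<And>i. i \<in> I \<Longrightarrow> h i \<in> C0 K) \<Longrightarrow> (\<lambda>x. \<Sum>i\<in>I. c i * h i x) \<in> C0 K"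
proof (induction I rule: infinite_finite_induct)
  case (insert j I)
  have "(\<lambda>x. c j * h j x + (\<Sum>i\<in>I. c i * h i x)) \<in> C0 K"
    by (rule C0_add[OF C0_cmult insert.IH]) (use insert.prems in auto)
  then show ?case using insert.hyps by simp
qed (simp_all add: C0_zero)

section \<open>Generating indicator functions and approximation\<close>

definition gen :: "nat + nat set \<Rightarrow> nat + nat set \<Rightarrow> complex" where
  "gen i x = of_bool (x = i \<or> (\<exists>A n. i = Inr A \<and> x = Inl n \<and> n \<in> A))"

lemma gen_simps [simp]:
  "gen (Inl k) (Inl n) = of_bool (n = k)" "gen (Inl k) (Inr B) = 0"
  "gen (Inr A) (Inl n) = of_bool (n \<in> A)" "gen (Inr A) (Inr B) = of_bool (B = A)"
  unfolding gen_def by auto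

lemma gen_le: "cmod (gen i x) \<le> 1"
  unfolding gen_def by simp

lemma gen_Inl: "gen (Inl k) \<in> C0 K"
  unfolding C0_iff
proof (intro conjI ballI allI impI)
  fix A assume "A \<in> \<A>"
  show "((\<lambda>n. gen (Inl k) (Inl n)) \<longlongrightarrow> gen (Inl k) (Inr A)) (along A)"
    by (rule tendsto_eventually) (simp add: eventually_along)
next
  show "controlled (\<lambda>n. gen (Inl k) (Inl n))"
    unfolding controlled_def
  proof (intro allI impI)
    fix \<epsilon> :: real assume "\<epsilon> > 0"
    then have "{n. \<epsilon> \<le> cmod (gen (Inl k) (Inl n))} \<subseteq> {k}" by auto
    then have "finite {n. \<epsilon> \<le> cmod (gen (Inl k) (Inl n))}" by (rule finite_subset) simp
    then show "\<exists>\<W>\<subseteq>\<A>. finite \<W> \<and> finite ({n. \<epsilon> \<le> cmod (gen (Inl k) (Inl n))} - \<Union>\<W>)"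
      by (intro exI[of _ "{}"]) simp
  qed
qed simp

lemma gen_Inr: "A \<in> \<A> \<Longrightarrow> gen (Inr A) \<in> C0 K"
  unfolding C0_iff
proof (intro conjI ballI allI impI)
  fix B assume "B \<in> \<A>" "A \<in> \<A>"
  show "((\<lambda>n. gen (Inr A) (Inl n)) \<longlongrightarrow> gen (Inr A) (Inr B)) (along B)"
  proof (rule tendsto_eventually)
    have "{n \<in> B. \<not> gen (Inr A) (Inl n) = gen (Inr A) (Inr B)} \<subseteq> (if B = A then {} else B \<inter> A)" by auto
    then show "\<forall>\<^sub>F n in along B. gen (Inr A) (Inl n) = gen (Inr A) (Inr B)"
      unfolding eventually_along using finite_Int[OF \<open>B \<in> \<A>\<close> \<open>A \<in> \<A>\<close>]
      by (rule_tac finite_subset) auto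
  qed
next
  assume "A \<in> \<A>"
  show "controlled (\<lambda>n. gen (Inr A) (Inl n))"
    unfolding controlled_def
  proof (intro allI impI)
    fix \<epsilon> :: real assume "\<epsilon> > 0"
    then have "{n. \<epsilon> \<le> cmod (gen (Inr A) (Inl n))} - \<Union>{A} = {}" by auto
    then show "\<exists>\<W>\<subseteq>\<A>. finite \<W> \<and> finite ({n. \<epsilon> \<le> cmod (gen (Inr A) (Inl n))} - \<Union>\<W>)"
      using \<open>A \<in> \<A>\<close> by (intro exI[of _ "{A}"]) (metis empty_subsetI finite.emptyI finite_insert insert_subset)
  qed
qed auto

lemma gen_C0: "i \<in> topspace K \<Longrightarrow> gen i \<in> C0 K"
  by (cases i) (auto simp: mem_topspace gen_Inl gen_Inr)

lemma C0_limit: "f \<in> C0 K \<Longrightarrow> A \<in> \<A> \<Longrightarrow> ((\<lambda>n. f (Inl n)) \<longlongrightarrow> f (Inr A)) (along A)"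
  unfolding C0_iff by blast

lemma C0_finite_large:
  assumes "f \<in> C0 K" "\<epsilon> > 0" shows "finite {A \<in> \<A>. \<epsilon> \<le> cmod (f (Inr A))}"
proof -
  obtain \<W> where W: "\<W> \<subseteq> \<A>" "finite \<W>" "finite ({n. \<epsilon> / 2 \<le> cmod (f (Inl n))} - \<Union>\<W>)"
    using assms unfolding C0_iff by (auto intro: controlledE[of "\<lambda>n. f (Inl n)" "\<epsilon> / 2"])
  have "{A \<in> \<A>. \<epsilon> \<le> cmod (f (Inr A))} \<subseteq> \<W>"
  proof
    fix A assume A: "A \<in> {A \<in> \<A>. \<epsilon> \<le> cmod (f (Inr A))}"
    then show "A \<in> \<W>" using large_limit_mem[OF W _ C0_limit[OF assms(1)]] assms(2) by auto
  qed
  then show ?thesis using W(2) by (rule finite_subset)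
qed

lemma C0_countable_support:
  assumes "f \<in> C0 K" shows "countable {A \<in> \<A>. f (Inr A) \<noteq> 0}"
proof -
  have "{A \<in> \<A>. f (Inr A) \<noteq> 0} \<subseteq> (\<Union>m. {A \<in> \<A>. inverse (real (Suc m)) \<le> cmod (f (Inr A))})"
  proof
    fix A assume A: "A \<in> {A \<in> \<A>. f (Inr A) \<noteq> 0}"
    then obtain m where "inverse (real (Suc m)) < cmod (f (Inr A))"
      using reals_Archimedean[of "cmod (f (Inr A))"] by auto
    then show "A \<in> (\<Union>m. {A \<in> \<A>. inverse (real (Suc m)) \<le> cmod (f (Inr A))})"
      using A less_imp_le by blast
  qed
  moreover have "countable (\<Union>m. {A \<in> \<A>. inverse (real (Suc m)) \<le> cmod (f (Inr A))})"
  proof (rule countable_UN)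
    show "countable {A \<in> \<A>. inverse (real (Suc m)) \<le> cmod (f (Inr A))}" for m
      by (rule countable_finite[OF C0_finite_large[OF assms]]) simp
  qed simp
  ultimately show ?thesis by (rule countable_subset)
qed

lemma C0_finite_of_small_limits:
  assumes "f \<in> C0 K" "\<epsilon> > 0" "\<And>A. A \<in> \<A> \<Longrightarrow> cmod (f (Inr A)) < \<epsilon>"
  shows "finite {n. \<epsilon> \<le> cmod (f (Inl n))}"
proof -
  obtain \<W> where W: "\<W> \<subseteq> \<A>" "finite \<W>" "finite ({n. \<epsilon> \<le> cmod (f (Inl n))} - \<Union>\<W>)"
    using assms(1,2) unfolding C0_iff by (auto intro: controlledE[of "\<lambda>n. f (Inl n)" \<epsilon>])
  have "finite {n \<in> A. \<not> cmod (f (Inl n)) < \<epsilon>}" if "A \<in> \<W>" for A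
  proof -
    have A: "A \<in> \<A>" using that W(1) by auto
    show ?thesis
      using order_tendstoD(2)[OF tendsto_norm[OF C0_limit[OF assms(1) A]] assms(3)[OF A]]
      unfolding eventually_along .
  qed
  then have "finite (({n. \<epsilon> \<le> cmod (f (Inl n))} - \<Union>\<W>) \<union> (\<Union>A\<in>\<W>. {n \<in> A. \<not> cmod (f (Inl n)) < \<epsilon>}))"
    using W by (intro finite_UnI finite_UN_I) auto
  then show ?thesis by (rule rev_finite_subset) auto
qed

text \<open>Once the finitely many indicators with large limits are subtracted, the rest is large at
  finitely many isolated points, which are corrected one by one. The condition on \<open>X\<close>
  records that only generators at actual limits of \<open>f\<close> occur.\<close>

lemma C0_approx:
  assumes f: "f \<in> C0 K" and "\<epsilon> > 0"
  obtains X c where "finite X" "X \<subseteq> range Inl \<union> Inr ` {A \<in> \<A>. f (Inr A) \<noteq> 0}"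
    "\<And>x. cmod (f x - (\<Sum>i\<in>X. c i * gen i x)) \<le> \<epsilon>"
proof -
  define W where "W = {A \<in> \<A>. \<epsilon> \<le> cmod (f (Inr A))}"
  have W: "finite W" "W \<subseteq> \<A>" unfolding W_def using C0_finite_large[OF assms] by auto
  define h where "h x = f x - (\<Sum>A\<in>W. f (Inr A) * gen (Inr A) x)" for x
  have h: "h \<in> C0 K"
    unfolding h_def by (intro C0_diff f C0_sum gen_Inr) (use W in auto)
  have h0: "cmod (h (Inr A)) < \<epsilon>" for A
  proof (cases "A \<in> W")
    case True
    then have "(\<Sum>B\<in>W. f (Inr B) * gen (Inr B) (Inr A)) = f (Inr A)"
      using W(1) by (simp add: sum.delta' if_distrib cong: if_cong)
    then show ?thesis using \<open>\<epsilon> > 0\<close> unfolding h_def by simp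
  next
    case False
    then have "(\<Sum>B\<in>W. f (Inr B) * gen (Inr B) (Inr A)) = 0"
      by (intro sum.neutral) auto
    moreover have "cmod (f (Inr A)) < \<epsilon>"
      using False f \<open>\<epsilon> > 0\<close> unfolding W_def C0_iff by (cases "A \<in> \<A>") auto
    ultimately show ?thesis unfolding h_def by simp
  qed
  define F where "F = {n. \<epsilon> \<le> cmod (h (Inl n))}"
  have F: "finite F" unfolding F_def by (rule C0_finite_of_small_limits[OF h \<open>\<epsilon> > 0\<close> h0])
  define c where "c i = (case i of Inl n \<Rightarrow> h (Inl n) | Inr A \<Rightarrow> f (Inr A))" for i :: "nat + nat set"
  let ?X = "Inl ` F \<union> Inr ` W"
  have sum: "(\<Sum>i\<in>?X. c i * gen i x) = (\<Sum>n\<in>F. h (Inl n) * gen (Inl n) x) + (\<Sum>A\<in>W. f (Inr A) * gen (Inr A) x)" for x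
    using F W(1) by (subst sum.union_disjoint) (auto simp: sum.reindex c_def)
  have "cmod (f x - (\<Sum>i\<in>?X. c i * gen i x)) \<le> \<epsilon>" for x
  proof -
    have eq: "f x - (\<Sum>i\<in>?X. c i * gen i x) = h x - (\<Sum>n\<in>F. h (Inl n) * gen (Inl n) x)"
      unfolding sum h_def by simp
    show ?thesis
    proof (cases x)
      case (Inl n)
      have "(\<Sum>m\<in>F. h (Inl m) * gen (Inl m) (Inl n)) = (if n \<in> F then h (Inl n) else 0)"
        using F by (simp add: sum.delta' if_distrib cong: if_cong)
      moreover have "n \<notin> F \<Longrightarrow> cmod (h (Inl n)) \<le> \<epsilon>" unfolding F_def by simp
      ultimately show ?thesis using \<open>\<epsilon> > 0\<close> unfolding eq unfolding Inl by simp
    next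
      case (Inr A)
      then show ?thesis unfolding eq unfolding Inr using h0[of A] by simp
    qed
  qed
  moreover have "?X \<subseteq> range Inl \<union> Inr ` {A \<in> \<A>. f (Inr A) \<noteq> 0}"
    using \<open>\<epsilon> > 0\<close> unfolding W_def by auto
  moreover have "finite ?X" using F W by simp
  ultimately show thesis using that[of ?X c] by blast
qed

section \<open>Separability in the supremum distance\<close>

lemma sup_dist_le: "(\<And>x. cmod (f x - g x) \<le> c) \<Longrightarrow> sup_dist f g \<le> c"
  unfolding sup_dist_def by (rule sup_norm_least)

lemma le_sup_dist: "f \<in> C0 K \<Longrightarrow> g \<in> C0 K \<Longrightarrow> cmod (f x - g x) \<le> sup_dist f g"
  unfolding sup_dist_def using cmod_le_sup_norm[OF bounded_C0[OF C0_diff]] by auto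

lemma separable_part:
  assumes "countable Q" "Q \<subseteq> \<A>"
  obtains D where "countable D" "D \<subseteq> C0 K"
    "\<And>f \<epsilon>. f \<in> C0 K \<Longrightarrow> (\<And>B. B \<in> \<A> - Q \<Longrightarrow> f (Inr B) = 0) \<Longrightarrow> \<epsilon> > 0 \<Longrightarrow> \<exists>d\<in>D. sup_dist f d \<le> \<epsilon>"
proof -
  obtain Z :: "complex set" where Z: "countable Z" "\<And>U. open U \<Longrightarrow> U \<noteq> {} \<Longrightarrow> \<exists>z\<in>Z. z \<in> U"
    using countable_dense_setE by metis
  let ?I = "range Inl \<union> Inr ` Q :: (nat + nat set) set"
  define D where "D = (\<Union>X\<in>{X. X \<subseteq> ?I \<and> finite X}. (\<lambda>q x. \<Sum>i\<in>X. q i * gen i x) ` PiE X (\<lambda>_. Z))"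
  have I: "?I \<subseteq> topspace K" using assms(2) by (auto simp: mem_topspace)
  have "countable {X. X \<subseteq> ?I \<and> finite X}"
    using countable_Collect_finite_subset[of ?I] assms(1) by (simp add: conj_commute)
  then have "countable D"
    unfolding D_def by (intro countable_UN countable_image countable_PiE Z) auto
  moreover have "D \<subseteq> C0 K"
  proof
    fix d assume "d \<in> D"
    then obtain X q where X: "X \<subseteq> ?I" "d = (\<lambda>x. \<Sum>i\<in>X. q i * gen i x)" unfolding D_def by auto
    show "d \<in> C0 K" unfolding X(2) by (intro C0_sum gen_C0) (use X(1) I in blast)
  qed
  moreover have "\<exists>d\<in>D. sup_dist f d \<le> \<epsilon>"
    if f: "f \<in> C0 K" "\<And>B. B \<in> \<A> - Q \<Longrightarrow> f (Inr B) = 0" "\<epsilon> > 0" for f \<epsilon>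
  proof -
    have e: "\<epsilon> / 2 > 0" using f(3) by simp
    obtain X c where X: "finite X" "X \<subseteq> range Inl \<union> Inr ` {A \<in> \<A>. f (Inr A) \<noteq> 0}"
      "\<And>x. cmod (f x - (\<Sum>i\<in>X. c i * gen i x)) \<le> \<epsilon> / 2"
      by (rule C0_approx[OF f(1) e]) blast
    have XI: "X \<subseteq> ?I" using X(2) f(2) by blast
    \<comment> \<open>The coefficients cause an error of at most \<open>card X\<close> times
      \<open>\<delta>\<close>; the added 1 covers empty \<open>X\<close>.\<close>
    define \<delta> where "\<delta> = \<epsilon> / (2 * (real (card X) + 1))"
    have \<delta>: "\<delta> > 0" unfolding \<delta>_def using f(3) by simp
    have "\<exists>z. z \<in> Z \<and> cmod (c i - z) < \<delta>" for i
      using Z(2)[of "ball (c i) \<delta>"] \<delta> by (auto simp: dist_norm)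
    then obtain q where q: "\<And>i. q i \<in> Z" "\<And>i. cmod (c i - q i) < \<delta>" by metis
    define q' where "q' = restrict q X"
    let ?d = "\<lambda>x. \<Sum>i\<in>X. q' i * gen i x"
    have "q' \<in> PiE X (\<lambda>_. Z)" using q(1) unfolding q'_def by auto
    then have "?d \<in> D" unfolding D_def using X(1) XI by blast
    moreover have "sup_dist f ?d \<le> \<epsilon>"
    proof (rule sup_dist_le)
      fix x
      have "cmod ((\<Sum>i\<in>X. c i * gen i x) - ?d x) = cmod (\<Sum>i\<in>X. (c i - q i) * gen i x)"
        unfolding q'_def by (simp add: sum_subtractf left_diff_distrib)
      also have "\<dots> \<le> (\<Sum>i\<in>X. cmod ((c i - q i) * gen i x))" by (rule norm_sum)
      also have "\<dots> \<le> (\<Sum>i\<in>X. \<delta>)"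
      proof (rule sum_mono)
        fix i
        have "cmod ((c i - q i) * gen i x) \<le> cmod (c i - q i) * 1"
          unfolding norm_mult by (intro mult_left_mono gen_le) simp
        then show "cmod ((c i - q i) * gen i x) \<le> \<delta>" using q(2)[of i] by simp
      qed
      also have "\<dots> \<le> \<epsilon> / 2" using f(3) unfolding \<delta>_def by (simp add: field_simps)
      finally show "cmod (f x - ?d x) \<le> \<epsilon>"
        using X(3)[of x] norm_triangle_ineq[of "f x - (\<Sum>i\<in>X. c i * gen i x)" "(\<Sum>i\<in>X. c i * gen i x) - ?d x"]
        by simp
    qed
    ultimately show ?thesis by blast
  qed
  ultimately show thesis by (rule that)
qed

text \<open>The points of \<open>D\<close> may lie outside \<open>R\<close>, so a point of
  \<open>R\<close> is picked near each of them at each precision.\<close>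

lemma separable_subspaceI:
  assumes R: "R \<subseteq> C0 K" and D: "countable D" "D \<subseteq> C0 K"
    and dense: "\<And>f \<epsilon>. f \<in> R \<Longrightarrow> \<epsilon> > 0 \<Longrightarrow> \<exists>d\<in>D. sup_dist f d \<le> \<epsilon>"
  shows "separable_space (subtopology (Metric_space.mtopology (C0 K) sup_dist) R)"
proof -
  interpret Metric_space "C0 K" sup_dist by (rule Metric_space_C0)
  \<comment> \<open>If no point of \<open>R\<close> is that close to \<open>d\<close>, the value is
    arbitrary; the intersection in \<open>S\<close> keeps everything inside
    \<open>R\<close>.\<close>
  define pick where "pick d n = (SOME r. r \<in> R \<and> sup_dist r d \<le> inverse (real (Suc n)))" for d n
  define S where "S = R \<inter> case_prod pick ` (D \<times> (UNIV :: nat set))"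
  have "countable S" unfolding S_def using D(1) by (intro countable_Int2 countable_image countable_SIGMA) auto
  moreover have "S \<subseteq> R" unfolding S_def by auto
  moreover have "R \<subseteq> mtopology closure_of S"
  proof
    fix f assume f: "f \<in> R"
    show "f \<in> mtopology closure_of S"
      unfolding metric_closure_of
    proof (intro CollectI conjI allI impI)
      show "f \<in> C0 K" using f R by auto
      fix r :: real assume "0 < r"
      then obtain n where n: "inverse (real (Suc n)) < r / 2" using reals_Archimedean[of "r / 2"] by auto
      obtain d where d: "d \<in> D" "sup_dist f d \<le> inverse (real (Suc n))"
        using dense[OF f, of "inverse (real (Suc n))"] by auto
      have p: "pick d n \<in> R \<and> sup_dist (pick d n) d \<le> inverse (real (Suc n))"
        unfolding pick_def by (rule someI[of _ f]) (use f d in auto)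
      then have "pick d n \<in> S" unfolding S_def using d(1) by auto
      moreover have "sup_dist f (pick d n) < r"
      proof -
        have "sup_dist f (pick d n) \<le> sup_dist f d + sup_dist d (pick d n)"
          using f R p d D by (intro triangle) auto
        also have "sup_dist d (pick d n) = sup_dist (pick d n) d" by (rule commute)
        finally show ?thesis using n p d(2) by linarith
      qed
      ultimately show "\<exists>y\<in>S. y \<in> mball f r" using f R p by (intro bexI[of _ "pick d n"]) auto
    qed
  qed
  ultimately show ?thesis
    unfolding separable_space_def closure_of_subtopology
    using R by (intro exI[of _ S]) (auto simp: Int_absorb1)
qed

lemma separable_no_separated:
  assumes R: "R \<subseteq> C0 K" and sep: "separable_space (subtopology (Metric_space.mtopology (C0 K) sup_dist) R)"
    and h: "\<And>i. i \<in> I \<Longrightarrow> h i \<in> R" and "\<delta> > 0"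
    and far: "\<And>i j. i \<in> I \<Longrightarrow> j \<in> I \<Longrightarrow> i \<noteq> j \<Longrightarrow> \<delta> \<le> sup_dist (h i) (h j)"
  shows "countable I"
proof -
  interpret Metric_space "C0 K" sup_dist by (rule Metric_space_C0)
  obtain S where S: "countable S" "S \<subseteq> R" "R \<subseteq> mtopology closure_of S"
    using sep R unfolding separable_space_def closure_of_subtopology
    by (auto simp: Int_absorb1 subset_iff Int_absorb2)
  have "\<exists>y\<in>S. y \<in> mball (h i) (\<delta> / 2)" if "i \<in> I" for i
  proof -
    have "h i \<in> mtopology closure_of S" using S(3) h[OF that] by blast
    then show ?thesis using half_gt_zero[OF \<open>\<delta> > 0\<close>] unfolding metric_closure_of by blast
  qed
  then obtain s where s: "\<And>i. i \<in> I \<Longrightarrow> s i \<in> S \<and> s i \<in> mball (h i) (\<delta> / 2)" by metis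
  have "inj_on s I"
  proof (rule inj_onI, rule ccontr)
    fix i j assume ij: "i \<in> I" "j \<in> I" "s i = s j" "i \<noteq> j"
    have "sup_dist (h i) (h j) \<le> sup_dist (h i) (s i) + sup_dist (s i) (h j)"
      using s ij h R S by (intro triangle) auto
    moreover have "sup_dist (h i) (s i) < \<delta> / 2" "sup_dist (h j) (s i) < \<delta> / 2"
      using s[OF ij(1)] s[OF ij(2)] ij(3) by auto
    ultimately show False using far[OF ij(1,2,4)] commute[of "h j" "s i"] by linarith
  qed
  moreover have "s ` I \<subseteq> S" using s by auto
  ultimately show ?thesis using countable_image_inj_on[OF countable_subset[OF _ S(1)]] by simp
qed

end

section \<open>The matrix of an operator\<close>

locale bounded_operator = ad_family +
  fixes T :: "(nat + nat set \<Rightarrow> complex) \<Rightarrow> (nat + nat set \<Rightarrow> complex)"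
  assumes bounded_operator: "T \<in> bounded_operators K"
begin

lemma T_C0: "f \<in> C0 K \<Longrightarrow> T f \<in> C0 K"
  using bounded_operator unfolding bounded_operators_def by blast

lemma T_add: "f \<in> C0 K \<Longrightarrow> g \<in> C0 K \<Longrightarrow> T (\<lambda>x. f x + g x) = (\<lambda>x. T f x + T g x)"
  using bounded_operator unfolding bounded_operators_def by blast

lemma T_cmult: "f \<in> C0 K \<Longrightarrow> T (\<lambda>x. c * f x) = (\<lambda>x. c * T f x)"
  using bounded_operator unfolding bounded_operators_def by blast

lemma T_diff: "f \<in> C0 K \<Longrightarrow> g \<in> C0 K \<Longrightarrow> T (\<lambda>x. f x - g x) = (\<lambda>x. T f x - T g x)"
  using T_add[of f "\<lambda>x. (-1) * g x"] T_cmult[of g "-1"] C0_cmult[of g "-1"] by simp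

lemma T_sum:
  assumes "\<And>i. i \<in> I \<Longrightarrow> h i \<in> C0 K"
  shows "T (\<lambda>x. \<Sum>i\<in>I. c i * h i x) = (\<lambda>x. \<Sum>i\<in>I. c i * T (h i) x)"
  using assms
proof (induction I rule: infinite_finite_induct)
  case (insert j I)
  have "T (\<lambda>x. c j * h j x + (\<Sum>i\<in>I. c i * h i x)) = (\<lambda>x. T (\<lambda>x. c j * h j x) x + T (\<lambda>x. \<Sum>i\<in>I. c i * h i x) x)"
    by (rule T_add) (use insert.prems in \<open>auto intro: C0_cmult C0_sum\<close>)
  then show ?case using insert by (simp add: T_cmult)
qed (use T_cmult[OF C0_zero, of 0] in simp_all)

definition op_bound :: real where
  "op_bound = (SOME b. 0 \<le> b \<and> (\<forall>f\<in>C0 K. sup_norm (T f) \<le> b * sup_norm f))"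

lemma sup_norm_nonneg: "f \<in> C0 K \<Longrightarrow> 0 \<le> sup_norm f"
  using cmod_le_sup_norm[OF bounded_C0] norm_ge_zero order_trans by metis

lemma op_bound: "0 \<le> op_bound \<and> (\<forall>f\<in>C0 K. sup_norm (T f) \<le> op_bound * sup_norm f)"
  unfolding op_bound_def
proof (rule someI_ex)
  obtain b where b: "\<forall>f\<in>C0 K. sup_norm (T f) \<le> b * sup_norm f"
    using bounded_operator unfolding bounded_operators_def by auto
  have "sup_norm (T f) \<le> \<bar>b\<bar> * sup_norm f" if "f \<in> C0 K" for f
  proof -
    have "b * sup_norm f \<le> \<bar>b\<bar> * sup_norm f"
      using sup_norm_nonneg[OF that] by (intro mult_right_mono) auto
    then show ?thesis using b that by force
  qed
  then show "\<exists>b. 0 \<le> b \<and> (\<forall>f\<in>C0 K. sup_norm (T f) \<le> b * sup_norm f)"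
    by (intro exI[of _ "\<bar>b\<bar>"]) auto
qed

lemma T_bound:
  assumes "f \<in> C0 K" "\<And>x. cmod (f x) \<le> c"
  shows "cmod (T f x) \<le> op_bound * c"
proof -
  have "cmod (T f x) \<le> sup_norm (T f)" by (rule cmod_le_sup_norm[OF bounded_C0[OF T_C0[OF assms(1)]]])
  also have "\<dots> \<le> op_bound * sup_norm f" using op_bound assms(1) by simp
  also have "\<dots> \<le> op_bound * c" using sup_norm_least[of f c] assms(2) op_bound by (intro mult_left_mono) auto
  finally show ?thesis .
qed

text \<open>\<open>C0_approx\<close> uses only generators at the limits of \<open>f\<close>, and
  evaluating \<open>T\<close> at \<open>x\<close> is a bounded functional, so it suffices that it
  vanishes on those.\<close>

lemma T_vanish:
  assumes gen0: "\<And>i. i \<in> range Inl \<union> Inr ` V \<Longrightarrow> T (gen i) x = 0" and "V \<subseteq> \<A>"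
    and f: "f \<in> C0 K" "\<And>B. B \<in> \<A> - V \<Longrightarrow> f (Inr B) = 0"
  shows "T f x = 0"
proof -
  have "cmod (T f x) \<le> op_bound * \<epsilon>" if "\<epsilon> > 0" for \<epsilon>
  proof -
    obtain X c where X: "finite X" "X \<subseteq> range Inl \<union> Inr ` {A \<in> \<A>. f (Inr A) \<noteq> 0}"
      "\<And>x. cmod (f x - (\<Sum>i\<in>X. c i * gen i x)) \<le> \<epsilon>"
      by (rule C0_approx[OF f(1) \<open>\<epsilon> > 0\<close>]) blast
    have XV: "X \<subseteq> range Inl \<union> Inr ` V" using X(2) f(2) by blast
    have gX: "gen i \<in> C0 K" if "i \<in> X" for i
    proof (rule gen_C0)
      show "i \<in> topspace K" using that XV assms(2) unfolding topspace_K_space K_points_def by blast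
    qed
    have "T (\<lambda>x. f x - (\<Sum>i\<in>X. c i * gen i x)) x = T f x - (\<Sum>i\<in>X. c i * T (gen i) x)"
      by (subst T_diff[OF f(1) C0_sum[OF gX]], assumption, subst T_sum[OF gX], assumption) simp
    also have "(\<Sum>i\<in>X. c i * T (gen i) x) = 0"
      using gen0 XV by (intro sum.neutral ballI) auto
    finally have "T f x = T (\<lambda>x. f x - (\<Sum>i\<in>X. c i * gen i x)) x" by simp
    moreover have "cmod (T (\<lambda>x. f x - (\<Sum>i\<in>X. c i * gen i x)) x) \<le> op_bound * \<epsilon>"
      by (intro T_bound C0_diff C0_sum f gX X(3))
    ultimately show ?thesis by simp
  qed
  from this[of "\<delta> / (op_bound + 1)" for \<delta>] have "cmod (T f x) \<le> \<delta>" if "\<delta> > 0" for \<delta>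
  proof -
    have "cmod (T f x) \<le> op_bound * (\<delta> / (op_bound + 1))"
      using op_bound that by (intro \<open>\<And>\<epsilon>. \<epsilon> > 0 \<Longrightarrow> cmod (T f x) \<le> op_bound * \<epsilon>\<close>) auto
    also have "\<dots> \<le> \<delta>" using op_bound that by (simp add: field_simps)
    finally show ?thesis .
  qed
  then have "cmod (T f x) \<le> 0" by (rule field_le_epsilon) simp
  then show ?thesis by simp
qed

text \<open>Rows exist for limit points as well: the rows at the y_A are later subtracted to make
  the columns null.\<close>

definition matrix_entry :: "nat + nat set \<Rightarrow> nat \<Rightarrow> complex" where
  "matrix_entry x k = T (gen (Inl k)) x"

lemma cnj_sgn_mult: "cnj (sgn z) * z = of_real (cmod z)"
proof (cases "z = 0")
  case False
  have "cnj (sgn z) * z = (z * cnj z) / of_real (cmod z)" by (simp add: sgn_eq)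
  also have "\<dots> = of_real (cmod z)"
    using False by (simp add: complex_norm_square[symmetric] power2_eq_square)
  finally show ?thesis .
qed simp

lemma cmod_cnj_sgn_le: "cmod (cnj (sgn z)) \<le> 1"
  by (simp add: norm_sgn)

text \<open>Coefficients of modulus at most 1 align the values at \<open>x\<close>, so the sum of
  moduli becomes the value of \<open>T\<close> at a single function of norm at most 1.\<close>

lemma T_test:
  assumes I: "finite I" and h: "\<And>i. i \<in> I \<Longrightarrow> h i \<in> C0 K"
    and disj: "\<And>y. (\<Sum>i\<in>I. cmod (h i y)) \<le> 1"
  shows "(\<Sum>i\<in>I. cmod (T (h i) x)) \<le> op_bound"
proof -
  let ?u = "\<lambda>i. cnj (sgn (T (h i) x))"
  let ?f = "\<lambda>y. \<Sum>i\<in>I. ?u i * h i y"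
  have f1: "cmod (?f y) \<le> 1" for y
  proof -
    have "cmod (?f y) \<le> (\<Sum>i\<in>I. cmod (?u i * h i y))" by (rule norm_sum)
    also have "\<dots> \<le> (\<Sum>i\<in>I. cmod (h i y))"
      unfolding norm_mult by (intro sum_mono mult_left_le_one_le cmod_cnj_sgn_le) auto
    also have "\<dots> \<le> 1" by (rule disj)
    finally show ?thesis .
  qed
  have "cmod (T ?f x) \<le> op_bound * 1" by (intro T_bound C0_sum h f1)
  moreover have "T ?f x = of_real (\<Sum>i\<in>I. cmod (T (h i) x))"
    by (subst T_sum[OF h], assumption) (simp add: cnj_sgn_mult)
  moreover have "0 \<le> (\<Sum>i\<in>I. cmod (T (h i) x))" by (intro sum_nonneg) simp
  ultimately show ?thesis by (simp only: norm_of_real abs_of_nonneg mult_1_right)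
qed

lemma matrix_entry_rows:
  assumes "finite F" shows "(\<Sum>k\<in>F. cmod (matrix_entry x k)) \<le> op_bound"
  unfolding matrix_entry_def
proof (rule T_test[OF assms])
  fix y :: "nat + nat set"
  show "(\<Sum>k\<in>F. cmod (gen (Inl k) y)) \<le> 1"
  proof (cases y)
    case (Inl n)
    have "(\<Sum>k\<in>F. cmod (gen (Inl k) y)) = (\<Sum>k\<in>F. if n = k then 1 else 0)"
      unfolding Inl by (intro sum.cong) auto
    then show ?thesis using assms by simp
  next
    case (Inr A)
    then show ?thesis by simp
  qed
qed (rule gen_Inl)

text \<open>The single row of the point \<open>x\<close>, repeated, so that the lemmas on row sums
  cover limit points too.\<close>

sublocale mat_row: row_bounded "\<lambda>_. matrix_entry x" op_bound for x
  by unfold_locales (rule matrix_entry_rows)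

text \<open>
  The differences of the two sides form an \<open>\<ell>\<^sub>1\<close> family over \<open>\<A>\<close>: they are the values of a
  functional that vanishes on \<open>c\<^sub>0\<close>.
\<close>

lemma countable_exceptional:
  "countable {A \<in> \<A>. T (gen (Inr A)) x \<noteq> (\<Sum>\<^sub>\<infinity>k\<in>A. matrix_entry x k)}"
proof -
  define S where "S A = T (gen (Inr A)) x - (\<Sum>\<^sub>\<infinity>k\<in>A. matrix_entry x k)" for A
  have "countable {A \<in> \<A>. S A \<noteq> 0}"
  proof (rule countable_nonzero_of_sum_le)
    fix X assume X: "finite X" "X \<subseteq> \<A>"
    have ov: "finite (A \<inter> B)" if "A \<in> X" "B \<in> X" "A \<noteq> B" for A B
      using that X(2) by (intro finite_Int) auto
    obtain O' where O: "finite O'" "disjoint_family_on (\<lambda>A. A - O') X"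
      by (rule finite_pairwise_overlap[OF X(1) ov])
    \<comment> \<open>This is the indicator of \<open>A - O'\<close> together with y_A; for distinct
      \<open>A\<close> the supports are disjoint, as \<open>T_test\<close> demands.\<close>
    define h where "h A y = gen (Inr A) y - (\<Sum>k\<in>A \<inter> O'. 1 * gen (Inl k) y)" for A y
    have hC: "h A \<in> C0 K" if "A \<in> X" for A
      unfolding h_def using that X(2) by (intro C0_diff C0_sum gen_Inl gen_Inr) auto
    have Th: "T (h A) x = T (gen (Inr A)) x - (\<Sum>k\<in>A \<inter> O'. matrix_entry x k)" if "A \<in> X" for A
    proof -
      have "T (h A) = (\<lambda>x. T (gen (Inr A)) x - T (\<lambda>y. \<Sum>k\<in>A \<inter> O'. 1 * gen (Inl k) y) x)"
        unfolding h_def using that X(2) by (intro T_diff C0_sum gen_Inl gen_Inr) auto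
      also have "T (\<lambda>y. \<Sum>k\<in>A \<inter> O'. 1 * gen (Inl k) y) = (\<lambda>x. \<Sum>k\<in>A \<inter> O'. 1 * T (gen (Inl k)) x)"
        by (intro T_sum gen_Inl)
      finally show ?thesis unfolding matrix_entry_def by simp
    qed
    have hInl: "h A (Inl n) = of_bool (n \<in> A - O')" for A n
    proof -
      have "(\<Sum>k\<in>A \<inter> O'. 1 * gen (Inl k) (Inl n)) = (\<Sum>k\<in>A \<inter> O'. if n = k then 1 else 0)"
        by (intro sum.cong) auto
      then show ?thesis unfolding h_def using O(1) by simp
    qed
    have hInr: "h A (Inr B) = of_bool (B = A)" for A B
      unfolding h_def by simp
    have "(\<Sum>A\<in>X. cmod (T (h A) x)) \<le> op_bound"
    proof (rule T_test[OF X(1) hC])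
      fix y :: "nat + nat set"
      show "(\<Sum>A\<in>X. cmod (h A y)) \<le> 1"
      proof (cases y)
        case (Inl n)
        show ?thesis
        proof (cases "\<exists>A\<in>X. n \<in> A - O'")
          case True
          then obtain A where A: "A \<in> X" "n \<in> A - O'" by blast
          have "(\<Sum>B\<in>X. cmod (h B y)) = (\<Sum>B\<in>X. if B = A then 1 else 0)"
            unfolding Inl hInl using A O(2) by (intro sum.cong) (auto simp: disjoint_family_on_def)
          then show ?thesis using X(1) by simp
        next
          case False
          then have "(\<Sum>B\<in>X. cmod (h B y)) = 0"
            unfolding Inl hInl by (intro sum.neutral) auto
          then show ?thesis by simp
        qed
      next
        case (Inr B)
        have "(\<Sum>A\<in>X. cmod (h A y)) = (\<Sum>A\<in>X. if B = A then 1 else 0)"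
          unfolding Inr hInr by (intro sum.cong) auto
        then show ?thesis using X(1) by simp
      qed
    qed
    moreover have "(\<Sum>A\<in>X. cmod (row_sum (\<lambda>_. matrix_entry x) (A - O') 0)) \<le> op_bound"
      by (rule mat_row.sum_disjoint_row_sums_le[OF X(1) O(2)])
    moreover have "(\<Sum>A\<in>X. cmod (S A)) \<le> (\<Sum>A\<in>X. cmod (T (h A) x) + cmod (row_sum (\<lambda>_. matrix_entry x) (A - O') 0))"
    proof (rule sum_mono)
      fix A assume "A \<in> X"
      have "S A = T (h A) x - row_sum (\<lambda>_. matrix_entry x) (A - O') 0"
        using Th[OF \<open>A \<in> X\<close>] mat_row.row_sum_split[OF O(1), of x A 0]
        unfolding S_def row_sum_def by (simp add: algebra_simps)
      then show "cmod (S A) \<le> cmod (T (h A) x) + cmod (row_sum (\<lambda>_. matrix_entry x) (A - O') 0)"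
        using norm_triangle_ineq4 by metis
    qed
    ultimately show "(\<Sum>A\<in>X. cmod (S A)) \<le> op_bound + op_bound" unfolding sum.distrib by linarith
  qed
  then show ?thesis unfolding S_def by simp
qed

end

section \<open>Removing the limits of the columns\<close>

lemma (in ad_family) disjoint_tails:
  assumes "countable Q" "Q \<subseteq> \<A>"
  obtains tl where "\<And>q. tl q \<subseteq> q" "\<And>q. q \<in> Q \<Longrightarrow> finite (q - tl q)"
    "\<And>q r. q \<in> Q \<Longrightarrow> r \<in> Q \<Longrightarrow> q \<noteq> r \<Longrightarrow> tl q \<inter> tl r = {}"
proof -
  obtain \<nu> :: "nat set \<Rightarrow> nat" where \<nu>: "inj_on \<nu> Q" using assms(1) unfolding countable_def by auto
  \<comment> \<open>Only finitely many members precede \<open>q\<close> in the enumeration, and each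
    of them meets \<open>q\<close> in a finite set.\<close>
  define tl where "tl q = q - \<Union>{p \<in> Q. \<nu> p < \<nu> q}" for q
  show thesis
  proof (rule that[of tl])
    show "tl q \<subseteq> q" for q unfolding tl_def by auto
    show "finite (q - tl q)" if q: "q \<in> Q" for q
    proof -
      have "finite (\<nu> ` {p \<in> Q. \<nu> p < \<nu> q})" by (rule finite_subset[of _ "{..<\<nu> q}"]) auto
      moreover have "inj_on \<nu> {p \<in> Q. \<nu> p < \<nu> q}" using \<nu> by (rule inj_on_subset) auto
      ultimately have "finite {p \<in> Q. \<nu> p < \<nu> q}" by (rule finite_imageD)
      then have "finite (\<Union>p\<in>{p \<in> Q. \<nu> p < \<nu> q}. q \<inter> p)"
        by (rule finite_UN_I) (use assms(2) q finite_Int in auto)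
      moreover have "q - tl q \<subseteq> (\<Union>p\<in>{p \<in> Q. \<nu> p < \<nu> q}. q \<inter> p)" unfolding tl_def by auto
      ultimately show ?thesis by (rule finite_subset[rotated])
    qed
    show "tl q \<inter> tl r = {}" if "q \<in> Q" "r \<in> Q" "q \<noteq> r" for q r
    proof -
      have "\<nu> q \<noteq> \<nu> r" using \<nu> that by (auto dest: inj_onD)
      then consider "\<nu> q < \<nu> r" | "\<nu> r < \<nu> q" by linarith
      then show ?thesis
      proof cases
        case 1
        then have "tl r \<inter> q = {}" using that unfolding tl_def by auto
        then show ?thesis unfolding tl_def by auto
      next
        case 2
        then have "tl q \<inter> r = {}" using that unfolding tl_def by auto
        then show ?thesis unfolding tl_def by auto
      qed
    qed
  qed
qed

locale tails = ad_family +
  fixes Q :: "nat set set" and tl :: "nat set \<Rightarrow> nat set"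
  assumes Q_sub: "Q \<subseteq> \<A>" and tl_sub: "tl q \<subseteq> q" and tl_cofinite: "q \<in> Q \<Longrightarrow> finite (q - tl q)"
    and tl_disjoint: "q \<in> Q \<Longrightarrow> r \<in> Q \<Longrightarrow> q \<noteq> r \<Longrightarrow> tl q \<inter> tl r = {}"
begin

definition owner :: "nat \<Rightarrow> nat set" where
  "owner n = (SOME q. q \<in> Q \<and> n \<in> tl q)"

definition owned :: "nat \<Rightarrow> bool" where
  "owned n \<longleftrightarrow> (\<exists>q\<in>Q. n \<in> tl q)"

lemma owner: "owned n \<Longrightarrow> owner n \<in> Q \<and> n \<in> tl (owner n)"
  unfolding owned_def owner_def by (rule someI_ex) auto

lemma owner_eq: "q \<in> Q \<Longrightarrow> n \<in> tl q \<Longrightarrow> owned n \<and> owner n = q"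
  using owner[of n] tl_disjoint[of q "owner n"] unfolding owned_def by auto

text \<open>
  Subtracting \<open>Q_part\<close> removes the limits along the members of \<open>Q\<close>. Applied to the columns of
  a matrix it makes them tend to zero, at the cost of an operator with separable range.
\<close>

definition Q_part :: "(nat + nat set \<Rightarrow> complex) \<Rightarrow> (nat + nat set \<Rightarrow> complex)" where
  "Q_part f x = (case x of Inl n \<Rightarrow> if owned n then f (Inr (owner n)) else 0
     | Inr A \<Rightarrow> if A \<in> Q then f (Inr A) else 0)"

lemma Q_part_large:
  "{n. \<epsilon> \<le> cmod (Q_part f (Inl n))} \<subseteq> \<Union>{q \<in> Q. \<epsilon> \<le> cmod (f (Inr q))}" if "\<epsilon> > 0"
proof
  fix n assume n: "n \<in> {n. \<epsilon> \<le> cmod (Q_part f (Inl n))}"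
  then have o: "owned n" using that unfolding Q_part_def by (auto split: if_splits)
  then have "\<epsilon> \<le> cmod (f (Inr (owner n)))" using n unfolding Q_part_def by simp
  moreover have "n \<in> owner n" "owner n \<in> Q" using owner[OF o] tl_sub by auto
  ultimately show "n \<in> \<Union>{q \<in> Q. \<epsilon> \<le> cmod (f (Inr q))}" by auto
qed

text \<open>At level \<open>\<epsilon>\<close> only the finitely many \<open>q\<close> with a large
  limit matter, and disjointness of the tails keeps their contributions apart.\<close>

lemma Q_part_C0:
  assumes f: "f \<in> C0 K" shows "Q_part f \<in> C0 K"
proof -
  have fin: "finite {q \<in> Q. \<epsilon> \<le> cmod (f (Inr q))}" if "\<epsilon> > 0" for \<epsilon>
    by (rule finite_subset[OF _ C0_finite_large[OF f that]]) (use Q_sub in auto)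
  have "((\<lambda>n. Q_part f (Inl n)) \<longlongrightarrow> Q_part f (Inr A)) (along A)" if A: "A \<in> \<A>" for A
  proof (cases "A \<in> Q")
    case True
    have "{n \<in> A. \<not> Q_part f (Inl n) = Q_part f (Inr A)} \<subseteq> A - tl A"
    proof
      fix n assume n: "n \<in> {n \<in> A. \<not> Q_part f (Inl n) = Q_part f (Inr A)}"
      have "n \<notin> tl A" using n owner_eq[OF True, of n] True unfolding Q_part_def by auto
      then show "n \<in> A - tl A" using n by auto
    qed
    from finite_subset[OF this tl_cofinite[OF True]] show ?thesis
      by (intro tendsto_eventually) (simp add: eventually_along)
  next
    case False
    have "\<forall>\<^sub>F n in along A. dist (Q_part f (Inl n)) 0 < \<epsilon>" if "\<epsilon> > 0" for \<epsilon>
    proof -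
      have "{n \<in> A. \<not> dist (Q_part f (Inl n)) 0 < \<epsilon>} \<subseteq> (\<Union>q\<in>{q \<in> Q. \<epsilon> \<le> cmod (f (Inr q))}. A \<inter> q)"
        using Q_part_large[OF that, of f] by (auto simp: not_less)
      moreover have "finite (\<Union>q\<in>{q \<in> Q. \<epsilon> \<le> cmod (f (Inr q))}. A \<inter> q)"
        by (intro finite_UN_I fin that finite_Int A) (use Q_sub False in auto)
      ultimately show ?thesis unfolding eventually_along by (rule finite_subset)
    qed
    moreover have "Q_part f (Inr A) = 0" using False unfolding Q_part_def by simp
    ultimately show ?thesis by (simp add: tendsto_iff)
  qed
  moreover have "controlled (\<lambda>n. Q_part f (Inl n))"
    unfolding controlled_def
  proof (intro allI impI)
    fix \<epsilon> :: real assume "\<epsilon> > 0"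
    then have "{n. \<epsilon> \<le> cmod (Q_part f (Inl n))} - \<Union>{q \<in> Q. \<epsilon> \<le> cmod (f (Inr q))} = {}"
      using Q_part_large[of \<epsilon> f] by auto
    then have "finite ({n. \<epsilon> \<le> cmod (Q_part f (Inl n))} - \<Union>{q \<in> Q. \<epsilon> \<le> cmod (f (Inr q))})" by (metis finite.emptyI)
    then show "\<exists>\<W>\<subseteq>\<A>. finite \<W> \<and> finite ({n. \<epsilon> \<le> cmod (Q_part f (Inl n))} - \<Union>\<W>)"
      using fin[OF \<open>\<epsilon> > 0\<close>] Q_sub by (intro exI[of _ "{q \<in> Q. \<epsilon> \<le> cmod (f (Inr q))}"]) auto
  qed
  moreover have "Q_part f (Inr A) = 0" if "A \<notin> \<A>" for A
    using that Q_sub unfolding Q_part_def by auto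
  ultimately show ?thesis unfolding C0_iff by blast
qed

end

context bounded_operator
begin

text \<open>\<open>M\<close> is the matrix of \<open>T\<close> corrected by \<open>Q_part\<close>.
  The correction does not touch the values at y_B for \<open>B\<close> outside \<open>Q\<close>, and
  from these values the symbol will be read.\<close>

lemma c0_matrix_representation:
  obtains M b Q where "c0_matrix M b" "countable Q" "Q \<subseteq> \<A>"
    "\<And>A. A \<in> \<A> - Q \<Longrightarrow> \<exists>h\<in>C0 K. (\<forall>n. h (Inl n) = row_sum M A n) \<and>
       (\<forall>B\<in>\<A> - Q. h (Inr B) = T (gen (Inr A)) (Inr B))"
proof -
  \<comment> \<open>Members at which some column has a nonzero limit: countably many for each
    column.\<close>
  define Q0 where "Q0 = (\<Union>k. {q \<in> \<A>. T (gen (Inl k)) (Inr q) \<noteq> 0})"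
  have Q0: "countable Q0" "Q0 \<subseteq> \<A>"
    unfolding Q0_def by (intro countable_UN C0_countable_support T_C0 gen_Inl) auto
  obtain tl where tl: "\<And>q. tl q \<subseteq> q" "\<And>q. q \<in> Q0 \<Longrightarrow> finite (q - tl q)"
    "\<And>q r. q \<in> Q0 \<Longrightarrow> r \<in> Q0 \<Longrightarrow> q \<noteq> r \<Longrightarrow> tl q \<inter> tl r = {}"
    by (rule disjoint_tails[OF Q0]) blast
  interpret tails \<A> Q0 tl by unfold_locales (fact Q0 tl)+
  define M where "M n k = matrix_entry (Inl n) k - (if owned n then matrix_entry (Inr (owner n)) k else 0)" for n k
  have M_eq: "M n k = T (gen (Inl k)) (Inl n) - Q_part (T (gen (Inl k))) (Inl n)" for n k
    unfolding M_def matrix_entry_def Q_part_def by simp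
  have c0: "c0_matrix M (op_bound + op_bound)"
  proof
    fix F :: "nat set" and n assume F: "finite F"
    have "(\<Sum>k\<in>F. cmod (M n k)) \<le> (\<Sum>k\<in>F. cmod (matrix_entry (Inl n) k) + cmod (matrix_entry (Inr (owner n)) k))"
    proof (rule sum_mono)
      fix k
      show "cmod (M n k) \<le> cmod (matrix_entry (Inl n) k) + cmod (matrix_entry (Inr (owner n)) k)"
        unfolding M_def using norm_triangle_ineq4[of "matrix_entry (Inl n) k" "matrix_entry (Inr (owner n)) k"] by simp
    qed
    also have "\<dots> \<le> op_bound + op_bound" unfolding sum.distrib by (intro add_mono matrix_entry_rows F)
    finally show "(\<Sum>k\<in>F. cmod (M n k)) \<le> op_bound + op_bound" .
  next
    fix k
    define h where "h x = T (gen (Inl k)) x - Q_part (T (gen (Inl k))) x" for x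
    have h: "h \<in> C0 K" unfolding h_def by (intro C0_diff Q_part_C0 T_C0 gen_Inl)
    have h0: "h (Inr A) = 0" if "A \<in> \<A>" for A
      unfolding h_def Q_part_def using that unfolding Q0_def by auto
    have "\<forall>\<^sub>F n in sequentially. dist (M n k) 0 < \<epsilon>" if "\<epsilon> > 0" for \<epsilon>
    proof -
      have "finite {n. \<epsilon> \<le> cmod (h (Inl n))}"
        by (rule C0_finite_of_small_limits[OF h that]) (simp add: h0 that)
      then show ?thesis unfolding eventually_sequentially_finite M_eq h_def by (simp add: not_less)
    qed
    then show "(\<lambda>n. M n k) \<longlonglongrightarrow> 0" by (simp add: tendsto_iff)
  qed
  \<comment> \<open>The rows entering \<open>M\<close> are those at isolated points and at y_q for
    \<open>q \<in> Q0\<close>, countably many; members exceptional for any of them are set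
    aside.\<close>
  define Q1 where "Q1 = (\<Union>x\<in>range Inl \<union> Inr ` Q0. {A \<in> \<A>. T (gen (Inr A)) x \<noteq> (\<Sum>\<^sub>\<infinity>k\<in>A. matrix_entry x k)})"
  have Q1: "countable Q1" "Q1 \<subseteq> \<A>"
    unfolding Q1_def by (intro countable_UN countable_exceptional) (use Q0 in auto)
  show thesis
  proof (rule that[OF c0, of "Q0 \<union> Q1"])
    show "countable (Q0 \<union> Q1)" "Q0 \<union> Q1 \<subseteq> \<A>" using Q0 Q1 by auto
    fix A assume A: "A \<in> \<A> - (Q0 \<union> Q1)"
    define h where "h x = T (gen (Inr A)) x - Q_part (T (gen (Inr A))) x" for x
    have reg: "T (gen (Inr A)) x = (\<Sum>\<^sub>\<infinity>k\<in>A. matrix_entry x k)" if "x \<in> range Inl \<union> Inr ` Q0" for x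
      using A that unfolding Q1_def by blast
    have "h \<in> C0 K" unfolding h_def using A by (intro C0_diff Q_part_C0 T_C0 gen_Inr) auto
    moreover have "h (Inl n) = row_sum M A n" for n
    proof (cases "owned n")
      case True
      have "h (Inl n) = (\<Sum>\<^sub>\<infinity>k\<in>A. matrix_entry (Inl n) k) - (\<Sum>\<^sub>\<infinity>k\<in>A. matrix_entry (Inr (owner n)) k)"
        using True owner[OF True] reg[of "Inl n"] reg[of "Inr (owner n)"] unfolding h_def Q_part_def by simp
      also have "\<dots> = (\<Sum>\<^sub>\<infinity>k\<in>A. matrix_entry (Inl n) k - matrix_entry (Inr (owner n)) k)"
        using infsum_add[OF mat_row.summable[of "Inl n" A], of "\<lambda>k. - matrix_entry (Inr (owner n)) k"]
          mat_row.summable[of "Inr (owner n)" A]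
        by (simp add: infsum_uminus summable_on_uminus)
      also have "\<dots> = row_sum M A n" unfolding row_sum_def M_def using True by simp
      finally show ?thesis .
    next
      case False
      then show ?thesis using reg[of "Inl n"] unfolding h_def Q_part_def row_sum_def M_def by simp
    qed
    moreover have "h (Inr B) = T (gen (Inr A)) (Inr B)" if "B \<in> \<A> - (Q0 \<union> Q1)" for B
      using that unfolding h_def Q_part_def by simp
    ultimately show "\<exists>h\<in>C0 K. (\<forall>n. h (Inl n) = row_sum M A n) \<and>
        (\<forall>B\<in>\<A> - (Q0 \<union> Q1). h (Inr B) = T (gen (Inr A)) (Inr B))" by blast
  qed
qed

end

section \<open>The symbol of an operator\<close>

definition copy :: "nat \<Rightarrow> nat set \<Rightarrow> nat set" where
  "copy r p = (\<lambda>a. prod_encode (a, r)) ` p"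

text \<open>Indices of equal class carry copies of the same family, so operators can move between
  them; different classes carry different families, between which rigidity leaves only the scalar
  0.\<close>

definition copies :: "(nat \<Rightarrow> nat set set) \<Rightarrow> nat \<Rightarrow> (nat \<Rightarrow> nat) \<Rightarrow> nat set set" where
  "copies P m cl = {copy r p |r p. r < m \<and> p \<in> P (cl r)}"

lemma inj_copy: "inj (copy r)"
proof (rule injI)
  fix p q assume "copy r p = copy r q"
  moreover have "inj (\<lambda>a. prod_encode (a, r))" by (rule injI) simp
  ultimately show "p = q" unfolding copy_def by (simp add: inj_image_eq_iff)
qed

lemma countable_copy_vimage:
  assumes "countable Q" shows "countable {p. copy r p \<in> Q}"
proof -
  have "copy r ` {p. copy r p \<in> Q} \<subseteq> Q" by auto
  from countable_subset[OF this assms] show ?thesis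
    by (rule countable_image_inj_on) (rule inj_on_subset[OF inj_copy], simp)
qed

lemma prod_encode_mem_copy: "prod_encode (a, r) \<in> copy s p \<longleftrightarrow> r = s \<and> a \<in> p"
  unfolding copy_def by auto

lemma copy_eq_iff: "p \<noteq> {} \<Longrightarrow> copy r p = copy s q \<longleftrightarrow> r = s \<and> p = q"
proof
  assume p: "p \<noteq> {}" and eq: "copy r p = copy s q"
  obtain a where "a \<in> p" using p by blast
  then have "prod_encode (a, r) \<in> copy s q" using prod_encode_mem_copy[of a r r p] eq by simp
  then have "r = s" unfolding prod_encode_mem_copy by simp
  then show "r = s \<and> p = q" using eq inj_copy by (auto dest: injD)
qed simp

lemma copy_Int: "copy r p \<inter> copy s q = (if r = s then copy r (p \<inter> q) else {})"
  unfolding copy_def by auto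

lemma filterlim_prod_encode: "filterlim (\<lambda>a. prod_encode (a, r)) sequentially sequentially"
  by (rule filterlim_at_top_mono[OF filterlim_ident]) (auto intro: always_eventually le_prod_encode_1)

lemma filterlim_copy: "filterlim (\<lambda>a. prod_encode (a, r)) (along (copy r p)) (along p)"
  unfolding filterlim_inf filterlim_principal
proof
  show "filterlim (\<lambda>a. prod_encode (a, r)) sequentially (along p)"
    by (rule filterlim_mono[OF filterlim_prod_encode]) auto
  show "\<forall>\<^sub>F a in along p. prod_encode (a, r) \<in> copy r p"
    unfolding eventually_along prod_encode_mem_copy by simp
qed

locale rigid = rigid_family +
  fixes m :: nat and cl :: "nat \<Rightarrow> nat"
begin

abbreviation \<A> :: "nat set set" where "\<A> \<equiv> copies P m cl"

lemma copy_mem: "r < m \<Longrightarrow> p \<in> P (cl r) \<Longrightarrow> copy r p \<in> \<A>"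
  unfolding copies_def by auto

lemma mem_cases:
  assumes "A \<in> \<A>" obtains r p where "r < m" "p \<in> P (cl r)" "A = copy r p"
  using assms unfolding copies_def by auto

lemma P_nonempty: "p \<in> P i \<Longrightarrow> p \<noteq> {}"
  using P_inf by auto

lemma P_class: "p \<in> P i \<Longrightarrow> p \<in> P j \<Longrightarrow> i = j"
  using P_Int[of p i p j] P_inf[of p i] by auto

lemma ad_copies: "almost_disjoint_family \<A>"
  unfolding almost_disjoint_family_def
proof (intro conjI ballI impI)
  fix A assume "A \<in> \<A>"
  then obtain r p where "p \<in> P (cl r)" "A = copy r p" by (rule mem_cases)
  then show "infinite A" unfolding copy_def using P_inf
    by (simp add: finite_image_iff inj_on_def)
next
  fix A B assume A: "A \<in> \<A>" and B: "B \<in> \<A>" and AB: "A \<noteq> B"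
  obtain r p where r: "r < m" "p \<in> P (cl r)" "A = copy r p" using A by (rule mem_cases)
  obtain s q where s: "s < m" "q \<in> P (cl s)" "B = copy s q" using B by (rule mem_cases)
  show "finite (A \<inter> B)"
  proof (cases "r = s")
    case True
    then have "finite (p \<inter> q)" using P_Int[OF r(2) s(2)] AB r s by auto
    then show ?thesis unfolding r(3) s(3) copy_Int True by (simp add: copy_def)
  qed (simp add: r s copy_Int)
qed

sublocale ad_family \<A> by unfold_locales (rule ad_copies)

text \<open>Columns in copy \<open>r\<close> and rows in copy \<open>s\<close> form a block that
  inherits the row bound and the null columns, so rigidity applies from \<open>P (cl r)\<close> to
  \<open>P (cl s)\<close>.\<close>

lemma block_scalar:
  assumes M: "c0_matrix M b" and Q: "countable Q"
    and rep: "\<And>A. A \<in> \<A> - Q \<Longrightarrow> \<exists>h\<in>C0 K. \<forall>n. h (Inl n) = row_sum M A n"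
    and r: "r < m" and s: "s < m"
  shows "\<exists>l. (cl r \<noteq> cl s \<longrightarrow> l = 0) \<and>
    countable {p \<in> P (cl r). \<not> (\<lambda>a. row_sum M (copy r p) (prod_encode (a, s)) - l * of_bool (a \<in> p)) \<longlonglongrightarrow> 0}"
proof -
  define N where "N a k = M (prod_encode (a, s)) (prod_encode (k, r))" for a k
  interpret M: c0_matrix M b by (rule M)
  have inj: "inj_on (\<lambda>k. prod_encode (k, r)) F" for F by (rule inj_onI) simp
  have N: "c0_matrix N b"
  proof
    fix F :: "nat set" and a assume "finite F"
    have "(\<Sum>k\<in>F. cmod (N a k)) = (\<Sum>k\<in>(\<lambda>k. prod_encode (k, r)) ` F. cmod (M (prod_encode (a, s)) k))"
      unfolding N_def by (simp add: sum.reindex[OF inj])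
    also have "\<dots> \<le> b" using \<open>finite F\<close> by (intro M.rows) simp
    finally show "(\<Sum>k\<in>F. cmod (N a k)) \<le> b" .
  next
    fix k show "(\<lambda>a. N a k) \<longlonglongrightarrow> 0"
      unfolding N_def by (rule filterlim_compose[OF M.cols filterlim_prod_encode])
  qed
  have rs: "row_sum N p a = row_sum M (copy r p) (prod_encode (a, s))" for p a
    unfolding row_sum_def copy_def N_def by (subst infsum_reindex[OF inj]) (simp add: o_def)
  have "in_space (P (cl s)) (row_sum N p)" if p: "p \<in> P (cl r)" "copy r p \<notin> Q" for p
  proof -
    obtain h where h: "h \<in> C0 K" "\<And>n. h (Inl n) = row_sum M (copy r p) n"
      using rep[of "copy r p"] copy_mem[OF r p(1)] p(2) by auto
    show ?thesis
      unfolding in_space_def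
    proof (intro conjI ballI allI impI)
      fix q assume q: "q \<in> P (cl s)"
      have "((\<lambda>a. h (Inl (prod_encode (a, s)))) \<longlongrightarrow> h (Inr (copy s q))) (along q)"
        by (rule filterlim_compose[OF C0_limit[OF h(1) copy_mem[OF s q]] filterlim_copy])
      then show "convergent_along (row_sum N p) q"
        unfolding convergent_along_def rs h(2) by blast
    next
      fix \<epsilon> :: real assume "\<epsilon> > 0"
      then obtain \<W> where W: "\<W> \<subseteq> \<A>" "finite \<W>" "finite ({n. \<epsilon> \<le> cmod (h (Inl n))} - \<Union>\<W>)"
        using h(1) unfolding C0_iff by (auto intro: controlledE[of "\<lambda>n. h (Inl n)" \<epsilon>])
      \<comment> \<open>Only members in copy \<open>s\<close> contain codes from copy
        \<open>s\<close>; the others contribute nothing to the covering of this block.\<close>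
      define W0 where "W0 = {q \<in> P (cl s). copy s q \<in> \<W>}"
      have "finite (copy s ` W0)" by (rule finite_subset[OF _ W(2)]) (auto simp: W0_def)
      then have "finite W0" by (rule finite_imageD) (rule inj_on_subset[OF inj_copy], simp)
      moreover have "W0 \<subseteq> P (cl s)" unfolding W0_def by auto
      moreover have "finite ({a. \<epsilon> \<le> cmod (row_sum N p a)} - \<Union>W0)"
      proof (rule finite_imageD)
        have "(\<lambda>a. prod_encode (a, s)) ` ({a. \<epsilon> \<le> cmod (row_sum N p a)} - \<Union>W0) \<subseteq>
            {n. \<epsilon> \<le> cmod (h (Inl n))} - \<Union>\<W>"
        proof
          fix n assume "n \<in> (\<lambda>a. prod_encode (a, s)) ` ({a. \<epsilon> \<le> cmod (row_sum N p a)} - \<Union>W0)"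
          then obtain a where a: "n = prod_encode (a, s)" "\<epsilon> \<le> cmod (row_sum N p a)" "a \<notin> \<Union>W0" by auto
          have "n \<notin> w" if w: "w \<in> \<W>" for w
          proof
            assume nw: "n \<in> w"
            have "w \<in> \<A>" using w W(1) by auto
            then obtain r' q where "r' < m" and rq: "q \<in> P (cl r')" "w = copy r' q" by (rule mem_cases)
            then have "s = r'" "a \<in> q" using nw a(1) prod_encode_mem_copy by auto
            then have "q \<in> W0" using rq w unfolding W0_def by simp
            then show False using a(3) \<open>a \<in> q\<close> by auto
          qed
          then show "n \<in> {n. \<epsilon> \<le> cmod (h (Inl n))} - \<Union>\<W>" using a(1,2) h(2) rs by simp
        qed
        then show "finite ((\<lambda>a. prod_encode (a, s)) ` ({a. \<epsilon> \<le> cmod (row_sum N p a)} - \<Union>W0))"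
          using W(3) by (rule finite_subset)
      qed (rule inj_onI, simp)
      ultimately show "\<exists>\<W>0\<subseteq>P (cl s). finite \<W>0 \<and> finite ({a. \<epsilon> \<le> cmod (row_sum N p a)} - \<Union>\<W>0)"
        by blast
    qed
  qed
  then have "{p \<in> P (cl r). \<not> in_space (P (cl s)) (row_sum N p)} \<subseteq> {p. copy r p \<in> Q}" by auto
  moreover have "countable {p. copy r p \<in> Q}" by (rule countable_copy_vimage[OF Q])
  ultimately have "countable {p \<in> P (cl r). \<not> in_space (P (cl s)) (row_sum N p)}" by (rule countable_subset)
  from P_rigid[OF N this] show ?thesis unfolding rs .
qed

definition supported :: "(nat \<Rightarrow> nat \<Rightarrow> complex) \<Rightarrow> bool" where
  "supported c \<longleftrightarrow> (\<forall>s r. \<not> (s < m \<and> r < m \<and> cl r = cl s) \<longrightarrow> c s r = 0)"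

text \<open>As far as limits off \<open>Q\<close> can tell, 1_p in copy \<open>r\<close> goes to the
  sum over \<open>s\<close> of \<open>c s r\<close> times 1_p in copy \<open>s\<close>. The row
  index comes first so that composition becomes the matrix product.\<close>

definition rep_off :: "nat set set \<Rightarrow> ((nat + nat set \<Rightarrow> complex) \<Rightarrow> (nat + nat set \<Rightarrow> complex)) \<Rightarrow>
    (nat \<Rightarrow> nat \<Rightarrow> complex) \<Rightarrow> bool" where
  "rep_off Q T c \<longleftrightarrow> (\<forall>r s p q. r < m \<longrightarrow> s < m \<longrightarrow> p \<in> P (cl r) \<longrightarrow> q \<in> P (cl s) \<longrightarrow> copy r p \<notin> Q \<longrightarrow> copy s q \<notin> Q \<longrightarrow>
     T (gen (Inr (copy r p))) (Inr (copy s q)) = (if p = q then c s r else 0))"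

definition represents :: "((nat + nat set \<Rightarrow> complex) \<Rightarrow> (nat + nat set \<Rightarrow> complex)) \<Rightarrow> (nat \<Rightarrow> nat \<Rightarrow> complex) \<Rightarrow> bool" where
  "represents T c \<longleftrightarrow> supported c \<and> (\<exists>Q. countable Q \<and> rep_off Q T c)"

lemma rep_offD:
  assumes "rep_off Q T c" "r < m" "s < m" "p \<in> P (cl r)" "q \<in> P (cl s)" "copy r p \<notin> Q" "copy s q \<notin> Q"
  shows "T (gen (Inr (copy r p))) (Inr (copy s q)) = (if p = q then c s r else 0)"
  using assms unfolding rep_off_def by blast

lemma represents_exists:
  assumes "T \<in> bounded_operators K"
  shows "\<exists>c. represents T c"
proof -
  interpret bounded_operator \<A> T by unfold_locales (rule assms)
  obtain M b Q where M: "c0_matrix M b" and Q: "countable Q" "Q \<subseteq> \<A>"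
    and rep: "\<And>A. A \<in> \<A> - Q \<Longrightarrow> \<exists>h\<in>C0 K. (\<forall>n. h (Inl n) = row_sum M A n) \<and>
       (\<forall>B\<in>\<A> - Q. h (Inr B) = T (gen (Inr A)) (Inr B))"
    by (rule c0_matrix_representation) blast
  have rep': "\<exists>h\<in>C0 K. \<forall>n. h (Inl n) = row_sum M A n" if "A \<in> \<A> - Q" for A
    using rep[OF that] by blast
  define D where "D r s l = {p \<in> P (cl r). \<not> (\<lambda>a. row_sum M (copy r p) (prod_encode (a, s)) - l * of_bool (a \<in> p)) \<longlonglongrightarrow> 0}" for r s l
  define l where "l s r = (SOME l. (cl r \<noteq> cl s \<longrightarrow> l = 0) \<and> countable (D r s l))" for s r
  have l: "(cl r \<noteq> cl s \<longrightarrow> l s r = 0) \<and> countable (D r s (l s r))" if "r < m" "s < m" for r s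
    unfolding l_def by (rule someI_ex) (use block_scalar[OF M Q(1) rep' that] in \<open>simp add: D_def\<close>)
  \<comment> \<open>The choice in \<open>l\<close> is arbitrary for indices out of range; the
    cut-off makes the matrix \<open>supported\<close> and hence unique.\<close>
  define c where "c s r = (if s < m \<and> r < m \<and> cl r = cl s then l s r else 0)" for s r
  define Q' where "Q' = Q \<union> (\<Union>r<m. \<Union>s<m. copy r ` D r s (l s r))"
  have "countable Q'"
    unfolding Q'_def using Q(1) l by (intro countable_Un countable_UN countable_image) auto
  moreover have "rep_off Q' T c"
    unfolding rep_off_def
  proof (intro allI impI)
    fix r s p q
    assume r: "r < m" and s: "s < m" and p: "p \<in> P (cl r)" and q: "q \<in> P (cl s)"
      and pQ: "copy r p \<notin> Q'" and qQ: "copy s q \<notin> Q'"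
    have cA: "copy r p \<in> \<A> - Q" "copy s q \<in> \<A> - Q"
      using copy_mem r s p q pQ qQ unfolding Q'_def by auto
    obtain h where h: "h \<in> C0 K" "\<And>n. h (Inl n) = row_sum M (copy r p) n"
      "h (Inr (copy s q)) = T (gen (Inr (copy r p))) (Inr (copy s q))"
      using rep[OF cA(1)] cA(2) by blast
    \<comment> \<open>The limit of these row sums along \<open>q\<close> is computed twice, from the
      function \<open>h\<close> and from the scalar up to a null sequence.\<close>
    have 1: "((\<lambda>a. row_sum M (copy r p) (prod_encode (a, s))) \<longlongrightarrow> h (Inr (copy s q))) (along q)"
      using filterlim_compose[OF C0_limit[OF h(1) copy_mem[OF s q]] filterlim_copy] unfolding h(2) .
    have "p \<notin> D r s (l s r)" using pQ r s unfolding Q'_def by auto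
    then have "(\<lambda>a. row_sum M (copy r p) (prod_encode (a, s)) - l s r * of_bool (a \<in> p)) \<longlonglongrightarrow> 0"
      using p unfolding D_def by simp
    then have 2: "((\<lambda>a. row_sum M (copy r p) (prod_encode (a, s)) - l s r * of_bool (a \<in> p)) \<longlongrightarrow> 0) (along q)"
      by (rule tendsto_mono[rotated]) simp
    have 3: "((\<lambda>a. l s r * of_bool (a \<in> p)) \<longlongrightarrow> (if p = q then l s r else 0)) (along q)"
    proof (rule tendsto_eventually)
      have "{a \<in> q. \<not> l s r * of_bool (a \<in> p) = (if p = q then l s r else 0)} \<subseteq> (if p = q then {} else p \<inter> q)"
        by auto
      moreover have "finite (if p = q then {} else p \<inter> q)" using P_Int[OF p q] by auto
      ultimately show "\<forall>\<^sub>F a in along q. l s r * of_bool (a \<in> p) = (if p = q then l s r else 0)"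
        unfolding eventually_along by (rule finite_subset)
    qed
    have "((\<lambda>a. row_sum M (copy r p) (prod_encode (a, s))) \<longlongrightarrow> 0 + (if p = q then l s r else 0)) (along q)"
      using tendsto_add[OF 2 3] by simp
    then have "h (Inr (copy s q)) = 0 + (if p = q then l s r else 0)"
      by (rule tendsto_unique[OF along_nontrivial[OF P_inf[OF q]] 1])
    moreover have "p = q \<Longrightarrow> cl r = cl s" using P_class p q by auto
    ultimately show "T (gen (Inr (copy r p))) (Inr (copy s q)) = (if p = q then c s r else 0)"
      using r s unfolding c_def h(3) by auto
  qed
  moreover have "supported c" unfolding supported_def c_def by auto
  ultimately show ?thesis unfolding represents_def by blast
qed

text \<open>Uncountability of the families gives symbols their meaning: some \<open>p\<close>
  escapes a countable set in all copies at once.\<close>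

lemma obtain_P_avoiding:
  assumes "countable Q"
  obtains p where "p \<in> P i" "\<And>r. r < m \<Longrightarrow> copy r p \<notin> Q"
proof -
  have "countable (\<Union>r<m. {p. copy r p \<in> Q})"
    by (intro countable_UN countable_copy_vimage assms) auto
  then have "\<not> P i \<subseteq> (\<Union>r<m. {p. copy r p \<in> Q})" using P_unc countable_subset by auto
  then show thesis using that by auto
qed

lemma represents_unique:
  assumes "represents T c" "represents T d"
  shows "c = d"
proof -
  obtain Q where Q: "countable Q" "rep_off Q T c" using assms(1) unfolding represents_def by auto
  obtain Q' where Q': "countable Q'" "rep_off Q' T d" using assms(2) unfolding represents_def by auto
  have "c s r = d s r" for s r
  proof (cases "s < m \<and> r < m \<and> cl r = cl s")
    case True
    obtain p where p: "p \<in> P (cl r)" "\<And>r. r < m \<Longrightarrow> copy r p \<notin> Q \<union> Q'"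
      by (rule obtain_P_avoiding[of "Q \<union> Q'" "cl r"]) (use Q Q' in auto)
    have "T (gen (Inr (copy r p))) (Inr (copy s p)) = c s r"
      using Q(2) True p unfolding rep_off_def by auto
    moreover have "T (gen (Inr (copy r p))) (Inr (copy s p)) = d s r"
      using Q'(2) True p unfolding rep_off_def by auto
    ultimately show ?thesis by simp
  next
    case False
    then show ?thesis using assms unfolding represents_def supported_def by metis
  qed
  then show ?thesis by blast
qed

lemma represents_add:
  assumes "represents S c" "represents T d"
  shows "represents (\<lambda>f x. S f x + T f x) (\<lambda>s r. c s r + d s r)"
proof -
  obtain Q where Q: "countable Q" "rep_off Q S c" using assms(1) unfolding represents_def by auto
  obtain Q' where Q': "countable Q'" "rep_off Q' T d" using assms(2) unfolding represents_def by auto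
  have "rep_off (Q \<union> Q') (\<lambda>f x. S f x + T f x) (\<lambda>s r. c s r + d s r)"
    using Q(2) Q'(2) unfolding rep_off_def by auto
  moreover have "supported (\<lambda>s r. c s r + d s r)"
    using assms unfolding represents_def supported_def by auto
  ultimately show ?thesis using Q(1) Q'(1) unfolding represents_def by (intro conjI exI[of _ "Q \<union> Q'"]) auto
qed

lemma represents_cmult:
  assumes "represents T c"
  shows "represents (\<lambda>f x. a * T f x) (\<lambda>s r. a * c s r)"
proof -
  obtain Q where Q: "countable Q" "rep_off Q T c" using assms(1) unfolding represents_def by auto
  have "rep_off Q (\<lambda>f x. a * T f x) (\<lambda>s r. a * c s r)"
    using Q(2) unfolding rep_off_def by auto
  moreover have "supported (\<lambda>s r. a * c s r)"
    using assms unfolding represents_def supported_def by auto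
  ultimately show ?thesis using Q(1) unfolding represents_def by auto
qed

text \<open>\<open>T\<close> takes an indicator to a combination of indicators of copies of the same
  \<open>p\<close>, plus a remainder whose limits lie in a fixed countable set. \<open>S\<close>
  sends such remainders to functions with limits in another fixed countable set, so off it only the
  combination counts.\<close>

lemma represents_comp:
  assumes S: "S \<in> bounded_operators K" "represents S d" and T: "T \<in> bounded_operators K" "represents T c"
  shows "represents (S \<circ> T) (\<lambda>s r. \<Sum>t<m. d s t * c t r)"
proof -
  interpret S: bounded_operator \<A> S by unfold_locales (rule S(1))
  interpret T: bounded_operator \<A> T by unfold_locales (rule T(1))
  obtain Q where Q: "countable Q" "rep_off Q S d" using S(2) unfolding represents_def by auto
  obtain Q' where Q': "countable Q'" "rep_off Q' T c" using T(2) unfolding represents_def by auto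
  have sc: "supported c" "supported d" using S(2) T(2) unfolding represents_def by auto
  define V where "V = Q' \<inter> \<A>"
  have V: "countable V" "V \<subseteq> \<A>" using Q'(1) unfolding V_def by auto
  \<comment> \<open>Collects the limits of \<open>S\<close> on all generators available to
    remainders, and so does not depend on the indicator to which \<open>T\<close> is
    applied.\<close>
  define Q2 where "Q2 = (\<Union>i\<in>range Inl \<union> Inr ` V. {B \<in> \<A>. S (gen i) (Inr B) \<noteq> 0})"
  have "gen i \<in> C0 K" if "i \<in> range Inl \<union> Inr ` V" for i :: "nat + nat set"
    using that V(2) gen_Inl gen_Inr by auto
  then have Q2: "countable Q2"
    unfolding Q2_def using V(1) by (intro countable_UN C0_countable_support S.T_C0) auto
  have van: "S h (Inr B) = 0" if "h \<in> C0 K" "\<And>B. B \<in> \<A> - V \<Longrightarrow> h (Inr B) = 0" "B \<in> \<A>" "B \<notin> Q2" for h B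
  proof (rule S.T_vanish[OF _ V(2) that(1,2)])
    fix i :: "nat + nat set" assume "i \<in> range Inl \<union> Inr ` V"
    then show "S (gen i) (Inr B) = 0" using that(3,4) unfolding Q2_def by blast
  qed
  \<comment> \<open>Saturates \<open>Q\<close> under change of copy, because \<open>S\<close> meets
    all copies of \<open>p\<close> and not only the one in copy \<open>r\<close>.\<close>
  define Q3 where "Q3 = (\<Union>r<m. copy r ` {p. \<exists>t<m. copy t p \<in> Q})"
  have "countable {p. \<exists>t<m. copy t p \<in> Q}"
  proof -
    have "countable (\<Union>t<m. {p. copy t p \<in> Q})"
      by (intro countable_UN countable_copy_vimage Q(1)) auto
    moreover have "{p. \<exists>t<m. copy t p \<in> Q} = (\<Union>t<m. {p. copy t p \<in> Q})" by auto
    ultimately show ?thesis by simp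
  qed
  then have Q3: "countable Q3" unfolding Q3_def by (intro countable_UN) auto
  have "rep_off (Q' \<union> Q2 \<union> Q3) (S \<circ> T) (\<lambda>s r. \<Sum>t<m. d s t * c t r)"
    unfolding rep_off_def
  proof (intro allI impI)
    fix r s p q
    assume r: "r < m" and s: "s < m" and p: "p \<in> P (cl r)" and q: "q \<in> P (cl s)"
      and pQ: "copy r p \<notin> Q' \<union> Q2 \<union> Q3" and qQ: "copy s q \<notin> Q' \<union> Q2 \<union> Q3"
    have pQ3: "copy t p \<notin> Q" if "t < m" for t
      using pQ that r unfolding Q3_def by auto
    have qQ3: "copy s q \<notin> Q" using qQ s unfolding Q3_def by auto
    let ?I = "{t. t < m \<and> cl t = cl r}"
    let ?A = "copy r p"
    define g where "g x = (\<Sum>t\<in>?I. c t r * gen (Inr (copy t p)) x)" for x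
    have gen_p: "gen (Inr (copy t p)) \<in> C0 K" if "t \<in> ?I" for t
      using that p by (intro gen_Inr copy_mem) auto
    have gC: "g \<in> C0 K" unfolding g_def by (intro C0_sum gen_p)
    have TA: "T (gen (Inr ?A)) \<in> C0 K" using T.T_C0 gen_Inr copy_mem[OF r p] by blast
    define h where "h x = T (gen (Inr ?A)) x - g x" for x
    have hC: "h \<in> C0 K" unfolding h_def by (intro C0_diff TA gC)
    have h0: "h (Inr B) = 0" if B: "B \<in> \<A> - V" for B
    proof -
      obtain u q' where u: "u < m" "q' \<in> P (cl u)" "B = copy u q'" using B by (auto elim: mem_cases)
      have "T (gen (Inr ?A)) (Inr B) = (if p = q' then c u r else 0)"
        unfolding u(3) by (rule rep_offD[OF Q'(2) r u(1) p u(2)]) (use pQ B in \<open>auto simp: V_def u\<close>)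
      moreover have "g (Inr B) = (if p = q' then c u r else 0)"
      proof -
        have eq: "copy u q' = copy t p \<longleftrightarrow> u = t \<and> q' = p" for t
          by (rule copy_eq_iff[OF P_nonempty[OF u(2)]])
        have "g (Inr B) = (\<Sum>t\<in>?I. if t = u then (if p = q' then c u r else 0) else 0)"
          unfolding g_def u(3) by (intro sum.cong) (auto simp: eq)
        also have "\<dots> = (if u \<in> ?I then (if p = q' then c u r else 0) else 0)"
          by (subst sum.delta) auto
        also have "\<dots> = (if p = q' then c u r else 0)"
          using u P_class[of p "cl r" "cl u"] p by auto
        finally show ?thesis .
      qed
      ultimately show ?thesis unfolding h_def by simp
    qed
    have "T (gen (Inr ?A)) = (\<lambda>x. g x + h x)" unfolding h_def by auto
    then have "S (T (gen (Inr ?A))) (Inr (copy s q)) = S g (Inr (copy s q)) + S h (Inr (copy s q))"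
      using S.T_add[OF gC hC] by simp
    also have "S h (Inr (copy s q)) = 0"
      by (rule van[OF hC h0]) (use copy_mem[OF s q] qQ in auto)
    also have "S g (Inr (copy s q)) = (\<Sum>t\<in>?I. c t r * S (gen (Inr (copy t p))) (Inr (copy s q)))"
      unfolding g_def by (subst S.T_sum[OF gen_p], assumption) simp
    also have "\<dots> = (\<Sum>t\<in>?I. if p = q then d s t * c t r else 0)"
    proof (rule sum.cong[OF refl])
      fix t assume t: "t \<in> ?I"
      then have "S (gen (Inr (copy t p))) (Inr (copy s q)) = (if p = q then d s t else 0)"
        using Q(2) p q s pQ3[of t] qQ3 unfolding rep_off_def by auto
      then show "c t r * S (gen (Inr (copy t p))) (Inr (copy s q)) = (if p = q then d s t * c t r else 0)"
        by simp
    qed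
    also have "\<dots> = (if p = q then \<Sum>t\<in>?I. d s t * c t r else 0)" by simp
    also have "(\<Sum>t\<in>?I. d s t * c t r) = (\<Sum>t<m. d s t * c t r)"
    proof (rule sum.mono_neutral_left)
      have "c t r = 0" if "cl t \<noteq> cl r" for t
        using sc(1) that[symmetric] unfolding supported_def by blast
      then show "\<forall>t\<in>{..<m} - ?I. d s t * c t r = 0" by auto
    qed auto
    finally show "(S \<circ> T) (gen (Inr ?A)) (Inr (copy s q)) = (if p = q then \<Sum>t<m. d s t * c t r else 0)"
      by simp
  qed
  moreover have "supported (\<lambda>s r. \<Sum>t<m. d s t * c t r)"
    unfolding supported_def
  proof (intro allI impI sum.neutral ballI)
    fix s r t assume "\<not> (s < m \<and> r < m \<and> cl r = cl s)" "t \<in> {..<m}"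
    then have "\<not> (s < m \<and> t < m \<and> cl t = cl s) \<or> \<not> (t < m \<and> r < m \<and> cl r = cl t)" by auto
    then have "d s t = 0 \<or> c t r = 0" using sc unfolding supported_def by blast
    then show "d s t * c t r = 0" by auto
  qed
  moreover have "countable (Q' \<union> Q2 \<union> Q3)" using Q'(1) Q2 Q3 by auto
  ultimately show ?thesis unfolding represents_def by blast
qed

text \<open>Generators at isolated points or in \<open>Q\<close> have their countably many limits
  put into \<open>V\<close>; the others are governed by the zero matrix. So every image has its
  limits in \<open>V\<close>.\<close>

lemma represents_zero_separable:
  assumes T: "T \<in> bounded_operators K" and zero: "represents T (\<lambda>s r. 0)"
  shows "T \<in> separable_range_operators K"
proof -
  interpret T: bounded_operator \<A> T by unfold_locales (rule T)
  obtain Q where Q: "countable Q" "rep_off Q T (\<lambda>s r. 0)" using zero unfolding represents_def by auto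
  define V where "V = (Q \<inter> \<A>) \<union> (\<Union>i\<in>range Inl \<union> Inr ` (Q \<inter> \<A>). {B \<in> \<A>. T (gen i) (Inr B) \<noteq> 0})"
  have "gen i \<in> C0 K" if "i \<in> range Inl \<union> Inr ` (Q \<inter> \<A>)" for i :: "nat + nat set"
    using that gen_Inl gen_Inr by auto
  then have V: "countable V" "V \<subseteq> \<A>"
    unfolding V_def using Q(1) by (auto intro!: C0_countable_support T.T_C0)
  have van: "T f (Inr B) = 0" if f: "f \<in> C0 K" and B: "B \<in> \<A> - V" for f B
  proof (rule T.T_vanish[of \<A>])
    fix i :: "nat + nat set" assume i: "i \<in> range Inl \<union> Inr ` \<A>"
    show "T (gen i) (Inr B) = 0"
    proof (cases "i \<in> range Inl \<union> Inr ` (Q \<inter> \<A>)")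
      case True
      then show ?thesis using B unfolding V_def by blast
    next
      case False
      then obtain A where A: "A \<in> \<A>" "A \<notin> Q" "i = Inr A" using i by auto
      obtain r p where r: "r < m" "p \<in> P (cl r)" "A = copy r p" using A(1) by (rule mem_cases)
      obtain s q where s: "s < m" "q \<in> P (cl s)" "B = copy s q" using B by (auto elim: mem_cases)
      have "B \<notin> Q" using B unfolding V_def by auto
      then have "T (gen (Inr A)) (Inr B) = (if p = q then 0 else 0)"
        using Q(2) r s A(2) unfolding rep_off_def by blast
      then show ?thesis using A(3) by simp
    qed
  qed (use f in auto)
  obtain D where D: "countable D" "D \<subseteq> C0 K"
    "\<And>f \<epsilon>. f \<in> C0 K \<Longrightarrow> (\<And>B. B \<in> \<A> - V \<Longrightarrow> f (Inr B) = 0) \<Longrightarrow> \<epsilon> > 0 \<Longrightarrow> \<exists>d\<in>D. sup_dist f d \<le> \<epsilon>"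
    by (rule separable_part[OF V]) blast
  have "separable_space (subtopology (Metric_space.mtopology (C0 K) sup_dist) (T ` C0 K))"
  proof (rule separable_subspaceI[OF _ D(1,2)])
    show "T ` C0 K \<subseteq> C0 K" using T.T_C0 by auto
    fix f and \<epsilon> :: real assume "f \<in> T ` C0 K" "\<epsilon> > 0"
    then show "\<exists>d\<in>D. sup_dist f d \<le> \<epsilon>" using van T.T_C0 by (auto intro!: D(3))
  qed
  then show ?thesis using T unfolding separable_range_operators_def by simp
qed

text \<open>A nonzero \<open>c s r\<close> separates the images for uncountably many
  \<open>p\<close> by its modulus, as seen at the limit point of \<open>copy s p\<close>.\<close>

lemma separable_represents_zero:
  assumes T: "T \<in> separable_range_operators K" and rep: "represents T c"
  shows "c = (\<lambda>s r. 0)"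
proof -
  have T': "T \<in> bounded_operators K" and sep: "separable_space (subtopology (Metric_space.mtopology (C0 K) sup_dist) (T ` C0 K))"
    using T unfolding separable_range_operators_def by auto
  interpret T: bounded_operator \<A> T by unfold_locales (rule T')
  obtain Q where Q: "countable Q" "rep_off Q T c" using rep unfolding represents_def by auto
  have "c s r = 0" for s r
  proof (rule ccontr)
    assume c: "c s r \<noteq> 0"
    then have sr: "s < m" "r < m" "cl r = cl s" using rep unfolding represents_def supported_def by blast+
    define I where "I = {p \<in> P (cl r). copy r p \<notin> Q \<and> copy s p \<notin> Q}"
    have gI: "gen (Inr (copy r p)) \<in> C0 K" if "p \<in> I" for p
      using that sr by (intro gen_Inr copy_mem) (auto simp: I_def)
    have "countable I"
    proof (rule separable_no_separated[OF _ sep, of I "\<lambda>p. T (gen (Inr (copy r p)))" "cmod (c s r)"])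
      show "T ` C0 K \<subseteq> C0 K" using T.T_C0 by auto
      show "T (gen (Inr (copy r p))) \<in> T ` C0 K" if "p \<in> I" for p using gI[OF that] by blast
      show "0 < cmod (c s r)" using c by simp
      fix p q assume pq: "p \<in> I" "q \<in> I" "p \<noteq> q"
      have "T (gen (Inr (copy r p))) (Inr (copy s p)) = c s r"
        using Q(2) sr pq(1) unfolding rep_off_def I_def by auto
      moreover have "T (gen (Inr (copy r q))) (Inr (copy s p)) = 0"
        using Q(2) sr pq unfolding rep_off_def I_def by auto
      ultimately show "cmod (c s r) \<le> sup_dist (T (gen (Inr (copy r p)))) (T (gen (Inr (copy r q))))"
        using le_sup_dist[OF T.T_C0[OF gI[OF pq(1)]] T.T_C0[OF gI[OF pq(2)]], of "Inr (copy s p)"] by simp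
    qed
    then obtain p where p: "p \<in> P (cl r)" "\<And>t. t < m \<Longrightarrow> copy t p \<notin> Q \<union> copy r ` I"
      using obtain_P_avoiding[of "Q \<union> copy r ` I"] Q(1) by (metis countable_Un countable_image)
    then have "p \<in> I" using sr unfolding I_def by auto
    then show False using p(2)[OF sr(2)] by auto
  qed
  then show ?thesis by blast
qed

end

section \<open>The quotient algebra\<close>

lemma (in bounded_operator) scaled_bounded_operator: "(\<lambda>f x. c * T f x) \<in> bounded_operators K"
proof -
  have "sup_norm (\<lambda>x. c * T f x) \<le> (cmod c * op_bound) * sup_norm f" if f: "f \<in> C0 K" for f
  proof (rule sup_norm_least)
    fix x
    have "cmod (T f x) \<le> op_bound * sup_norm f"
      by (rule T_bound[OF f cmod_le_sup_norm[OF bounded_C0[OF f]]])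
    then show "cmod (c * T f x) \<le> (cmod c * op_bound) * sup_norm f"
      unfolding norm_mult mult.assoc by (intro mult_left_mono) auto
  qed
  moreover have "T f = (\<lambda>x. 0)" if "f \<notin> C0 K" for f
    using bounded_operator that unfolding bounded_operators_def by blast
  ultimately show ?thesis
    unfolding bounded_operators_def
    by (auto simp: T_add T_cmult distrib_left mult.left_commute intro!: C0_cmult T_C0)
qed

lemma (in ad_family) add_bounded_operators:
  assumes "S \<in> bounded_operators K" "T \<in> bounded_operators K"
  shows "(\<lambda>f x. S f x + T f x) \<in> bounded_operators K"
proof -
  interpret S: bounded_operator \<A> S by unfold_locales (rule assms)
  interpret T: bounded_operator \<A> T by unfold_locales (rule assms)
  have "sup_norm (\<lambda>x. S f x + T f x) \<le> (S.op_bound + T.op_bound) * sup_norm f" if f: "f \<in> C0 K" for f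
  proof (rule sup_norm_least)
    fix x
    have "cmod (S f x) \<le> S.op_bound * sup_norm f" "cmod (T f x) \<le> T.op_bound * sup_norm f"
      by (rule S.T_bound[OF f cmod_le_sup_norm[OF bounded_C0[OF f]]],
          rule T.T_bound[OF f cmod_le_sup_norm[OF bounded_C0[OF f]]])
    then show "cmod (S f x + T f x) \<le> (S.op_bound + T.op_bound) * sup_norm f"
      using norm_triangle_ineq[of "S f x" "T f x"] by (simp add: distrib_right)
  qed
  moreover have "S f = (\<lambda>x. 0)" "T f = (\<lambda>x. 0)" if "f \<notin> C0 K" for f
    using assms that unfolding bounded_operators_def by blast+
  ultimately show ?thesis
    unfolding bounded_operators_def
    by (auto simp: S.T_add T.T_add S.T_cmult T.T_cmult distrib_left intro!: C0_add S.T_C0 T.T_C0)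
qed

lemma (in ad_family) comp_bounded_operators:
  assumes "S \<in> bounded_operators K" "T \<in> bounded_operators K"
  shows "S \<circ> T \<in> bounded_operators K"
proof -
  interpret S: bounded_operator \<A> S by unfold_locales (rule assms)
  interpret T: bounded_operator \<A> T by unfold_locales (rule assms)
  have "sup_norm (S (T f)) \<le> (S.op_bound * T.op_bound) * sup_norm f" if f: "f \<in> C0 K" for f
  proof (rule sup_norm_least)
    fix x
    have "cmod (S (T f) x) \<le> S.op_bound * (T.op_bound * sup_norm f)"
      by (intro S.T_bound T.T_bound T.T_C0 f cmod_le_sup_norm[OF bounded_C0[OF f]])
    then show "cmod (S (T f) x) \<le> (S.op_bound * T.op_bound) * sup_norm f" by (simp add: mult.assoc)
  qed
  moreover have "S (T f) = (\<lambda>x. 0)" if "f \<notin> C0 K" for f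
  proof -
    have "T f = (\<lambda>x. 0)" using assms(2) that unfolding bounded_operators_def by blast
    then show ?thesis using S.T_cmult[OF C0_zero, of 0] by simp
  qed
  ultimately show ?thesis
    unfolding bounded_operators_def
    by (auto simp: S.T_add T.T_add S.T_cmult T.T_cmult T.T_C0 intro!: S.T_C0 T.T_C0)
qed

lemma along_copy: "along (copy s q) = filtermap (\<lambda>a. prod_encode (a, s)) (along q)"
proof (rule filter_eqI)
  fix P
  have "{n \<in> copy s q. \<not> P n} = (\<lambda>a. prod_encode (a, s)) ` {a \<in> q. \<not> P (prod_encode (a, s))}"
    unfolding copy_def by auto
  moreover have "inj_on (\<lambda>a. prod_encode (a, s)) X" for X by (rule inj_onI) simp
  ultimately show "eventually P (along (copy s q)) = eventually P (filtermap (\<lambda>a. prod_encode (a, s)) (along q))"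
    unfolding eventually_filtermap eventually_along by (simp add: finite_image_iff)
qed

section \<open>Operators realising every symbol\<close>

context rigid
begin

text \<open>The matrix unit with row \<open>s\<close> and column \<open>r\<close>: it transports a
  function from copy \<open>r\<close> to copy \<open>s\<close>. First components of the codes in
  \<open>B\<close> recover the \<open>q\<close> with \<open>B = copy s q\<close>.\<close>

definition shift :: "nat \<Rightarrow> nat \<Rightarrow> (nat + nat set \<Rightarrow> complex) \<Rightarrow> nat + nat set \<Rightarrow> complex" where
  "shift s r f x = (case x of
     Inl n \<Rightarrow> if snd (prod_decode n) = s then f (Inl (prod_encode (fst (prod_decode n), r))) else 0
   | Inr B \<Rightarrow> if \<exists>q\<in>P (cl s). B = copy s q then f (Inr (copy r ((fst \<circ> prod_decode) ` B))) else 0)"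

lemma shift_Inl: "shift s r f (Inl (prod_encode (a, t))) = (if t = s then f (Inl (prod_encode (a, r))) else 0)"
  unfolding shift_def by simp

lemma shift_Inr:
  assumes "q \<in> P i"
  shows "shift s r f (Inr (copy t q)) = (if t = s \<and> q \<in> P (cl s) then f (Inr (copy r q)) else 0)"
proof -
  have "(\<lambda>x. fst (prod_decode x)) ` copy t' q = q" for t' unfolding copy_def by (simp add: image_image)
  moreover have "(\<exists>q'\<in>P (cl s). copy t q = copy s q') \<longleftrightarrow> t = s \<and> q \<in> P (cl s)"
    unfolding copy_eq_iff[OF P_nonempty[OF assms]] by auto
  ultimately show ?thesis unfolding shift_def by simp
qed

text \<open>Equal classes mean that both copies carry the same family, so limits and finite
  coverings by members are transported.\<close>

lemma shift_C0:
  assumes f: "f \<in> C0 K" and s: "s < m" and r: "r < m" and eq: "cl r = cl s"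
  shows "shift s r f \<in> C0 K"
proof -
  have "((\<lambda>n. shift s r f (Inl n)) \<longlongrightarrow> shift s r f (Inr A)) (along A)" if A: "A \<in> \<A>" for A
  proof -
    obtain t q where t: "t < m" "q \<in> P (cl t)" "A = copy t q" using A by (rule mem_cases)
    show ?thesis
    proof (cases "t = s")
      case True
      have "((\<lambda>a. f (Inl (prod_encode (a, r)))) \<longlongrightarrow> f (Inr (copy r q))) (along q)"
        by (rule filterlim_compose[OF C0_limit[OF f copy_mem[OF r]] filterlim_copy]) (use t eq True in auto)
      then show ?thesis
        unfolding t(3) along_copy filterlim_filtermap shift_Inl shift_Inr[OF t(2)] using True t(2) by simp
    next
      case False
      then show ?thesis
        unfolding t(3) along_copy filterlim_filtermap shift_Inl shift_Inr[OF t(2)] by simp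
    qed
  qed
  moreover have "controlled (\<lambda>n. shift s r f (Inl n))"
    unfolding controlled_def
  proof (intro allI impI)
    fix \<epsilon> :: real assume "\<epsilon> > 0"
    then obtain \<W> where W: "\<W> \<subseteq> \<A>" "finite \<W>" "finite ({n. \<epsilon> \<le> cmod (f (Inl n))} - \<Union>\<W>)"
      using f unfolding C0_iff by (auto intro: controlledE[of "\<lambda>n. f (Inl n)" \<epsilon>])
    define W0 where "W0 = {q \<in> P (cl s). copy r q \<in> \<W>}"
    have "finite (copy r ` W0)" by (rule finite_subset[OF _ W(2)]) (auto simp: W0_def)
    then have "finite W0" by (rule finite_imageD) (rule inj_on_subset[OF inj_copy], simp)
    then have "finite (copy s ` W0)" by simp
    moreover have "copy s ` W0 \<subseteq> \<A>" using s unfolding W0_def by (auto intro: copy_mem)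
    moreover have "finite ({n. \<epsilon> \<le> cmod (shift s r f (Inl n))} - \<Union>(copy s ` W0))"
    proof (rule finite_subset)
      let ?u = "\<lambda>k. prod_encode (fst (prod_decode k), s)"
      show "{n. \<epsilon> \<le> cmod (shift s r f (Inl n))} - \<Union>(copy s ` W0) \<subseteq> ?u ` ({n. \<epsilon> \<le> cmod (f (Inl n))} - \<Union>\<W>)"
      proof
        fix n assume n: "n \<in> {n. \<epsilon> \<le> cmod (shift s r f (Inl n))} - \<Union>(copy s ` W0)"
        obtain a t where at: "n = prod_encode (a, t)" by (metis prod_decode_inverse surj_pair)
        have ts: "t = s" and fa: "\<epsilon> \<le> cmod (f (Inl (prod_encode (a, r))))"
          using n \<open>\<epsilon> > 0\<close> unfolding at by (auto simp: shift_Inl split: if_splits)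
        have "prod_encode (a, r) \<notin> w" if w: "w \<in> \<W>" for w
        proof
          assume aw: "prod_encode (a, r) \<in> w"
          have "w \<in> \<A>" using w W(1) by auto
          then obtain t' q where "t' < m" and q: "q \<in> P (cl t')" "w = copy t' q" by (rule mem_cases)
          then have "r = t'" "a \<in> q" using aw prod_encode_mem_copy by auto
          then have "q \<in> W0" using q w eq unfolding W0_def by simp
          moreover have "n \<in> copy s q" using \<open>a \<in> q\<close> unfolding at ts prod_encode_mem_copy by simp
          ultimately show False using n by auto
        qed
        then have "prod_encode (a, r) \<in> {n. \<epsilon> \<le> cmod (f (Inl n))} - \<Union>\<W>" using fa by auto
        then show "n \<in> ?u ` ({n. \<epsilon> \<le> cmod (f (Inl n))} - \<Union>\<W>)"
          by (rule rev_image_eqI) (simp add: at ts)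
      qed
      show "finite (?u ` ({n. \<epsilon> \<le> cmod (f (Inl n))} - \<Union>\<W>))" using W(3) by simp
    qed
    ultimately show "\<exists>\<W>\<subseteq>\<A>. finite \<W> \<and> finite ({n. \<epsilon> \<le> cmod (shift s r f (Inl n))} - \<Union>\<W>)" by blast
  qed
  moreover have "shift s r f (Inr A) = 0" if "A \<notin> \<A>" for A
    using that copy_mem[OF s] unfolding shift_def by auto
  ultimately show ?thesis unfolding C0_iff by blast
qed

lemma shift_add: "shift s r (\<lambda>x. f x + g x) = (\<lambda>x. shift s r f x + shift s r g x)"
  unfolding shift_def by (auto split: sum.split)

lemma shift_cmult: "shift s r (\<lambda>x. c * f x) = (\<lambda>x. c * shift s r f x)"
  unfolding shift_def by (auto split: sum.split)

lemma shift_le: "(\<And>x. cmod (f x) \<le> b) \<Longrightarrow> cmod (shift s r f x) \<le> b"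
proof -
  assume *: "\<And>x. cmod (f x) \<le> b"
  then have "0 \<le> b" using order_trans[OF norm_ge_zero] by blast
  then show ?thesis unfolding shift_def using * by (auto split: sum.split)
qed

definition block :: "(nat \<times> nat) set" where
  "block = {i. fst i < m \<and> snd i < m \<and> cl (snd i) = cl (fst i)}"

definition block_operator :: "(nat \<Rightarrow> nat \<Rightarrow> complex) \<Rightarrow> (nat + nat set \<Rightarrow> complex) \<Rightarrow> (nat + nat set \<Rightarrow> complex)" where
  "block_operator c f = (if f \<in> C0 K then (\<lambda>x. \<Sum>i\<in>block. c (fst i) (snd i) * shift (fst i) (snd i) f x) else (\<lambda>x. 0))"

lemma finite_block: "finite block"
  by (rule finite_subset[of _ "{..<m} \<times> {..<m}"]) (auto simp: block_def)

lemma block_operator_bounded: "block_operator c \<in> bounded_operators K"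
proof -
  have C0: "block_operator c f \<in> C0 K" if "f \<in> C0 K" for f
    unfolding block_operator_def using that by (auto intro!: C0_sum shift_C0 simp: block_def)
  have bound: "sup_norm (block_operator c f) \<le> (\<Sum>i\<in>block. cmod (c (fst i) (snd i))) * sup_norm f" if f: "f \<in> C0 K" for f
  proof (rule sup_norm_least)
    fix x
    have "cmod (block_operator c f x) \<le> (\<Sum>i\<in>block. cmod (c (fst i) (snd i) * shift (fst i) (snd i) f x))"
      unfolding block_operator_def using f by (simp add: norm_sum)
    also have "\<dots> \<le> (\<Sum>i\<in>block. cmod (c (fst i) (snd i)) * sup_norm f)"
      unfolding norm_mult
      by (intro sum_mono mult_left_mono shift_le cmod_le_sup_norm[OF bounded_C0[OF f]]) auto
    finally show "cmod (block_operator c f x) \<le> (\<Sum>i\<in>block. cmod (c (fst i) (snd i))) * sup_norm f"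
      by (simp add: sum_distrib_right)
  qed
  have add: "block_operator c (\<lambda>x. f x + g x) = (\<lambda>x. block_operator c f x + block_operator c g x)"
    if "f \<in> C0 K" "g \<in> C0 K" for f g
    unfolding block_operator_def using that C0_add[OF that] by (simp add: shift_add distrib_left sum.distrib)
  have cmult: "block_operator c (\<lambda>x. a * f x) = (\<lambda>x. a * block_operator c f x)" if "f \<in> C0 K" for f a
    unfolding block_operator_def using that C0_cmult[OF that]
    by (simp add: shift_cmult sum_distrib_left mult.left_commute)
  show ?thesis
    unfolding bounded_operators_def mem_Collect_eq
    using C0 add cmult bound by (intro conjI) (blast, blast, blast, blast, simp add: block_operator_def)
qed

lemma block_operator_represents:
  assumes "supported c" shows "represents (block_operator c) c"
proof -
  have "rep_off {} (block_operator c) c"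
    unfolding rep_off_def
  proof (intro allI impI)
    fix r s p q
    assume r: "r < m" and s: "s < m" and p: "p \<in> P (cl r)" and q: "q \<in> P (cl s)"
    let ?g = "gen (Inr (copy r p))"
    have g: "?g \<in> C0 K" by (rule gen_Inr[OF copy_mem[OF r p]])
    have "block_operator c ?g (Inr (copy s q)) =
        (\<Sum>i\<in>block. if i = (s, r) then (if p = q then c s r else 0) else 0)"
    proof -
      have "block_operator c ?g (Inr (copy s q)) =
          (\<Sum>i\<in>block. c (fst i) (snd i) * shift (fst i) (snd i) ?g (Inr (copy s q)))"
        unfolding block_operator_def using g by simp
      also have "\<dots> = (\<Sum>i\<in>block. if i = (s, r) then (if p = q then c s r else 0) else 0)"
      proof (intro sum.cong refl)
      fix i assume i: "i \<in> block"
      obtain s' r' where sr: "i = (s', r')" by (metis surj_pair)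
      have "shift s' r' ?g (Inr (copy s q)) = (if s = s' \<and> r' = r \<and> p = q then 1 else 0)"
        unfolding shift_Inr[OF q] using copy_eq_iff[OF P_nonempty[OF q], of r' r p] q by auto
      then show "c (fst i) (snd i) * shift (fst i) (snd i) ?g (Inr (copy s q)) =
          (if i = (s, r) then if p = q then c s r else 0 else 0)"
        unfolding sr by auto
      qed
      finally show ?thesis .
    qed
    also have "\<dots> = (if (s, r) \<in> block then (if p = q then c s r else 0) else 0)"
      using finite_block by (subst sum.delta) auto
    also have "\<dots> = (if p = q then c s r else 0)"
      using P_class[of p "cl r" "cl s"] p q r s unfolding block_def by auto
    finally show "block_operator c ?g (Inr (copy s q)) = (if p = q then c s r else 0)" .
  qed
  then show ?thesis using assms unfolding represents_def by blast
qed

section \<open>The symbol map and its kernel\<close>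

definition symbol :: "((nat + nat set \<Rightarrow> complex) \<Rightarrow> (nat + nat set \<Rightarrow> complex)) \<Rightarrow> nat \<Rightarrow> nat \<Rightarrow> complex" where
  "symbol T = (THE c. represents T c)"

lemma symbol_eq: "represents T c \<Longrightarrow> symbol T = c"
  unfolding symbol_def using represents_unique by blast

lemma represents_symbol: "T \<in> bounded_operators K \<Longrightarrow> represents T (symbol T)"
  using represents_exists symbol_eq by metis

lemma supported_symbol: "T \<in> bounded_operators K \<Longrightarrow> supported (symbol T)"
  using represents_symbol unfolding represents_def by blast

abbreviation R where "R \<equiv> operator_algebra K"
abbreviation I where "I \<equiv> separable_range_operators K"

lemma R_simps:
  "carrier R = bounded_operators K" "S \<otimes>\<^bsub>R\<^esub> T = S \<circ> T" "S \<oplus>\<^bsub>R\<^esub> T = (\<lambda>f x. S f x + T f x)"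
  "a \<odot>\<^bsub>R\<^esub> T = (\<lambda>f x. a * T f x)"
  unfolding operator_algebra_def by simp_all

lemma separable_iff: "T \<in> I \<longleftrightarrow> T \<in> bounded_operators K \<and> symbol T = (\<lambda>s r. 0)"
proof
  assume T: "T \<in> I"
  then have "T \<in> bounded_operators K" unfolding separable_range_operators_def by blast
  then show "T \<in> bounded_operators K \<and> symbol T = (\<lambda>s r. 0)"
    using separable_represents_zero[OF T represents_symbol] by blast
next
  assume "T \<in> bounded_operators K \<and> symbol T = (\<lambda>s r. 0)"
  then show "T \<in> I" using represents_zero_separable[of T] represents_symbol[of T] by simp
qed

lemma symbol_add:
  "S \<in> bounded_operators K \<Longrightarrow> T \<in> bounded_operators K \<Longrightarrow>
    symbol (\<lambda>f x. S f x + T f x) = (\<lambda>s r. symbol S s r + symbol T s r)"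
  by (intro symbol_eq represents_add represents_symbol)

lemma symbol_cmult:
  "T \<in> bounded_operators K \<Longrightarrow> symbol (\<lambda>f x. a * T f x) = (\<lambda>s r. a * symbol T s r)"
  by (intro symbol_eq represents_cmult represents_symbol)

lemma symbol_comp:
  "S \<in> bounded_operators K \<Longrightarrow> T \<in> bounded_operators K \<Longrightarrow>
    symbol (S \<circ> T) = (\<lambda>s r. \<Sum>t<m. symbol S s t * symbol T t r)"
  by (intro symbol_eq represents_comp represents_symbol)

lemma cmult_bounded: "T \<in> bounded_operators K \<Longrightarrow> (\<lambda>f x. a * T f x) \<in> bounded_operators K"
  by (rule bounded_operator.scaled_bounded_operator) unfold_locales

text \<open>The ideal is the kernel of the linear map \<open>symbol\<close>, so its cosets are the
  fibres, and computations in the quotient reduce to symbols of representatives.\<close>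

lemma coset_eq:
  assumes T: "T \<in> bounded_operators K"
  shows "I +>\<^bsub>R\<^esub> T = {S \<in> bounded_operators K. symbol S = symbol T}"
proof (intro equalityI subsetI)
  fix S assume "S \<in> I +>\<^bsub>R\<^esub> T"
  then obtain h where h: "h \<in> I" "S = (\<lambda>f x. h f x + T f x)"
    unfolding a_r_coset_def' R_simps by auto
  have hB: "h \<in> bounded_operators K" "symbol h = (\<lambda>s r. 0)" using h(1) separable_iff by auto
  show "S \<in> {S \<in> bounded_operators K. symbol S = symbol T}"
    using add_bounded_operators[OF hB(1) T] symbol_add[OF hB(1) T] hB(2) unfolding h(2) by simp
next
  fix S assume "S \<in> {S \<in> bounded_operators K. symbol S = symbol T}"
  then have S: "S \<in> bounded_operators K" "symbol S = symbol T" by auto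
  define h where "h = (\<lambda>f x. S f x + (\<lambda>f x. (-1) * T f x) f x)"
  have "h \<in> bounded_operators K" unfolding h_def by (intro add_bounded_operators S cmult_bounded T)
  moreover have "symbol h = (\<lambda>s r. 0)"
    unfolding h_def symbol_add[OF S(1) cmult_bounded[OF T]] symbol_cmult[OF T] S(2) by simp
  ultimately have "h \<in> I" unfolding separable_iff by blast
  moreover have "S = (\<lambda>f x. h f x + T f x)" unfolding h_def by auto
  ultimately show "S \<in> I +>\<^bsub>R\<^esub> T" unfolding a_r_coset_def' R_simps by auto
qed

lemma quotient_simps:
  "carrier (quotient_algebra R I) = {I +>\<^bsub>R\<^esub> T |T. T \<in> bounded_operators K}"
  "u \<oplus>\<^bsub>quotient_algebra R I\<^esub> v = (\<Union>S\<in>u. \<Union>T\<in>v. {\<lambda>f x. S f x + T f x})"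
  "u \<otimes>\<^bsub>quotient_algebra R I\<^esub> v = (\<Union>S\<in>u. \<Union>T\<in>v. I +>\<^bsub>R\<^esub> (S \<circ> T))"
  "a \<odot>\<^bsub>quotient_algebra R I\<^esub> u = (\<Union>T\<in>u. I +>\<^bsub>R\<^esub> (\<lambda>f x. a * T f x))"
  unfolding quotient_algebra_def FactRing_def ring.defs module.defs
  by (auto simp: A_RCOSETS_def' set_add_def' rcoset_mult_def R_simps)

end

theorem corollary1p5:
  fixes scale :: "complex \<Rightarrow> 'c::ring \<Rightarrow> 'c"
  assumes "complex_algebra scale"
    and "complex_algebra.finite_dimensional scale"
    and "complex_algebra.semisimple scale"
  shows "\<exists>\<A>. almost_disjoint_family \<A> \<and>
           (\<exists>\<phi>. complex_algebra.algebra_isomorphism scale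
                  (quotient_algebra (operator_algebra (K_space \<A>))
                     (separable_range_operators (K_space \<A>))) \<phi>)"
proof -
  interpret complex_algebra scale by (rule assms)
  obtain Basis where "fd_complex_algebra scale Basis"
    using finite_dimensional_basis[OF assms(2)] .
  then interpret fd_complex_algebra scale Basis .
  from matrix_units[OF assms(3)] obtain m :: nat and cl :: "nat \<Rightarrow> nat" and U :: "nat \<Rightarrow> nat \<Rightarrow> 'c" where
    U: "\<forall>i<m. \<forall>j<m. \<forall>k<m. \<forall>l<m. cl i = cl j \<longrightarrow> cl k = cl l \<longrightarrow> U i j * U k l = (if j = k then U i l else 0)"
    and U_span: "\<forall>x. \<exists>c. x = (\<Sum>i<m. \<Sum>j<m. if cl i = cl j then scale (c i j) (U i j) else 0)"
    and U_nonzero: "\<forall>i<m. \<forall>j<m. cl i = cl j \<longrightarrow> U i j \<noteq> 0"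
    by (elim exE conjE)
  have UU: "U i j * U k l = (if j = k then U i l else 0)"
    if "i < m" "j < m" "k < m" "l < m" "cl i = cl j" "cl k = cl l" for i j k l
    using U that by simp
  obtain P where "rigid_family P" using rigid_family_exists by blast
  then interpret rigid P m cl by (rule rigid.intro)
  let ?B = "bounded_operators (K_space (copies P m cl))"
  \<comment> \<open>Zero between different classes, so that sums can run over all pairs of
    indices.\<close>
  define W where "W i j = (if cl i = cl j then U i j else 0)" for i j
  define \<Theta> where "\<Theta> c = (\<Sum>i<m. \<Sum>j<m. scale (c i j) (W i j))" for c
  have WW: "scale (c i j) (W i j) * scale (d k l) (W k l) = (if j = k then scale (c i j * d j l) (W i l) else 0)"
    if "supported c" "supported d" "i < m" "j < m" "k < m" "l < m" for c d i j k l
  proof -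
    have z: "cl i \<noteq> cl j \<Longrightarrow> c i j = 0" "cl k \<noteq> cl l \<Longrightarrow> d k l = 0"
      using that(1,2) unfolding supported_def by auto
    show ?thesis
    proof (cases "cl i = cl j \<and> cl k = cl l")
      case True
      then show ?thesis
        using UU[OF that(3-6)] unfolding W_def by (auto simp: mult_scale_left mult_scale_right)
    next
      case False
      then have "c i j = 0 \<or> d k l = 0" using z by auto
      then show ?thesis by auto
    qed
  qed
  have \<Theta>_mult: "\<Theta> (\<lambda>s r. \<Sum>t<m. c s t * d t r) = \<Theta> c * \<Theta> d" if "supported c" "supported d" for c d
  proof -
    have "\<Theta> c * \<Theta> d = (\<Sum>i<m. \<Sum>j<m. \<Sum>k<m. \<Sum>l<m. scale (c i j) (W i j) * scale (d k l) (W k l))"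
      unfolding \<Theta>_def
      by (subst sum_distrib_right, intro sum.cong refl, subst sum_distrib_right, intro sum.cong refl)
        (simp add: sum_distrib_left)
    also have "\<dots> = (\<Sum>i<m. \<Sum>j<m. \<Sum>k<m. \<Sum>l<m. if j = k then scale (c i j * d j l) (W i l) else 0)"
      by (intro sum.cong refl WW that) auto
    also have "\<dots> = (\<Sum>i<m. \<Sum>j<m. \<Sum>l<m. scale (c i j * d j l) (W i l))"
      by (rule sum.cong[OF refl], rule sum.cong[OF refl]) (subst sum.swap, simp)
    also have "\<dots> = (\<Sum>i<m. \<Sum>l<m. \<Sum>j<m. scale (c i j * d j l) (W i l))"
      by (rule sum.cong[OF refl]) (rule sum.swap)
    also have "\<dots> = \<Theta> (\<lambda>s r. \<Sum>t<m. c s t * d t r)"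
      unfolding \<Theta>_def by (simp add: scale_sum_left)
    finally show ?thesis ..
  qed
  have \<Theta>_add: "\<Theta> (\<lambda>s r. c s r + d s r) = \<Theta> c + \<Theta> d" for c d
    unfolding \<Theta>_def by (simp add: scale_left_distrib sum.distrib)
  have \<Theta>_cmult: "\<Theta> (\<lambda>s r. a * c s r) = scale a (\<Theta> c)" for a c
    unfolding \<Theta>_def by (simp add: scale_sum_right)
  have \<Theta>_inj: "c = d" if "supported c" "supported d" "\<Theta> c = \<Theta> d" for c d
  proof (intro ext)
    fix s r
    define e where "e i j = c i j + (-1) * d i j" for i j
    have e: "supported e" using that(1,2) unfolding supported_def e_def by auto
    have "\<Theta> e = 0" using \<Theta>_add[of c "\<lambda>i j. (-1) * d i j"] \<Theta>_cmult[of "-1" d] that(3)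
      unfolding e_def by simp
    show "c s r = d s r"
    proof (cases "s < m \<and> r < m \<and> cl r = cl s")
      case True
      \<comment> \<open>Multiplying by the diagonal units at \<open>s\<close> and \<open>r\<close>
        isolates the entry \<open>e s r\<close>. Since \<open>\<Theta>\<close> respects these
        products, the vanishing of \<open>\<Theta> e\<close> passes to this entry times a nonzero
        matrix unit.\<close>
      define \<delta> where "\<delta> u i j = (if i = u \<and> j = u then 1 else 0 :: complex)" for u i j :: nat
      have \<delta>: "supported (\<delta> s)" "supported (\<delta> r)" using True unfolding supported_def \<delta>_def by auto
      let ?e1 = "\<lambda>i j. \<Sum>t<m. \<delta> s i t * e t j"
      have 1: "?e1 i j = (if i = s then e s j else 0)" for i j
      proof -
        have "?e1 i j = (\<Sum>t<m. if t = s then (if i = s then e s j else 0) else 0)"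
          by (rule sum.cong) (auto simp: \<delta>_def)
        then show ?thesis using True by simp
      qed
      have e1: "supported ?e1" using e unfolding 1 supported_def by auto
      let ?e2 = "\<lambda>i j. \<Sum>t<m. ?e1 i t * \<delta> r t j"
      have 2: "?e2 i j = (if i = s \<and> j = r then e s r else 0)" for i j
      proof -
        have "?e2 i j = (\<Sum>t<m. if t = r then (if i = s \<and> j = r then e s r else 0) else 0)"
          unfolding 1 by (rule sum.cong) (auto simp: \<delta>_def)
        then show ?thesis using True by simp
      qed
      have "\<Theta> ?e2 = \<Theta> (\<delta> s) * \<Theta> e * \<Theta> (\<delta> r)"
        unfolding \<Theta>_mult[OF e1 \<delta>(2)] \<Theta>_mult[OF \<delta>(1) e] ..
      then have "\<Theta> ?e2 = 0" using \<open>\<Theta> e = 0\<close> by simp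
      moreover have "\<Theta> ?e2 = scale (e s r) (W s r)"
      proof -
        have inner: "scale (if i = s \<and> j = r then e s r else 0) (W i j) =
            (if j = r then (if i = s then scale (e s r) (W s r) else 0) else 0)" for i j
          by auto
        have "\<Theta> ?e2 = (\<Sum>i<m. \<Sum>j<m. if j = r then (if i = s then scale (e s r) (W s r) else 0) else 0)"
          unfolding \<Theta>_def 2 inner ..
        then show ?thesis using True by simp
      qed
      ultimately have "e s r = 0" using U_nonzero True unfolding W_def by auto
      then show ?thesis unfolding e_def by simp
    next
      case False
      then have "c s r = 0" "d s r = 0" using that(1,2) unfolding supported_def by blast+
      then show ?thesis by simp
    qed
  qed
  have \<Theta>_surj: "\<exists>c. supported c \<and> \<Theta> c = x" for x
  proof -
    obtain c where c: "x = (\<Sum>i<m. \<Sum>j<m. if cl i = cl j then scale (c i j) (U i j) else 0)"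
      using U_span by blast
    define c' where "c' i j = (if i < m \<and> j < m \<and> cl j = cl i then c i j else 0)" for i j
    have "\<Theta> c' = x" unfolding \<Theta>_def c by (intro sum.cong refl) (auto simp: c'_def W_def)
    moreover have "supported c'" unfolding supported_def c'_def by auto
    ultimately show ?thesis by blast
  qed
  define \<phi> where "\<phi> u = \<Theta> (symbol (SOME T. T \<in> u))" for u
  \<comment> \<open>A common symbol on a nonempty set determines \<open>\<phi>\<close> there, so
    sums and products of cosets can be evaluated without first being written as cosets.\<close>
  have \<phi>: "\<phi> u = \<Theta> c" if "u \<noteq> {}" "\<And>T. T \<in> u \<Longrightarrow> symbol T = c" for u c
  proof -
    have "(SOME T. T \<in> u) \<in> u" using that(1) by (simp add: some_in_eq)
    then show ?thesis unfolding \<phi>_def using that(2) by simp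
  qed
  have mem: "T \<in> I +>\<^bsub>R\<^esub> T" if "T \<in> ?B" for T using coset_eq[OF that] that by simp
  have \<phi>_coset: "\<phi> (I +>\<^bsub>R\<^esub> T) = \<Theta> (symbol T)" if T: "T \<in> ?B" for T
    using mem[OF T] coset_eq[OF T] by (intro \<phi>) auto
  have "algebra_isomorphism (quotient_algebra R I) \<phi>"
    unfolding algebra_isomorphism_def
  proof (intro conjI ballI allI)
    show "bij_betw \<phi> (carrier (quotient_algebra R I)) UNIV"
      unfolding bij_betw_def
    proof
      show "inj_on \<phi> (carrier (quotient_algebra R I))"
      proof (rule inj_onI)
        fix u v assume u: "u \<in> carrier (quotient_algebra R I)" and v: "v \<in> carrier (quotient_algebra R I)"
          and eq: "\<phi> u = \<phi> v"
        obtain S where S: "S \<in> ?B" "u = I +>\<^bsub>R\<^esub> S" using u unfolding quotient_simps by blast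
        obtain T where T: "T \<in> ?B" "v = I +>\<^bsub>R\<^esub> T" using v unfolding quotient_simps by blast
        have "symbol S = symbol T"
          using eq unfolding S(2) T(2) \<phi>_coset[OF S(1)] \<phi>_coset[OF T(1)]
          by (rule \<Theta>_inj[OF supported_symbol[OF S(1)] supported_symbol[OF T(1)]])
        then show "u = v" unfolding S(2) T(2) coset_eq[OF S(1)] coset_eq[OF T(1)] by simp
      qed
      show "\<phi> ` carrier (quotient_algebra R I) = UNIV"
      proof (intro equalityI subsetI)
        fix x :: 'c
        obtain c where c: "supported c" "\<Theta> c = x" using \<Theta>_surj by blast
        have "\<phi> (I +>\<^bsub>R\<^esub> block_operator c) = x"
          unfolding \<phi>_coset[OF block_operator_bounded] symbol_eq[OF block_operator_represents[OF c(1)]]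
          by (rule c(2))
        moreover have "I +>\<^bsub>R\<^esub> block_operator c \<in> carrier (quotient_algebra R I)"
          unfolding quotient_simps using block_operator_bounded by blast
        ultimately show "x \<in> \<phi> ` carrier (quotient_algebra R I)" by blast
      qed simp
    qed
  next
    fix u v assume u: "u \<in> carrier (quotient_algebra R I)" and v: "v \<in> carrier (quotient_algebra R I)"
    obtain S where S: "S \<in> ?B" "u = I +>\<^bsub>R\<^esub> S" using u unfolding quotient_simps by blast
    obtain T where T: "T \<in> ?B" "v = I +>\<^bsub>R\<^esub> T" using v unfolding quotient_simps by blast
    have uS: "S' \<in> ?B \<and> symbol S' = symbol S" if "S' \<in> u" for S' using that coset_eq[OF S(1)] S(2) by auto
    have vT: "T' \<in> ?B \<and> symbol T' = symbol T" if "T' \<in> v" for T' using that coset_eq[OF T(1)] T(2) by auto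
    have ne: "S \<in> u" "T \<in> v" using mem S T by auto
    have "\<phi> (u \<oplus>\<^bsub>quotient_algebra R I\<^esub> v) = \<Theta> (\<lambda>s r. symbol S s r + symbol T s r)"
    proof (rule \<phi>)
      show "u \<oplus>\<^bsub>quotient_algebra R I\<^esub> v \<noteq> {}" unfolding quotient_simps using ne by blast
      fix L assume "L \<in> u \<oplus>\<^bsub>quotient_algebra R I\<^esub> v"
      then obtain S' T' where "S' \<in> u" "T' \<in> v" "L = (\<lambda>f x. S' f x + T' f x)"
        unfolding quotient_simps by blast
      then show "symbol L = (\<lambda>s r. symbol S s r + symbol T s r)"
        using uS vT symbol_add by simp
    qed
    then show "\<phi> (u \<oplus>\<^bsub>quotient_algebra R I\<^esub> v) = \<phi> u + \<phi> v"
      unfolding S(2) T(2) \<phi>_coset[OF S(1)] \<phi>_coset[OF T(1)] \<Theta>_add .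
    have "\<phi> (u \<otimes>\<^bsub>quotient_algebra R I\<^esub> v) = \<Theta> (\<lambda>s r. \<Sum>t<m. symbol S s t * symbol T t r)"
    proof (rule \<phi>)
      have "S \<circ> T \<in> I +>\<^bsub>R\<^esub> (S \<circ> T)" by (intro mem comp_bounded_operators S T)
      then show "u \<otimes>\<^bsub>quotient_algebra R I\<^esub> v \<noteq> {}" unfolding quotient_simps using ne by blast
      fix L assume "L \<in> u \<otimes>\<^bsub>quotient_algebra R I\<^esub> v"
      then obtain S' T' where S': "S' \<in> u" and T': "T' \<in> v" and L: "L \<in> I +>\<^bsub>R\<^esub> (S' \<circ> T')"
        unfolding quotient_simps by blast
      then have "symbol L = symbol (S' \<circ> T')"
        using coset_eq[OF comp_bounded_operators[of S' T']] uS vT by auto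
      then show "symbol L = (\<lambda>s r. \<Sum>t<m. symbol S s t * symbol T t r)"
        using uS[OF S'] vT[OF T'] symbol_comp by simp
    qed
    then show "\<phi> (u \<otimes>\<^bsub>quotient_algebra R I\<^esub> v) = \<phi> u * \<phi> v"
      unfolding S(2) T(2) \<phi>_coset[OF S(1)] \<phi>_coset[OF T(1)]
        \<Theta>_mult[OF supported_symbol[OF S(1)] supported_symbol[OF T(1)]] .
  next
    fix a u assume u: "u \<in> carrier (quotient_algebra R I)"
    obtain T where T: "T \<in> ?B" "u = I +>\<^bsub>R\<^esub> T" using u unfolding quotient_simps by blast
    have uT: "T' \<in> ?B \<and> symbol T' = symbol T" if "T' \<in> u" for T' using that coset_eq[OF T(1)] T(2) by auto
    have "\<phi> (a \<odot>\<^bsub>quotient_algebra R I\<^esub> u) = \<Theta> (\<lambda>s r. a * symbol T s r)"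
    proof (rule \<phi>)
      have "T \<in> u" using mem T by auto
      moreover have "(\<lambda>f x. a * T f x) \<in> I +>\<^bsub>R\<^esub> (\<lambda>f x. a * T f x)" by (intro mem cmult_bounded T)
      ultimately show "a \<odot>\<^bsub>quotient_algebra R I\<^esub> u \<noteq> {}" unfolding quotient_simps by blast
      fix L assume "L \<in> a \<odot>\<^bsub>quotient_algebra R I\<^esub> u"
      then obtain T' where T': "T' \<in> u" and L: "L \<in> I +>\<^bsub>R\<^esub> (\<lambda>f x. a * T' f x)"
        unfolding quotient_simps by blast
      then have "symbol L = symbol (\<lambda>f x. a * T' f x)"
        using coset_eq[OF cmult_bounded[of T' a]] uT by auto
      then show "symbol L = (\<lambda>s r. a * symbol T s r)" using uT[OF T'] symbol_cmult by simp
    qed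
    then show "\<phi> (a \<odot>\<^bsub>quotient_algebra R I\<^esub> u) = scale a (\<phi> u)"
      unfolding T(2) \<phi>_coset[OF T(1)] \<Theta>_cmult .
  qed
  then show ?thesis using ad_copies by blast
qed

end
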